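(* Let $C$ be a circle of perimeter $1$, let $L$ be a line segment of length $\tfrac12$, and let $R$ be a rectangle of size $0.1727\times 0.3273$. If $S\subset\mathbb{R}^2$ is a convex set which contains a copy of each of $C$, $L$ and $R$ obtained by some rotation and translation (possibly different for each of the three shapes), then the area of $S$ is at least $0.1$.
   Context: A "convex cover" for a family of plane figures is a convex set in which each figure of the family can be placed after a suitable rotation and translation. *)

theory Defs
  imports "HOL-Analysis.Analysis"
begin

text \<open>The plane is modelled as the complex numbers. A rigid motion consisting of a
rotation followed by a translation is z \<mapsto> u*z + t with |u| = 1.\<close>

definition rot_trans_copy :: "complex set \<Rightarrow> complex set \<Rightarrow> bool" where
  "rot_trans_copy X Y \<longleftrightarrow> (\<exists>u t. norm u = 1 \<and> Y = (\<lambda>z. u * z + t) ` X)"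

definition contains_copy :: "complex set \<Rightarrow> complex set \<Rightarrow> bool" where
  "contains_copy S X \<longleftrightarrow> (\<exists>Y. rot_trans_copy X Y \<and> Y \<subseteq> S)"

definition circ1 :: "complex set" where
  "circ1 = sphere 0 (1 / (2 * pi))"

definition seg_half :: "complex set" where
  "seg_half = closed_segment 0 (1/2)"

definition rect :: "complex set" where
  "rect = {z. 0 \<le> Re z \<and> Re z \<le> 0.1727 \<and> 0 \<le> Im z \<and> Im z \<le> 0.3273}"

end

theory Submission
  imports Defs
begin

text \<open>
  Measure lengths in units of \<open>10\<^sup>-\<^sup>5\<close> and put the centre of the disk at 0 and the sides of the rectangle
  parallel to the axes. A configuration is then given by the centre \<open>y\<close> of the rectangle and the end
  points \<open>x + e\<close>, \<open>x - e\<close> of the segment. The smallest possible area is about \<open>0.10044\<close>, so that there is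
  little room, and the proof is a branch and bound search over these five parameters.

  The lower bounds come from closed polygons whose vertices are chosen among the segment ends, the corners
  of the rectangle and the vertices of an inscribed 120-gon of the disk. If such a polygon splits into a chain
  running to the left and a chain running to the right, then its shoelace sum is at most twice the area of
  the convex set: by Fubini it suffices to compare the two chains on every vertical line. For a fixed choice
  of vertices the shoelace sum is affine in each of \<open>x\<close>, \<open>y\<close>, \<open>e\<close> separately, so that its error as a bound on a small
  box is of second order; this keeps the search down to about 2000 boxes. Since a shorter parallel segment
  with the same midpoint lies in the set too, an arc of directions \<open>e\<close> may be replaced by its chord.
\<close>

section \<open>Shoelace sums and area\<close>

text \<open>The hull of the three figures has no uniform description, since its vertex sequence
  changes with the configuration. A certificate therefore fixes one vertex sequence for a whole box
  and asks only that its two chains stay monotone there, which is a system of linear inequalities.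
  Such a polygon may be nonconvex or may even cross itself; its shoelace sum still bounds the area
  from below. The unit makes the data integral: half sides 16365 and 8635, half-length 25000, target
  area 10^9. Only the disk is irrational, hence the inscribed polygon with integer vertices. Every
  leaf of the search is then a statement about integers. The search space is bounded because a point
  at distance 34500 from the centre already spans enough area together with the disk. The symmetries
  of disk and rectangle and the exchange of the segment ends reduce the directions to a quarter turn
  and the rectangle centres to a half plane. Reflections are allowed in this reduction although the
  copies are not reflected, because area does not see them.\<close>

lemma lborel_complex_vec: "lborel = distr (lborel :: (real^2) measure) borel (\<lambda>v. Complex (v $ 1) (v $ 2))"
proof (rule lborel_eqI)
  have meas [measurable]: "(\<lambda>v::real^2. Complex (v $ 1) (v $ 2)) \<in> borel_measurable borel"
    unfolding Complex_eq by measurable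
  fix l u :: complex
  assume le: "\<And>b. b \<in> Basis \<Longrightarrow> l \<bullet> b \<le> u \<bullet> b"
  have "(\<lambda>v::real^2. Complex (v $ 1) (v $ 2)) -` box l u = box (vector [Re l, Im l]) (vector [Re u, Im u])"
    by (auto simp: box_def Basis_complex_def inner_axis Basis_vec_def inner_complex_def forall_2)
  then show "emeasure (distr (lborel :: (real^2) measure) borel (\<lambda>v. Complex (v $ 1) (v $ 2))) (box l u) =
      ennreal (\<Prod>b\<in>Basis. (u - l) \<bullet> b)"
    using le[of 1] le[of \<i>]
    by (simp add: emeasure_distr emeasure_lborel_box_eq Basis_vec_def inner_axis UNIV_2 Basis_complex_def
        inner_complex_def axis_eq_axis)
qed simp

lemma lborel_complex_prod: "lborel = distr (lborel \<Otimes>\<^sub>M lborel) borel (\<lambda>(x, y). Complex x y)"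
proof (rule lborel_eqI)
  have meas [measurable]: "(\<lambda>(x, y). Complex x y) \<in> borel_measurable (lborel \<Otimes>\<^sub>M lborel)"
    unfolding Complex_eq by measurable
  fix l u :: complex
  assume le: "\<And>b. b \<in> Basis \<Longrightarrow> l \<bullet> b \<le> u \<bullet> b"
  have "(\<lambda>(x, y). Complex x y) -` box l u = {Re l<..<Re u} \<times> {Im l<..<Im u}"
    by (auto simp: box_def Basis_complex_def inner_complex_def)
  then show "emeasure (distr (lborel \<Otimes>\<^sub>M lborel) borel (\<lambda>(x, y). Complex x y)) (box l u) =
      ennreal (\<Prod>b\<in>Basis. (u - l) \<bullet> b)"
    using le[of 1] le[of \<i>]
    by (simp add: emeasure_distr space_pair_measure lborel.emeasure_pair_measure_Times Basis_complex_def
        inner_complex_def ennreal_mult)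
qed simp

text \<open>The factor is the absolute determinant of \<open>f\<close> in the basis 1, \<i>.
  Conjugation with the coordinate map \<open>h\<close> carries the formula over from real vectors of
  dimension 2. It serves for the quarter turn, for the rotations and reflections of the reduction,
  and for the final change of unit.\<close>

lemma measure_linear_image_complex:
  fixes f :: "complex \<Rightarrow> complex"
  assumes f: "linear f" and T: "compact T"
  shows "measure lebesgue (f ` T) =
    \<bar>Re (f 1) * Im (f \<i>) - Im (f 1) * Re (f \<i>)\<bar> * measure lebesgue T"
proof -
  define h where "h = (\<lambda>v::real^2. Complex (v $ 1) (v $ 2))"
  define k where "k = (\<lambda>z. vector [Re z, Im z] :: real^2)"
  have hk: "h (k z) = z" and kh: "k (h v) = v" for z v
    by (auto simp: h_def k_def vec_eq_iff forall_2)
  have linh: "linear h" and link: "linear k"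
    by (auto intro!: linearI simp: h_def k_def vec_eq_iff forall_2 complex_eq_iff)
  have compact_image: "compact (p ` A)" if "linear p" "compact A" for p :: "'x::euclidean_space \<Rightarrow> 'y::euclidean_space" and A
    using that by (intro compact_continuous_image linear_continuous_on) (auto simp: linear_conv_bounded_linear)
  have hmeas: "h \<in> borel_measurable borel"
    unfolding h_def Complex_eq by measurable
  have eq: "measure lebesgue (k ` A) = measure lebesgue A" if A: "compact A" for A
  proof -
    have A': "A \<in> sets borel" using A borel_compact by blast
    have kA: "compact (k ` A)" using compact_image[OF link A] .
    have "measure lebesgue A = measure lborel A"
      using A' by (simp add: measure_completion)
    also have "\<dots> = measure (distr (lborel :: (real^2) measure) borel h) A"
      using lborel_complex_vec by (simp add: h_def)
    also have "\<dots> = measure lborel (h -` A)"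
      using A' hmeas by (simp add: measure_distr)
    also have "h -` A = k ` A"
      using hk kh by (auto simp: image_iff) metis
    also have "measure lborel (k ` A) = measure lebesgue (k ` A)"
      using borel_compact[OF kA] by (simp add: measure_completion)
    finally show ?thesis by simp
  qed
  define g where "g = k \<circ> f \<circ> h"
  have ling: "linear g"
    unfolding g_def using linh link f by (intro linear_compose)
  have fT: "compact (f ` T)" using compact_image[OF f T] .
  have "k ` (f ` T) = g ` (k ` T)"
    by (simp add: g_def image_image hk)
  then have "measure lebesgue (f ` T) = measure lebesgue (g ` (k ` T))"
    using eq[OF fT] by simp
  also have "\<dots> = \<bar>det (matrix g)\<bar> * measure lebesgue (k ` T)"
    using ling compact_image[OF link T] by (intro measure_linear_image lmeasurable_compact)
  also have "det (matrix g) = Re (f 1) * Im (f \<i>) - Im (f 1) * Re (f \<i>)"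
  proof -
    have "h (axis 1 1) = 1" "h (axis 2 1) = \<i>"
      by (auto simp: h_def axis_def complex_eq_iff)
    then show ?thesis
      by (simp add: det_2 matrix_def g_def k_def)
  qed
  finally show ?thesis by (simp add: eq[OF T])
qed

text \<open>Fubini, phrased with \<open>has_integral\<close> so that it can be compared with
  elementary integrals of piecewise linear functions. Compactness makes every slice finite, so that
  passing from \<open>emeasure\<close> to \<open>measure\<close> loses nothing.\<close>

lemma measure_compact_complex_slices:
  fixes S :: "complex set"
  assumes S: "compact S"
  shows "((\<lambda>t. measure lborel {s. Complex t s \<in> S}) has_integral measure lebesgue S) UNIV"
proof -
  define g where "g = (\<lambda>t. measure lborel {s. Complex t s \<in> S})"
  have S': "S \<in> sets borel" using S borel_compact by blast
  have meas [measurable]: "(\<lambda>(x, y). Complex x y) \<in> borel_measurable (lborel \<Otimes>\<^sub>M lborel)"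
    unfolding Complex_eq by measurable
  let ?V = "(\<lambda>(x, y). Complex x y) -` S \<inter> space (lborel \<Otimes>\<^sub>M lborel)"
  have V: "?V \<in> sets (lborel \<Otimes>\<^sub>M lborel)"
    using meas S' by (rule measurable_sets)
  have slice: "Pair t -` ?V = {s. Complex t s \<in> S}" for t
    by (auto simp: space_pair_measure)
  have fin: "emeasure lborel {s. Complex t s \<in> S} < \<infinity>" for t
  proof -
    obtain B where B: "\<And>z. z \<in> S \<Longrightarrow> cmod z \<le> B"
      using S compact_imp_bounded bounded_iff by metis
    have "{s. Complex t s \<in> S} \<subseteq> cball 0 B"
    proof
      fix s assume "s \<in> {s. Complex t s \<in> S}"
      then have "cmod (Complex t s) \<le> B" using B by auto
      then show "s \<in> cball 0 B" using abs_Im_le_cmod[of "Complex t s"] by auto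
    qed
    then show ?thesis by (metis bounded_cball bounded_subset emeasure_bounded_finite)
  qed
  have "emeasure lebesgue S = emeasure lborel S" using S' by simp
  also have "\<dots> = emeasure (distr (lborel \<Otimes>\<^sub>M lborel) borel (\<lambda>(x, y). Complex x y)) S"
    using lborel_complex_prod by simp
  also have "\<dots> = emeasure (lborel \<Otimes>\<^sub>M lborel) ?V"
    using S' by (simp add: emeasure_distr)
  also have "\<dots> = (\<integral>\<^sup>+t. emeasure lborel {s. Complex t s \<in> S} \<partial>lborel)"
    using V by (subst lborel.emeasure_pair_measure_alt) (simp_all only: slice)
  also have "\<dots> = (\<integral>\<^sup>+t. ennreal (g t) \<partial>lborel)"
    using fin by (intro nn_integral_cong) (simp add: g_def emeasure_eq_ennreal_measure less_top)
  finally have eq: "(\<integral>\<^sup>+t. ennreal (g t) \<partial>lborel) = ennreal (measure lebesgue S)"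
    using S by (simp add: emeasure_eq_measure2 lmeasurable_compact)
  have "(\<lambda>t. emeasure lborel (Pair t -` ?V)) \<in> borel_measurable lborel"
    using V by (rule lborel.measurable_emeasure_Pair)
  then have [measurable]: "g \<in> borel_measurable lborel"
    unfolding g_def measure_def slice by measurable
  have "(g has_integral measure lebesgue S) UNIV"
    using eq by (intro nn_integral_has_integral) (simp_all add: g_def[abs_def, symmetric], simp add: g_def)
  then show ?thesis by (simp add: g_def)
qed


section \<open>Shoelace sums of chains and the area between two chains\<close>

definition cross :: "complex \<Rightarrow> complex \<Rightarrow> real" where
  "cross z w = Re z * Im w - Im z * Re w"

text \<open>\<open>cross\<close> is twice the signed area of the triangle formed with the origin.
  The chain is left open; for a closed polygon the first vertex is repeated at the end.\<close>

fun cross_sum :: "complex list \<Rightarrow> real" where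
  "cross_sum (z # w # zs) = cross z w + cross_sum (w # zs)"
| "cross_sum _ = 0"

lemma cross_sum_append:
  "xs \<noteq> [] \<Longrightarrow> ys \<noteq> [] \<Longrightarrow> cross_sum (xs @ ys) = cross_sum xs + cross (last xs) (hd ys) + cross_sum ys"
proof (induction xs rule: cross_sum.induct)
  case ("2_2" v)
  then show ?case by (cases ys) auto
qed auto

lemma cross_sum_rev: "cross_sum (rev xs) = - cross_sum xs"
proof (induction xs rule: cross_sum.induct)
  case (1 z w zs)
  have "cross_sum (rev (w # zs) @ [z]) = cross_sum (rev (w # zs)) + cross w z"
    by (subst cross_sum_append) (auto simp: last_rev)
  with 1 show ?case by (simp add: cross_def)
qed auto

text \<open>The piecewise linear function through points with increasing real parts. On a vertical
  edge the denominator is 0, hence the quotient is 0 and the value is \<open>Im z\<close>, still a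
  point of the chain.\<close>

fun interpol :: "complex list \<Rightarrow> real \<Rightarrow> real" where
  "interpol (z # w # zs) t =
    (if t \<le> Re w then Im z + (t - Re z) / (Re w - Re z) * (Im w - Im z) else interpol (w # zs) t)"
| "interpol [z] t = Im z"
| "interpol [] t = 0"

lemma interpol_in_convex:
  assumes "convex S" "set zs \<subseteq> S" "zs \<noteq> []" "sorted (map Re zs)" "Re (hd zs) \<le> t" "t \<le> Re (last zs)"
  shows "Complex t (interpol zs t) \<in> S"
  using assms(2-)
proof (induction zs t rule: interpol.induct)
  case (1 z w zs t)
  show ?case
  proof (cases "t \<le> Re w")
    case True
    define k where "k = (t - Re z) / (Re w - Re z)"
    have "0 \<le> k" "k \<le> 1" "t = Re z + k * (Re w - Re z)"
      using True 1 by (auto simp: k_def divide_simps)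
    moreover have "Complex t (interpol (z # w # zs) t) = (1 - k) *\<^sub>R z + k *\<^sub>R w"
      using True \<open>t = _\<close> by (simp add: complex_eq_iff k_def[symmetric] algebra_simps)
    ultimately show ?thesis
      using convexD_alt[OF assms(1), of z w k] 1(2) by simp
  qed (use 1 in auto)
next
  case (2 z t)
  then have "Complex t (Im z) = z" by (simp add: complex_eq_iff)
  with 2 show ?case by simp
qed auto

text \<open>Twice the trapezoid under the edge from \<open>z\<close> to \<open>w\<close> is
  \<open>(Re w - Re z) * (Im z + Im w)\<close>, which equals
  \<open>Re w * Im w - Re z * Im z - cross z w\<close>; the products of coordinates telescope along
  the chain.\<close>

lemma has_integral_interpol:
  assumes "zs \<noteq> []" "sorted (map Re zs)"
  shows "(interpol zs has_integral
      (Re (last zs) * Im (last zs) - Re (hd zs) * Im (hd zs) - cross_sum zs) / 2) {Re (hd zs)..Re (last zs)}"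
  using assms
proof (induction zs rule: cross_sum.induct)
  case (1 z w zs)
  let ?l = "last (w # zs)"
  define k where "k = (Im w - Im z) / (Re w - Re z)"
  have le: "Re z \<le> Re w" "Re w \<le> Re ?l"
    using 1(3) by (cases "zs = []", auto)
  define G where "G = (\<lambda>t. Im z * t + k * (t - Re z)\<^sup>2 / 2)"
  have "((\<lambda>t. Im z + k * (t - Re z)) has_integral G (Re w) - G (Re z)) {Re z..Re w}"
    unfolding G_def using le by (intro fundamental_theorem_of_calculus)
      (auto simp: has_real_derivative_iff_has_vector_derivative[symmetric] intro!: derivative_eq_intros)
  moreover have "G (Re w) - G (Re z) = (Re w - Re z) * (Im z + Im w) / 2"
  proof (cases "Re w = Re z")
    case False
    then have "k * (Re w - Re z) = Im w - Im z" by (simp add: k_def)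
    then have "k * (Re w - Re z)\<^sup>2 = (Im w - Im z) * (Re w - Re z)" by (simp add: power2_eq_square)
    then show ?thesis by (simp add: G_def algebra_simps)
  qed simp
  ultimately have "((\<lambda>t. Im z + k * (t - Re z)) has_integral (Re w - Re z) * (Im z + Im w) / 2) {Re z..Re w}"
    by simp
  then have I1: "(interpol (z # w # zs) has_integral (Re w - Re z) * (Im z + Im w) / 2) {Re z..Re w}"
    by (rule has_integral_eq[rotated]) (simp add: k_def)
  have "(interpol (w # zs) has_integral (Re ?l * Im ?l - Re w * Im w - cross_sum (w # zs)) / 2) {Re w..Re ?l}"
    using 1 by simp
  \<comment> \<open>Beyond \<open>Re w\<close> both functions follow the same edges. At
    \<open>Re w\<close> itself they differ if the first edge is vertical with distinct ends, so a
    single point is exempted.\<close>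
  then have I2: "(interpol (z # w # zs) has_integral (Re ?l * Im ?l - Re w * Im w - cross_sum (w # zs)) / 2) {Re w..Re ?l}"
    by (rule has_integral_spike[of "{Re w}", rotated 2]) auto
  have eq: "(Re w - Re z) * (Im z + Im w) / 2 + (Re ?l * Im ?l - Re w * Im w - cross_sum (w # zs)) / 2
      = (Re ?l * Im ?l - Re z * Im z - cross_sum (z # w # zs)) / 2"
    by (simp add: cross_def field_simps)
  have "last (z # w # zs) = ?l" "hd (z # w # zs) = z" by simp_all
  then show ?case
    using has_integral_combine[OF le I1 I2] eq by (simp only:)
next
  case ("2_2" v)
  then show ?case using has_integral_refl(2)[of "\<lambda>_. Im v" "Re v"] by simp
qed simp

text \<open>With common ends the coordinate products cancel in the difference of the two integrals.
  On each vertical line the two chain points span a segment inside the slice, so the slice is at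
  least as long as the absolute difference of the heights; the chains may even cross.\<close>

lemma cross_sum_diff_le_measure:
  assumes S: "compact S" "convex S"
    and A: "set A \<subseteq> S" "A \<noteq> []" "sorted (map Re A)"
    and B: "set B \<subseteq> S" "B \<noteq> []" "sorted (map Re B)"
    and ends: "hd A = hd B" "last A = last B"
  shows "cross_sum B - cross_sum A \<le> 2 * measure lebesgue S"
proof -
  define g where "g = (\<lambda>t. measure lborel {s. Complex t s \<in> S})"
  define I where "I = {Re (hd A)..Re (last A)}"
  have g: "(g has_integral measure lebesgue S) UNIV"
    unfolding g_def by (rule measure_compact_complex_slices[OF S(1)])
  have gI: "g integrable_on I"
    using g integrable_on_subinterval[of g UNIV] unfolding I_def by (auto simp: integrable_on_def)
  have d: "((\<lambda>t. interpol A t - interpol B t) has_integral (cross_sum B - cross_sum A) / 2) I"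
    using has_integral_diff[OF has_integral_interpol[OF A(2,3)] has_integral_interpol[OF B(2,3), folded ends]]
    by (simp add: I_def ends diff_divide_distrib[symmetric])
  have "(cross_sum B - cross_sum A) / 2 \<le> integral I g"
  proof (rule has_integral_le[OF d integrable_integral[OF gI]])
    fix t assume t: "t \<in> I"
    have in_S: "Complex t (interpol A t) \<in> S" "Complex t (interpol B t) \<in> S"
      using t A B S ends by (auto simp: I_def intro!: interpol_in_convex)
    let ?V = "{s. Complex t s \<in> S}"
    have cV: "convex ?V"
    proof (rule convexI)
      fix s s' u v :: real
      assume "s \<in> ?V" "s' \<in> ?V" and uv: "0 \<le> u" "0 \<le> v" "u + v = 1"
      then have "u *\<^sub>R Complex t s + v *\<^sub>R Complex t s' \<in> S"
        using S(2) by (auto simp: convex_def)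
      moreover have "u *\<^sub>R Complex t s + v *\<^sub>R Complex t s' = Complex t (u *\<^sub>R s + v *\<^sub>R s')"
        using uv by (simp add: complex_eq_iff distrib_right[symmetric])
      ultimately show "u *\<^sub>R s + v *\<^sub>R s' \<in> ?V" by simp
    qed
    have bV: "bounded ?V"
    proof -
      obtain b where "\<And>z. z \<in> S \<Longrightarrow> cmod z \<le> b"
        using S compact_imp_bounded bounded_iff by metis
      then have "\<bar>s\<bar> \<le> b" if "s \<in> ?V" for s
        using that abs_Im_le_cmod[of "Complex t s"] by (force intro: order_trans)
      then show ?thesis by (auto simp: bounded_iff)
    qed
    have clV: "closed ?V"
    proof -
      have "?V = (\<lambda>s. Complex t s) -` S" by auto
      moreover have "continuous_on UNIV (\<lambda>s. Complex t s)"
        unfolding Complex_eq by (intro continuous_intros)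
      ultimately show ?thesis
        using compact_imp_closed[OF S(1)] continuous_closed_vimage by (metis continuous_on_eq_continuous_at open_UNIV UNIV_I)
    qed
    have sub: "closed_segment (interpol B t) (interpol A t) \<subseteq> ?V"
      using cV in_S by (simp add: convex_contains_segment)
    have "\<bar>interpol A t - interpol B t\<bar> = measure lborel (closed_segment (interpol B t) (interpol A t))"
      by (auto simp: closed_segment_eq_real_ivl)
    also have "\<dots> \<le> measure lborel ?V"
      using sub clV emeasure_bounded_finite[OF bV] by (intro measure_mono_fmeasurable)
        (auto simp: fmeasurable_def closed_segment_eq_real_ivl)
    finally show "interpol A t - interpol B t \<le> g t" by (simp add: g_def)
  qed
  also have "\<dots> \<le> integral UNIV g"
    using g gI by (intro integral_subset_le) (auto simp: g_def integrable_on_def)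
  also have "\<dots> = measure lebesgue S"
    using g by (rule integral_unique)
  finally show ?thesis by simp
qed

lemma sorted_map_hd_last:
  assumes "sorted (map f xs)" "x \<in> set xs"
  shows "f (hd xs) \<le> f x" "f x \<le> f (last xs)"
  using assms by (induction xs) auto

text \<open>\<open>as\<close> runs to the left and \<open>bs\<close> to the right, possibly with
  different ends. The closed polygon also contains the two edges linking the chains, and each of
  these can be attached to one of the chains without spoiling monotonicity.\<close>

lemma shoelace_le_measure:
  assumes S: "compact S" "convex S" "set as \<subseteq> S" "set bs \<subseteq> S"
    and ne: "as \<noteq> []" "bs \<noteq> []"
    and sorted: "sorted (map Re (rev as))" "sorted (map Re bs)"
  shows "cross_sum (as @ bs @ [hd as]) \<le> 2 * measure lebesgue S"
proof -
  define a0 a1 b0 b1 where "a0 = last as" "a1 = hd as" "b0 = hd bs" "b1 = last bs"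
  have in_S: "a0 \<in> S" "a1 \<in> S" "b0 \<in> S" "b1 \<in> S"
    using S ne by (auto simp: a0_a1_b0_b1_def)
  have bd: "Re a0 \<le> Re z" "Re z \<le> Re a1" if "z \<in> set as" for z
    using that sorted_map_hd_last[OF sorted(1), of z] ne by (auto simp: a0_a1_b0_b1_def hd_rev last_rev)
  have bd': "Re b0 \<le> Re z" "Re z \<le> Re b1" if "z \<in> set bs" for z
    using that sorted_map_hd_last[OF sorted(2), of z] by (auto simp: a0_a1_b0_b1_def)
  have ab: "Re a0 \<le> Re a1" "Re b0 \<le> Re b1"
    using bd[of a1] bd'[of b1] ne by (auto simp: a0_a1_b0_b1_def)
  \<comment> \<open>On either side the end lying further out is added to the other chain. The
    linking edge becomes an edge of that chain, and both chains then end at the same point.\<close>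
  define A1 where "A1 = (if Re a0 \<le> Re b0 then rev as else b0 # rev as)"
  define A2 where "A2 = (if Re a1 \<le> Re b1 then A1 @ [b1] else A1)"
  define B1 where "B1 = (if Re a0 \<le> Re b0 then a0 # bs else bs)"
  define B2 where "B2 = (if Re a1 \<le> Re b1 then B1 else B1 @ [a1])"
  have "cross_sum B2 - cross_sum A2 \<le> 2 * measure lebesgue S"
  proof (rule cross_sum_diff_le_measure[OF S(1,2)])
    show "set A2 \<subseteq> S" "set B2 \<subseteq> S" "A2 \<noteq> []" "B2 \<noteq> []"
      using S in_S ne by (auto simp: A2_def A1_def B2_def B1_def)
    show "sorted (map Re A2)" "sorted (map Re B2)"
      using sorted bd bd' ab
      by (fastforce simp: A2_def A1_def B2_def B1_def sorted_append)+
    show "hd A2 = hd B2" "last A2 = last B2"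
      using ne by (auto simp: A2_def A1_def B2_def B1_def a0_a1_b0_b1_def hd_rev last_rev)
  qed
  moreover have "cross_sum (as @ bs @ [hd as]) = cross_sum as + cross a0 b0 + cross_sum bs + cross b1 a1"
    using ne by (simp add: cross_sum_append a0_a1_b0_b1_def)
  moreover have "cross_sum B2 - cross_sum A2 = cross_sum as + cross a0 b0 + cross_sum bs + cross b1 a1"
  proof -
    have "cross_sum A1 = - cross_sum as + (if Re a0 \<le> Re b0 then 0 else cross b0 a0)"
      using ne cross_sum_append[of "[b0]" "rev as"] by (simp add: A1_def cross_sum_rev hd_rev a0_a1_b0_b1_def)
    moreover have "cross_sum B1 = cross_sum bs + (if Re a0 \<le> Re b0 then cross a0 b0 else 0)"
      using ne cross_sum_append[of "[a0]" "bs"] by (simp add: B1_def a0_a1_b0_b1_def)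
    moreover have "cross_sum A2 = cross_sum A1 + (if Re a1 \<le> Re b1 then cross a1 b1 else 0)"
      using ne cross_sum_append[of A1 "[b1]"] by (simp add: A2_def A1_def last_rev a0_a1_b0_b1_def)
    moreover have "cross_sum B2 = cross_sum B1 + (if Re a1 \<le> Re b1 then 0 else cross b1 a1)"
      using ne cross_sum_append[of B1 "[a1]"] by (simp add: B2_def B1_def a0_a1_b0_b1_def)
    ultimately show ?thesis by (simp add: cross_def)
  qed
  ultimately show ?thesis by simp
qed

section \<open>Polygons depending on the configuration\<close>

text \<open>
  \<open>Arc i j\<close> stands for the vertices \<open>i, \<dots>, j\<close> of the 120-gon, \<open>LP\<close> and \<open>LQ\<close> for \<open>x + e\<close> and \<open>x - e\<close>, and
  \<open>K1, \<dots>, K4\<close> for the corners of the rectangle. \<open>Aff a b p q r\<close> is the point \<open>(a, b) + p x + q y + r e\<close>.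
  The numbers in \<open>Form\<close> are the coefficients in \<open>eval_form\<close> below.
\<close>

datatype vertex = Arc nat nat | LP | LQ | K1 | K2 | K3 | K4
datatype affpt = Aff int int int int int
datatype form = Form int int int int int int int int int int

text \<open>A constraint \<open>(p, q, r, c)\<close> stands for \<open>p x + q y + r e \<ge> c\<close> in one coordinate.\<close>

type_synonym constr = "int \<times> int \<times> int \<times> int"

text \<open>
  The flag selects the coordinate (\<open>True\<close> for the imaginary part) in which the two chains are monotone; the
  form is the shoelace sum, and the constraints express that the chains are monotone.
\<close>

datatype polygon = Polygon bool form "constr list"

text \<open>
  A leaf names a polygon. The other nodes halve the box in one coordinate, the number being the new
  half-width, or split the list of directions.
\<close>

datatype tree = L nat | X1 int tree tree | X2 int tree tree | Y1 int tree tree | Y2 int tree tree | E nat tree tree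

text \<open>
  The entries of \<open>ctab\<close> are the coordinates of a vertex of the 120-gon and the shoelace sum up to there;
  vertices 120 to 150 repeat vertices 0 to 30. The table is kept as a parameter, for otherwise \<open>code_simp\<close>
  would normalize it anew at every access.
\<close>

context
  fixes ctab :: "(int \<times> int \<times> int) list"
begin

text \<open>The compact witness avoids the default value 0 of \<open>measure\<close> on sets of
  infinite area, since \<open>S\<close> may be unbounded. The bound is 0.1 expressed in squares of
  the unit.\<close>

definition big :: "complex set \<Rightarrow> bool" where
  "big S \<longleftrightarrow> (\<exists>T\<subseteq>S. compact T \<and> measure lebesgue T \<ge> 10 ^ 9)"

text \<open>The long side of the rectangle is horizontal; 16365 and 8635 are its half sides. The
  length of \<open>e\<close> is kept out of the definition and given separately as
  \<open>cmod e = 25000\<close>, so that shortened segments are configurations too.\<close>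

definition config :: "complex set \<Rightarrow> complex \<Rightarrow> complex \<Rightarrow> complex \<Rightarrow> bool" where
  "config S x y e \<longleftrightarrow> convex S \<and> cball 0 (10 ^ 5 / (2 * pi)) \<subseteq> S \<and> x + e \<in> S \<and> x - e \<in> S \<and>
    y + Complex 16365 8635 \<in> S \<and> y + Complex (- 16365) 8635 \<in> S \<and>
    y + Complex (- 16365) (- 8635) \<in> S \<and> y + Complex 16365 (- 8635) \<in> S"

definition circle_x :: "nat \<Rightarrow> int" where "circle_x i = fst (ctab ! i)"
definition circle_y :: "nat \<Rightarrow> int" where "circle_y i = fst (snd (ctab ! i))"
definition circle_sum :: "nat \<Rightarrow> int" where "circle_sum i = snd (snd (ctab ! i))"
definition circle_pt :: "nat \<Rightarrow> complex" where "circle_pt i = Complex (circle_x i) (circle_y i)"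

text \<open>The bound is \<open>\<lfloor>(10\<^sup>5 / (2 \<pi>))\<^sup>2\<rfloor>\<close>.\<close>

definition ctab_ok :: bool where
  "ctab_ok \<longleftrightarrow> (\<forall>i\<le>150. circle_x i * circle_x i + circle_y i * circle_y i \<le> 253302959) \<and>
    (\<forall>i<150. circle_sum (Suc i) = circle_sum i + (circle_x i * circle_y (Suc i) - circle_y i * circle_x (Suc i))) \<and>
    (\<forall>i<60. circle_x (Suc i) \<le> circle_x i) \<and> (\<forall>i<120. 60 \<le> i \<longrightarrow> circle_x i \<le> circle_x (Suc i)) \<and>
    (\<forall>i<90. 30 \<le> i \<longrightarrow> circle_y (Suc i) \<le> circle_y i) \<and> (\<forall>i<150. 90 \<le> i \<longrightarrow> circle_y i \<le> circle_y (Suc i))"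

fun first :: "vertex \<Rightarrow> affpt" where
  "first (Arc i j) = Aff (circle_x i) (circle_y i) 0 0 0"
| "first LP = Aff 0 0 1 0 1"
| "first LQ = Aff 0 0 1 0 (-1)"
| "first K1 = Aff 16365 8635 0 1 0"
| "first K2 = Aff (-16365) 8635 0 1 0"
| "first K3 = Aff (-16365) (-8635) 0 1 0"
| "first K4 = Aff 16365 (-8635) 0 1 0"

fun final :: "vertex \<Rightarrow> affpt" where
  "final (Arc i j) = Aff (circle_x j) (circle_y j) 0 0 0"
| "final v = first v"

fun inner_sum :: "vertex \<Rightarrow> int" where
  "inner_sum (Arc i j) = circle_sum j - circle_sum i"
| "inner_sum v = 0"

fun eval_pt :: "complex \<Rightarrow> complex \<Rightarrow> complex \<Rightarrow> affpt \<Rightarrow> complex" where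
  "eval_pt x y e (Aff a b p q r) = Complex a b + of_int p * x + of_int q * y + of_int r * e"

fun points :: "complex \<Rightarrow> complex \<Rightarrow> complex \<Rightarrow> vertex \<Rightarrow> complex list" where
  "points x y e (Arc i j) = map circle_pt [i..<Suc j]"
| "points x y e v = [eval_pt x y e (first v)]"

text \<open>Since \<open>cross\<close> is alternating, the product of a variable with itself
  vanishes. What remains is a constant, one vector for each of \<open>x\<close>, \<open>y\<close>,
  \<open>e\<close>, and three mixed coefficients; this is why shoelace sums are affine in each
  variable separately.\<close>

fun cross_form :: "affpt \<Rightarrow> affpt \<Rightarrow> form" where
  "cross_form (Aff a b p q r) (Aff a' b' p' q' r') =
    Form (a * b' - b * a') (p * a' - p' * a) (p * b' - p' * b) (q * a' - q' * a) (q * b' - q' * b)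
      (r * a' - r' * a) (r * b' - r' * b) (p * q' - q * p') (r * q' - q * r') (p * r' - r * p')"

fun add_form :: "form \<Rightarrow> form \<Rightarrow> form" where
  "add_form (Form a b c d f g h i j k) (Form a' b' c' d' f' g' h' i' j' k') =
    Form (a + a') (b + b') (c + c') (d + d') (f + f') (g + g') (h + h') (i + i') (j + j') (k + k')"

fun eval_form :: "complex \<Rightarrow> complex \<Rightarrow> complex \<Rightarrow> form \<Rightarrow> real" where
  "eval_form x y e (Form c a b a' b' a'' b'' m n l) =
    c + cross x (Complex a b) + cross y (Complex a' b') + cross e (Complex a'' b'') + m * cross x y + n * cross e y + l * cross x e"

lemma eval_cross_form: "eval_form x y e (cross_form v w) = cross (eval_pt x y e v) (eval_pt x y e w)"
  by (cases v; cases w) (simp add: cross_def algebra_simps)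

lemma eval_add_form: "eval_form x y e (add_form c d) = eval_form x y e c + eval_form x y e d"
  by (cases c; cases d) (simp add: cross_def algebra_simps)

text \<open>An arc enters through a difference of two partial sums from the table, so that a long
  arc costs no more than a short one.\<close>

fun edges :: "vertex list \<Rightarrow> form" where
  "edges (v # w # vs) = add_form (add_form (Form (inner_sum v) 0 0 0 0 0 0 0 0 0) (cross_form (final v) (first w))) (edges (w # vs))"
| "edges [v] = Form (inner_sum v) 0 0 0 0 0 0 0 0 0"
| "edges [] = Form 0 0 0 0 0 0 0 0 0 0"

text \<open>Vertex 0 is the rightmost one and the numbering is counterclockwise, so the half turn
  starting at \<open>k\<close> runs to the left for 0, down for 30, to the right for 60 and up for
  90. The last case accounts for the 30 repeated entries of the table.\<close>

fun arc_ok :: "nat \<Rightarrow> vertex \<Rightarrow> bool" where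
  "arc_ok k (Arc i j) \<longleftrightarrow> k \<le> i \<and> i \<le> j \<and> j \<le> k + 60"
| "arc_ok k v \<longleftrightarrow> True"

lemma cross_sum_map_circle_pt:
  assumes "ctab_ok" "i \<le> j" "j \<le> 150"
  shows "cross_sum (map circle_pt [i..<Suc j]) = circle_sum j - circle_sum i"
  using assms(2,3)
proof (induction j)
  case (Suc j)
  show ?case
  proof (cases "i = Suc j")
    case False
    then have ij: "i \<le> j" using Suc by simp
    have "cross_sum (map circle_pt [i..<Suc j] @ [circle_pt (Suc j)]) = cross_sum (map circle_pt [i..<Suc j]) + cross (circle_pt j) (circle_pt (Suc j))"
      using ij by (subst cross_sum_append) auto
    moreover have "cross (circle_pt j) (circle_pt (Suc j)) = circle_sum (Suc j) - circle_sum j"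
      using assms(1) Suc by (simp add: ctab_ok_def cross_def circle_pt_def)
    ultimately show ?thesis
      using Suc ij by simp
  qed simp
qed (simp add: circle_pt_def)

lemma points_facts:
  assumes "ctab_ok" "arc_ok k v" "k \<le> 90"
  shows "points x y e v \<noteq> []" "hd (points x y e v) = eval_pt x y e (first v)" "last (points x y e v) = eval_pt x y e (final v)"
    "cross_sum (points x y e v) = inner_sum v"
proof -
  have "points x y e v \<noteq> [] \<and> hd (points x y e v) = eval_pt x y e (first v) \<and>
    last (points x y e v) = eval_pt x y e (final v) \<and> cross_sum (points x y e v) = inner_sum v"
  proof (cases v)
    case (Arc i j)
    then have ij: "i \<le> j" "j \<le> 150" using assms by auto
    then have "[i..<Suc j] \<noteq> []" "hd [i..<Suc j] = i" "last [i..<Suc j] = j"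
      using hd_upt[of i "Suc j"] by (simp_all add: hd_upt del: upt_Suc)
    then show ?thesis
      unfolding Arc using cross_sum_map_circle_pt[OF assms(1) ij]
      by (simp add: hd_map last_map circle_pt_def del: upt_Suc)
  qed simp_all
  then show "points x y e v \<noteq> []" "hd (points x y e v) = eval_pt x y e (first v)" "last (points x y e v) = eval_pt x y e (final v)"
    "cross_sum (points x y e v) = inner_sum v" by auto
qed

lemma points_list_facts:
  assumes "ctab_ok" "\<forall>v\<in>set vs. \<exists>k\<le>90. arc_ok k v" "vs \<noteq> []"
  shows "concat (map (points x y e) vs) \<noteq> []"
    "hd (concat (map (points x y e) vs)) = eval_pt x y e (first (hd vs))"
    "last (concat (map (points x y e) vs)) = eval_pt x y e (final (last vs))"
    "cross_sum (concat (map (points x y e) vs)) = eval_form x y e (edges vs)"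
  using assms(2,3)
proof (induction vs rule: edges.induct)
  case (1 v w vs)
  { case 1 then show ?case using points_facts[OF assms(1)] by auto }
  { case 2 then show ?case using points_facts[OF assms(1)] by (auto simp: hd_append) }
  { case 3
    then have "concat (map (points x y e) (w # vs)) \<noteq> []" using "1.IH"(1) by auto
    then have "last (points x y e v @ concat (map (points x y e) (w # vs))) = last (concat (map (points x y e) (w # vs)))"
      by (rule last_appendR)
    also have "\<dots> = eval_pt x y e (final (last (w # vs)))"
      by (rule "1.IH"(3)) (use 3 in simp_all)
    finally show ?case by (simp only: list.map concat.simps last_ConsR list.distinct not_False_eq_True) }
  { case 4 
    obtain k where k: "arc_ok k v" "k \<le> 90" using 4 by auto
    have "cross_sum (points x y e v @ concat (map (points x y e) (w # vs))) =
      inner_sum v + cross (eval_pt x y e (final v)) (eval_pt x y e (first w)) + eval_form x y e (edges (w # vs))"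
      using points_facts[OF assms(1) k, of x y e] "1.IH" 4 by (subst cross_sum_append) auto
    then show ?case by (simp add: eval_add_form eval_cross_form) (simp add: cross_def) }
next
  case (2 v)
  { case 1 then show ?case using points_facts[OF assms(1)] by auto }
  { case 2 then show ?case using points_facts[OF assms(1)] by (auto simp: hd_append) }
  { case 3 then show ?case using points_facts[OF assms(1)] by auto }
  { case 4 then show ?case using points_facts(4)[OF assms(1)] by (auto simp: cross_def) }
qed auto

fun order_constr :: "bool \<Rightarrow> affpt \<Rightarrow> affpt \<Rightarrow> constr" where
  "order_constr ax (Aff a b p q r) (Aff a' b' p' q' r') = (p' - p, q' - q, r' - r, (if ax then b - b' else a - a'))"

definition coord :: "bool \<Rightarrow> complex \<Rightarrow> real" where
  "coord ax z = (if ax then Im z else Re z)"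

fun holds :: "bool \<Rightarrow> complex \<Rightarrow> complex \<Rightarrow> complex \<Rightarrow> constr \<Rightarrow> bool" where
  "holds ax x y e (p, q, r, c) \<longleftrightarrow> c \<le> p * coord ax x + q * coord ax y + r * coord ax e"

lemma holds_order_constr: "holds ax x y e (order_constr ax v w) \<longleftrightarrow> coord ax (eval_pt x y e v) \<le> coord ax (eval_pt x y e w)"
  by (cases v; cases w) (simp add: coord_def algebra_simps)

text \<open>Inside an arc the table itself is monotone, so each joint between neighbouring vertices
  of the list contributes exactly one condition.\<close>

fun incr_cons :: "bool \<Rightarrow> vertex list \<Rightarrow> constr list" where
  "incr_cons ax (v # w # vs) = order_constr ax (final v) (first w) # incr_cons ax (w # vs)"
| "incr_cons ax vs = []"

fun decr_cons :: "bool \<Rightarrow> vertex list \<Rightarrow> constr list" where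
  "decr_cons ax (v # w # vs) = order_constr ax (first w) (final v) # decr_cons ax (w # vs)"
| "decr_cons ax vs = []"

text \<open>A constraint without variables, between two vertices of the same kind, needs no counterpart in the list.\<close>

fun implied :: "constr list \<Rightarrow> constr \<Rightarrow> bool" where
  "implied [] (p, q, r, c) \<longleftrightarrow> p = 0 \<and> q = 0 \<and> r = 0 \<and> c \<le> 0"
| "implied ((p', q', r', c') # cs) (p, q, r, c) \<longleftrightarrow>
    (p' = p \<and> q' = q \<and> r' = r \<and> c \<le> c') \<or> implied cs (p, q, r, c)"

lemma implied_holds: "implied cs c \<Longrightarrow> list_all (holds ax x y e) cs \<Longrightarrow> holds ax x y e c"
  by (induction cs c rule: implied.induct) auto

text \<open>Form and constraints are stored with the polygon so that a leaf reads them off instead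
  of expanding the vertices again; here they are recomputed and compared once per polygon. One
  stored constraint may cover several joints with the same coefficients.\<close>

definition polygon_ok :: "vertex list \<Rightarrow> vertex list \<Rightarrow> polygon \<Rightarrow> bool" where
  "polygon_ok as bs p = (case p of Polygon ax c cs \<Rightarrow>
     as \<noteq> [] \<and> bs \<noteq> [] \<and>
     list_all (arc_ok (if ax then 30 else 0)) as \<and> list_all (arc_ok (if ax then 90 else 60)) bs \<and>
     list_all (implied cs) (decr_cons ax as) \<and> list_all (implied cs) (incr_cons ax bs) \<and>
     c = add_form (edges (as @ bs)) (cross_form (final (last bs)) (first (hd as))))"

definition sound :: "polygon \<Rightarrow> bool" where
  "sound p = (case p of Polygon ax c cs \<Rightarrow> \<forall>S x y e. config S x y e \<longrightarrow> list_all (holds ax x y e) cs \<longrightarrow>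
     (\<exists>T\<subseteq>S. compact T \<and> eval_form x y e c \<le> 2 * measure lebesgue T))"

section \<open>From monotone chains to sound polygons\<close>

lemma sorted_concat_incr:
  assumes "list_all (holds ax x y e) (incr_cons ax vs)"
    and "\<And>v. v \<in> set vs \<Longrightarrow> sorted (map (coord ax) (points x y e v)) \<and> points x y e v \<noteq> [] \<and>
      hd (points x y e v) = eval_pt x y e (first v) \<and> last (points x y e v) = eval_pt x y e (final v)"
  shows "sorted (map (coord ax) (concat (map (points x y e) vs)))"
  using assms
proof (induction ax vs rule: incr_cons.induct)
  case (1 ax v w vs)
  let ?r = "concat (map (points x y e) (w # vs))"
  have sr: "sorted (map (coord ax) ?r)" using 1 by auto
  have v: "sorted (map (coord ax) (points x y e v))" using 1 by auto
  have "coord ax a \<le> coord ax b" if "a \<in> set (points x y e v)" "b \<in> set ?r" for a b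
  proof -
    have "coord ax a \<le> coord ax (eval_pt x y e (final v))"
      using sorted_map_hd_last(2)[OF v that(1)] 1(3)[of v] by simp
    also have "\<dots> \<le> coord ax (eval_pt x y e (first w))"
      using 1(2) by (simp add: holds_order_constr)
    also have "\<dots> \<le> coord ax b"
      using sorted_map_hd_last(1)[OF sr that(2)] 1(3)[of w] by simp
    finally show ?thesis .
  qed
  then show ?case using sr v by (auto simp: sorted_append)
next
  case ("2_2" ax v)
  then show ?case by auto
qed auto

lemma sorted_concat_decr:
  assumes "list_all (holds ax x y e) (decr_cons ax vs)"
    and "\<And>v. v \<in> set vs \<Longrightarrow> sorted (rev (map (coord ax) (points x y e v))) \<and> points x y e v \<noteq> [] \<and>
      hd (points x y e v) = eval_pt x y e (first v) \<and> last (points x y e v) = eval_pt x y e (final v)"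
  shows "sorted (rev (map (coord ax) (concat (map (points x y e) vs))))"
  using assms
proof (induction ax vs rule: decr_cons.induct)
  case (1 ax v w vs)
  let ?r = "concat (map (points x y e) (w # vs))"
  have sr: "sorted (map (coord ax) (rev ?r))" using 1 by (auto simp: rev_map)
  have v: "sorted (map (coord ax) (rev (points x y e v)))" using 1 by (auto simp: rev_map)
  have "coord ax b \<le> coord ax a" if "a \<in> set (points x y e v)" "b \<in> set ?r" for a b
  proof -
    have "coord ax b \<le> coord ax (eval_pt x y e (first w))"
      using sorted_map_hd_last(2)[OF sr, of b] that 1(3)[of w] by (auto simp: last_rev)
    also have "\<dots> \<le> coord ax (eval_pt x y e (final v))"
      using 1(2) by (simp add: holds_order_constr)
    also have "\<dots> \<le> coord ax a"
      using sorted_map_hd_last(1)[OF v, of a] that 1(3)[of v] by (simp add: hd_rev)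
    finally show ?thesis .
  qed
  then show ?case using sr v by (auto simp: sorted_append rev_map)
next
  case ("2_2" ax v)
  then show ?case by auto
qed auto

lemma compact_linear_image_complex: "linear (f :: complex \<Rightarrow> complex) \<Longrightarrow> compact T \<Longrightarrow> compact (f ` T)"
  by (intro compact_continuous_image linear_continuous_on) (auto simp: linear_conv_bounded_linear)

lemma circle_pt_in_cball:
  assumes "ctab_ok" "i \<le> 150"
  shows "circle_pt i \<in> cball 0 (10 ^ 5 / (2 * pi))"
proof -
  have "real_of_int (circle_x i * circle_x i + circle_y i * circle_y i) \<le> 253302959"
    using assms unfolding ctab_ok_def by (metis of_int_le_iff of_int_numeral)
  moreover have "253302959 \<le> (10 ^ 5 / (2 * pi))\<^sup>2"
  proof -
    \<comment> \<open>The integer bound lies below the true value by less than one part in 10^9, so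
      a sharp upper bound for pi is required.\<close>
    have "pi\<^sup>2 \<le> 3.1415926535899\<^sup>2"
      using pi_approx by (intro power_mono) auto
    then show ?thesis by (simp add: field_simps power2_eq_square)
  qed
  moreover have "(cmod (circle_pt i))\<^sup>2 = real_of_int (circle_x i * circle_x i + circle_y i * circle_y i)"
    unfolding circle_pt_def cmod_power2 by (simp add: power2_eq_square)
  ultimately have "(cmod (circle_pt i))\<^sup>2 \<le> (10 ^ 5 / (2 * pi))\<^sup>2"
    by linarith
  then have "cmod (circle_pt i) \<le> 10 ^ 5 / (2 * pi)"
    by (rule power2_le_imp_le) simp
  then show ?thesis by simp
qed

lemma config_points:
  assumes "ctab_ok" "config S x y e" "arc_ok k v" "k \<le> 90"
  shows "set (points x y e v) \<subseteq> S"
proof (cases v)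
  case (Arc i j)
  then have "set (points x y e v) \<subseteq> cball 0 (10 ^ 5 / (2 * pi))"
    using assms circle_pt_in_cball[OF assms(1)] by (auto simp del: mem_cball)
  then show ?thesis using assms(2) by (auto simp: config_def)
qed (use assms(2) in \<open>auto simp: config_def add.commute zero_complex.code[symmetric]\<close>)

lemma sorted_points:
  assumes "ctab_ok" "arc_ok (if ax then 90 else 60) v"
  shows "sorted (map (coord ax) (points x y e v))"
proof (cases v)
  case (Arc i j)
  then have "coord ax (circle_pt k) \<le> coord ax (circle_pt (Suc k))" if "i \<le> k" "k < j" for k
    using assms that by (auto simp: ctab_ok_def coord_def circle_pt_def split: if_splits)
  then show ?thesis
    using Arc by (auto simp: sorted_iff_nth_Suc nth_append simp del: upt_Suc)
qed auto

lemma sorted_rev_points: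
  assumes "ctab_ok" "arc_ok (if ax then 30 else 0) v"
  shows "sorted (rev (map (coord ax) (points x y e v)))"
proof (cases v)
  case (Arc i j)
  then have "coord ax (circle_pt (Suc k)) \<le> coord ax (circle_pt k)" if "i \<le> k" "k < j" for k
    using assms that by (auto simp: ctab_ok_def coord_def circle_pt_def split: if_splits)
  then show ?thesis
    using Arc by (auto simp: sorted_rev_iff_nth_Suc nth_append simp del: upt_Suc)
qed auto

lemma cross_sum_map_rot: "cross_sum (map (\<lambda>z. - \<i> * z) zs) = cross_sum zs"
  by (induction zs rule: cross_sum.induct) (auto simp: cross_def)

text \<open>The quarter turn by \<open>- \<i>\<close> makes the imaginary part the real part and
  preserves orientation, shoelace sums and area, so the case of chains monotone in the imaginary
  part reduces to the other one.\<close>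

lemma shoelace_le_measure_coord:
  assumes S: "compact S" "convex S" "set as \<subseteq> S" "set bs \<subseteq> S"
    and ne: "as \<noteq> []" "bs \<noteq> []"
    and sorted: "sorted (rev (map (coord ax) as))" "sorted (map (coord ax) bs)"
  shows "cross_sum (as @ bs @ [hd as]) \<le> 2 * measure lebesgue S"
proof (cases ax)
  case False
  then have "coord ax = Re" by (auto simp: coord_def)
  then show ?thesis
    using assms by (intro shoelace_le_measure) (auto simp: rev_map)
next
  case True
  define f where "f = (\<lambda>z. - \<i> * z)"
  have f: "linear f" by (auto simp: f_def intro!: linearI simp: algebra_simps)
  have Ref: "Re \<circ> f = coord ax" using True by (auto simp: f_def coord_def)
  have "cross_sum (map f as @ map f bs @ [hd (map f as)]) \<le> 2 * measure lebesgue (f ` S)"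
    using assms Ref f
    by (intro shoelace_le_measure compact_linear_image_complex convex_linear_image)
      (auto simp: rev_map[symmetric])
  moreover have "map f as @ map f bs @ [hd (map f as)] = map f (as @ bs @ [hd as])"
    using ne by (simp add: hd_map)
  moreover have "measure lebesgue (f ` S) = measure lebesgue S"
    using measure_linear_image_complex[OF f S(1)] by (simp add: f_def)
  ultimately show ?thesis
    using cross_sum_map_rot[of "as @ bs @ [hd as]"] by (simp add: f_def)
qed

lemma polygon_ok_sound:
  assumes ct: "ctab_ok" and ok: "polygon_ok as bs p"
  shows "sound p"
proof -
  obtain ax c cs where p: "p = Polygon ax c cs" by (cases p)
  have ne: "as \<noteq> []" "bs \<noteq> []"
    and arcs: "\<And>v. v \<in> set as \<Longrightarrow> arc_ok (if ax then 30 else 0) v"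
      "\<And>v. v \<in> set bs \<Longrightarrow> arc_ok (if ax then 90 else 60) v"
    and imp: "list_all (implied cs) (decr_cons ax as)" "list_all (implied cs) (incr_cons ax bs)"
    and c: "c = add_form (edges (as @ bs)) (cross_form (final (last bs)) (first (hd as)))"
    using ok by (auto simp: polygon_ok_def p list_all_iff)
  have k90: "(if ax then 30 else 0::nat) \<le> 90" "(if ax then 90 else 60::nat) \<le> 90" by auto
  show ?thesis
    unfolding sound_def p polygon.case
  proof (intro allI impI)
    fix S x y e
    assume cf: "config S x y e" and hl: "list_all (holds ax x y e) cs"
    define us ws where "us = concat (map (points x y e) as)" and "ws = concat (map (points x y e) bs)"
    \<comment> \<open>\<open>S\<close> itself is only known to be convex; the hull of the finitely
      many vertices is compact and still contains both chains.\<close>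
    define T where "T = convex hull (set (us @ ws))"
    have sub: "set (us @ ws) \<subseteq> S"
      using config_points[OF ct cf arcs(1) k90(1)] config_points[OF ct cf arcs(2) k90(2)]
      by (auto simp: us_def ws_def)
    have T: "T \<subseteq> S" "compact T" "convex T" "set us \<subseteq> T" "set ws \<subseteq> T"
      using sub cf hull_subset[of "set (us @ ws)" convex]
      by (auto simp: T_def config_def hull_minimal finite_imp_compact_convex_hull)
    have exa: "\<forall>v\<in>set as. \<exists>k\<le>90. arc_ok k v" using arcs(1) k90(1) by blast
    have exb: "\<forall>v\<in>set bs. \<exists>k\<le>90. arc_ok k v" using arcs(2) k90(2) by blast
    have exab: "\<forall>v\<in>set (as @ bs). \<exists>k\<le>90. arc_ok k v" using exa exb by auto
    note fu = points_list_facts[OF ct exa ne(1), of x y e, folded us_def]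
    note fw = points_list_facts[OF ct exb ne(2), of x y e, folded ws_def]
    have "cross_sum (us @ ws @ [hd us]) \<le> 2 * measure lebesgue T"
    proof (rule shoelace_le_measure_coord[OF T(2-5) fu(1) fw(1)])
      show "sorted (rev (map (coord ax) us))"
        unfolding us_def
        using sorted_rev_points[OF ct arcs(1)] points_facts[OF ct arcs(1) k90(1)]
          implied_holds[OF _ hl] imp(1)
        by (intro sorted_concat_decr) (auto simp: list_all_iff)
      show "sorted (map (coord ax) ws)"
        unfolding ws_def
        using sorted_points[OF ct arcs(2)] points_facts[OF ct arcs(2) k90(2)]
          implied_holds[OF _ hl] imp(2)
        by (intro sorted_concat_incr) (auto simp: list_all_iff)
    qed
    moreover have "cross_sum (us @ ws @ [hd us]) = eval_form x y e c"
    proof -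
      have "cross_sum ((us @ ws) @ [hd us]) = cross_sum (us @ ws) + cross (last ws) (hd us)"
        using fu(1) fw(1) by (subst cross_sum_append) auto
      moreover have "cross_sum (us @ ws) = eval_form x y e (edges (as @ bs))"
        using points_list_facts(4)[OF ct exab, of x y e] ne by (simp add: us_def ws_def)
      ultimately show ?thesis
        using fu fw by (simp add: c eval_add_form eval_cross_form)
    qed
    ultimately show "\<exists>T\<subseteq>S. compact T \<and> eval_form x y e c \<le> 2 * measure lebesgue T"
      using T by auto
  qed
qed

section \<open>Bounds on boxes\<close>

definition threshold :: int where "threshold = 2000000000"

text \<open>A linear condition has its worst case at extreme points: each box coordinate at the
  unfavourable end, and \<open>e\<close> at one end of the chord, hence the minimum. Order
  conditions never mix real and imaginary parts, so all arguments are values of one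
  coordinate.\<close>

fun constrs_ok :: "int \<Rightarrow> int \<Rightarrow> int \<Rightarrow> int \<Rightarrow> int \<Rightarrow> int \<Rightarrow> constr list \<Rightarrow> bool" where
  "constrs_ok x y d h u v [] \<longleftrightarrow> True"
| "constrs_ok x y d h u v ((p, q, r, c) # cs) \<longleftrightarrow>
    c \<le> p * x - \<bar>p\<bar> * d + q * y - \<bar>q\<bar> * h + min (r * u) (r * v) \<and> constrs_ok x y d h u v cs"

text \<open>For fixed \<open>e\<close>, write \<open>x\<close> and \<open>y\<close> as box centre
  plus deviations s and t. The form is its value at the centre plus terms linear in s, terms linear
  in t, and the rest m cross s t; each is bounded on its own. \<open>b\<close> collects everything
  free of \<open>e\<close>, while \<open>w\<close>, \<open>g1\<close>, \<open>g2\<close> carry the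
  dependence on \<open>e\<close>.\<close>

definition end_ok :: "int \<Rightarrow> int \<Rightarrow> int \<Rightarrow> int \<Rightarrow> int \<Rightarrow> int \<Rightarrow> int \<Rightarrow> int \<Rightarrow> bool" where
  "end_ok b y1 y2 h1 h2 w g1 g2 \<longleftrightarrow> threshold \<le> b + w + y1 * g2 - y2 * g1 - h1 * \<bar>g2\<bar> - h2 * \<bar>g1\<bar>"

text \<open>The form is affine in \<open>e\<close>, so the two ends of the chord decide.\<close>

definition ends_ok :: "int \<Rightarrow> int \<Rightarrow> int \<Rightarrow> int \<Rightarrow> int \<Rightarrow> int \<Rightarrow> int \<Rightarrow> int \<Rightarrow> int \<Rightarrow> int \<Rightarrow> int \<Rightarrow> int \<Rightarrow> int \<Rightarrow> int \<Rightarrow> bool" where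
  "ends_ok b y1 y2 h1 h2 a'' b'' n g1 g2 u1 u2 v1 v2 \<longleftrightarrow>
    end_ok b y1 y2 h1 h2 (u1 * b'' - u2 * a'') (g1 - n * u1) (g2 - n * u2) \<and>
    end_ok b y1 y2 h1 h2 (v1 * b'' - v2 * a'') (g1 - n * v1) (g2 - n * v2)"

text \<open>A nonzero \<open>l\<close> can only come from an edge joining the two ends of the
  segment. With \<open>l = 0\<close> the coefficients of the deviation of \<open>x\<close> do not
  involve \<open>e\<close>, and their share of the bound is computed once for both chord
  ends.\<close>

fun leaf_ok :: "polygon \<Rightarrow> int \<Rightarrow> int \<Rightarrow> int \<Rightarrow> int \<Rightarrow> int \<Rightarrow> int \<Rightarrow> int \<Rightarrow> int \<Rightarrow> int \<times> int \<Rightarrow> int \<times> int \<Rightarrow> bool" where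
  "leaf_ok (Polygon ax (Form c a b a' b' a'' b'' m n l) cs) x1 x2 y1 y2 d1 d2 h1 h2 (u1, u2) (v1, v2) \<longleftrightarrow>
    l = 0 \<and>
    (if ax then constrs_ok x2 y2 d2 h2 u2 v2 cs else constrs_ok x1 y1 d1 h1 u1 v1 cs) \<and>
    ends_ok (c + x1 * b - x2 * a - d1 * \<bar>b + m * y2\<bar> - d2 * \<bar>a + m * y1\<bar> - \<bar>m\<bar> * (d1 * h2 + d2 * h1))
      y1 y2 h1 h2 a'' b'' n (a' - m * x1) (b' - m * x2) u1 u2 v1 v2"

definition in_box :: "complex \<Rightarrow> int \<Rightarrow> int \<Rightarrow> int \<Rightarrow> int \<Rightarrow> bool" where
  "in_box z c1 c2 d1 d2 \<longleftrightarrow> \<bar>Re z - c1\<bar> \<le> d1 \<and> \<bar>Im z - c2\<bar> \<le> d2"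

definition ivec :: "int \<times> int \<Rightarrow> complex" where
  "ivec v = Complex (fst v) (snd v)"

lemma abs_mult_bound: "\<bar>a\<bar> \<le> d \<Longrightarrow> - (d * \<bar>b\<bar>) \<le> a * (b::real)"
  by (metis abs_ge_minus_self abs_ge_zero abs_mult minus_le_iff mult_right_mono order_trans)

lemma constrs_ok_holds:
  fixes k :: real
  assumes "constrs_ok x y d h u v cs" "\<bar>coord ax z - x\<bar> \<le> d" "\<bar>coord ax w - y\<bar> \<le> h"
    and "0 \<le> k" "k \<le> 1" "coord ax e = (1 - k) * u + k * v"
  shows "list_all (holds ax z w e) cs"
  using assms(1-3,6)
proof (induction x y d h u v cs rule: constrs_ok.induct)
  case (2 x y d h u v p q r c cs)
  define s t where "s = coord ax z - x" and "t = coord ax w - y"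
  have st: "\<bar>s\<bar> \<le> d" "\<bar>t\<bar> \<le> h" using 2 by (auto simp: s_def t_def)
  have "c \<le> p * x - \<bar>p\<bar> * d + q * y - \<bar>q\<bar> * h + min (r * u) (r * v)"
    using 2 by simp
  then have "c \<le> p * x - \<bar>p\<bar> * d + q * y - \<bar>q\<bar> * h + r * u" "c \<le> p * x - \<bar>p\<bar> * d + q * y - \<bar>q\<bar> * h + r * v"
    by auto
  then have cc: "real_of_int c \<le> real_of_int (p * x - \<bar>p\<bar> * d + q * y - \<bar>q\<bar> * h + r * u)"
      "real_of_int c \<le> real_of_int (p * x - \<bar>p\<bar> * d + q * y - \<bar>q\<bar> * h + r * v)"
    by (simp_all only: of_int_le_iff)
  have "c = (1 - k) * c + k * c" by (simp add: algebra_simps)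
  also have "\<dots> \<le> (1 - k) * (p * x - \<bar>p\<bar> * d + q * y - \<bar>q\<bar> * h + r * u) + k * (p * x - \<bar>p\<bar> * d + q * y - \<bar>q\<bar> * h + r * v)"
    using cc assms(4,5) by (intro add_mono mult_left_mono) auto
  also have "\<dots> = p * x - \<bar>p\<bar> * d + q * y - \<bar>q\<bar> * h + r * coord ax e"
    unfolding 2(5) by (simp add: algebra_simps)
  also have "\<dots> \<le> p * coord ax z + q * coord ax w + r * coord ax e"
    using abs_mult_bound[OF st(1), of p] abs_mult_bound[OF st(2), of q]
    by (simp add: s_def t_def algebra_simps)
  finally show ?case using 2 by simp
qed simp

lemma end_ok_bound:
  assumes "end_ok (c + x1 * b - x2 * a - d1 * \<bar>b + m * y2\<bar> - d2 * \<bar>a + m * y1\<bar> - \<bar>m\<bar> * (d1 * h2 + d2 * h1))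
      y1 y2 h1 h2 (u1 * b'' - u2 * a'') (a' - m * x1 - n * u1) (b' - m * x2 - n * u2)"
    and x: "in_box x x1 x2 d1 d2" and y: "in_box y y1 y2 h1 h2"
  shows "2 * 10 ^ 9 \<le> eval_form x y (ivec (u1, u2)) (Form c a b a' b' a'' b'' m n 0)"
proof -
  define s1 s2 t1 t2 where "s1 = Re x - x1" "s2 = Im x - x2" "t1 = Re y - y1" "t2 = Im y - y2"
  have st: "\<bar>s1\<bar> \<le> d1" "\<bar>s2\<bar> \<le> d2" "\<bar>t1\<bar> \<le> h1" "\<bar>t2\<bar> \<le> h2"
    using x y by (auto simp: in_box_def s1_s2_t1_t2_def)
  define g1 g2 where "g1 = a' - m * x1 - n * u1" "g2 = b' - m * x2 - n * u2"
  define w where "w = u1 * b'' - u2 * a''"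
  have "threshold \<le> (c + x1 * b - x2 * a - d1 * \<bar>b + m * y2\<bar> - d2 * \<bar>a + m * y1\<bar> - \<bar>m\<bar> * (d1 * h2 + d2 * h1)) + w
      + y1 * g2 - y2 * g1 - h1 * \<bar>g2\<bar> - h2 * \<bar>g1\<bar>"
    using assms(1) by (simp add: end_ok_def g1_g2_def w_def)
  then have "real_of_int threshold \<le> real_of_int ((c + x1 * b - x2 * a - d1 * \<bar>b + m * y2\<bar> - d2 * \<bar>a + m * y1\<bar> - \<bar>m\<bar> * (d1 * h2 + d2 * h1)) + w
      + y1 * g2 - y2 * g1 - h1 * \<bar>g2\<bar> - h2 * \<bar>g1\<bar>)"
    by (simp only: of_int_le_iff)
  then have I: "2 * 10 ^ 9 \<le> (c + x1 * b - x2 * a - d1 * \<bar>b + m * y2\<bar> - d2 * \<bar>a + m * y1\<bar> - \<bar>m\<bar> * (d1 * h2 + d2 * h1)) + w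
      + y1 * g2 - y2 * g1 - h1 * \<bar>g2\<bar> - h2 * \<bar>real_of_int g1\<bar>"
    by (simp add: threshold_def)
  have b1: "- (d1 * \<bar>b + m * y2\<bar>) \<le> s1 * (b + m * y2)"
    using abs_mult_bound[OF st(1), of "real_of_int (b + m * y2)"] by simp
  have b2: "- (d2 * \<bar>a + m * y1\<bar>) \<le> (- s2) * (a + m * y1)"
    using abs_mult_bound[of "- s2" d2 "real_of_int (a + m * y1)"] st(2) by simp
  have b3: "- (h1 * \<bar>real_of_int g2\<bar>) \<le> t1 * g2"
    using abs_mult_bound[OF st(3), of g2] by simp
  have b4: "- (h2 * \<bar>real_of_int g1\<bar>) \<le> (- t2) * g1"
    using abs_mult_bound[of "- t2" h2 g1] st(4) by simp
  have "\<bar>s1 * t2 - s2 * t1\<bar> \<le> d1 * h2 + d2 * h1"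
  proof -
    have "\<bar>s1 * t2\<bar> \<le> d1 * h2" "\<bar>s2 * t1\<bar> \<le> d2 * h1"
      using st by (auto simp: abs_mult intro!: mult_mono order_trans[OF abs_ge_zero])
    then show ?thesis by linarith
  qed
  from abs_mult_bound[OF this, of m]
  have b5: "- (\<bar>m\<bar> * (d1 * h2 + d2 * h1)) \<le> m * (s1 * t2 - s2 * t1)"
    by (simp add: mult.commute)
  have xy: "x = Complex (x1 + s1) (x2 + s2)" "y = Complex (y1 + t1) (y2 + t2)"
    by (auto simp: s1_s2_t1_t2_def complex_eq_iff)
  \<comment> \<open>With \<open>x\<close> at the centre of its box, all terms containing
    \<open>y\<close> combine to \<open>cross y (Complex g1 g2)\<close>; the terms with
    \<open>s1\<close> and \<open>s2\<close> are the correction for the deviation of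
    \<open>x\<close>.\<close>
  have "eval_form x y (ivec (u1, u2)) (Form c a b a' b' a'' b'' m n 0) =
    c + x1 * b - x2 * a + w + y1 * g2 - y2 * g1
     + s1 * (b + m * y2) + (- s2) * (a + m * y1) + t1 * g2 + (- t2) * g1 + m * (s1 * t2 - s2 * t1)"
    unfolding xy by (simp add: cross_def ivec_def g1_g2_def w_def algebra_simps)
  then show ?thesis
    using I b1 b2 b3 b4 b5
    by (simp only: of_int_add of_int_diff of_int_mult of_int_minus of_int_abs)
qed

text \<open>The constraints hold on the whole box and chord, so one polygon serves all these
  configurations. Its form at \<open>e\<close> is a convex combination of the values at the chord
  ends, both of which reach the threshold.\<close>

lemma leaf_ok_big:
  fixes k :: real
  assumes s: "sound p" and ok: "leaf_ok p x1 x2 y1 y2 d1 d2 h1 h2 u v"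
    and cf: "config S x y e" and x: "in_box x x1 x2 d1 d2" and y: "in_box y y1 y2 h1 h2"
    and k: "0 \<le> k" "k \<le> 1" and e: "e = (1 - k) *\<^sub>R ivec u + k *\<^sub>R ivec v"
  shows "big S"
proof -
  obtain ax c a b a' b' a'' b'' m n l cs where p: "p = Polygon ax (Form c a b a' b' a'' b'' m n l) cs"
    by (metis polygon.exhaust form.exhaust)
  obtain u1 u2 v1 v2 where uv: "u = (u1, u2)" "v = (v1, v2)" by (metis surj_pair)
  have l: "l = 0" using ok by (simp add: p uv)
  have hl: "list_all (holds ax x y e) cs"
  proof (cases ax)
    case True
    then have "constrs_ok x2 y2 d2 h2 u2 v2 cs" using ok by (simp add: p uv)
    then show ?thesis
      by (rule constrs_ok_holds[OF _ _ _ k]) (use True x y e in \<open>auto simp: in_box_def coord_def uv ivec_def\<close>)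
  next
    case False
    then have "constrs_ok x1 y1 d1 h1 u1 v1 cs" using ok by (simp add: p uv)
    then show ?thesis
      by (rule constrs_ok_holds[OF _ _ _ k]) (use False x y e in \<open>auto simp: in_box_def coord_def uv ivec_def\<close>)
  qed
  let ?c = "Form c a b a' b' a'' b'' m n 0"
  have "2 * 10 ^ 9 \<le> eval_form x y (ivec (u1, u2)) ?c" "2 * 10 ^ 9 \<le> eval_form x y (ivec (v1, v2)) ?c"
    by (rule end_ok_bound[OF _ x y]; use ok in \<open>simp add: p uv ends_ok_def\<close>)+
  then have "(1 - k) * (2 * 10 ^ 9) + k * (2 * 10 ^ 9) \<le> (1 - k) * eval_form x y (ivec (u1, u2)) ?c + k * eval_form x y (ivec (v1, v2)) ?c"
    using k by (intro add_mono mult_left_mono) auto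
  also have "\<dots> = eval_form x y e ?c"
    by (simp add: e uv ivec_def cross_def algebra_simps)
  finally have "2 * 10 ^ 9 \<le> eval_form x y e ?c" by (simp add: algebra_simps)
  moreover obtain T where "T \<subseteq> S" "compact T" "eval_form x y e ?c \<le> 2 * measure lebesgue T"
    using s cf hl unfolding sound_def p polygon.case l by blast
  ultimately show ?thesis unfolding big_def by (intro exI[of _ T]) auto
qed

section \<open>Search trees over boxes and lists of directions\<close>

fun pick :: "polygon list \<Rightarrow> nat \<Rightarrow> polygon" where
  "pick (p # ps) (Suc k) = pick ps k"
| "pick (p # ps) 0 = p"
| "pick [] k = Polygon False (Form 0 0 0 0 0 0 0 0 0 0) []"

text \<open>The default polygon has the form 0 and no constraints, so the empty set witnesses its
  soundness; lying below the threshold, it can never close a leaf.\<close>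

lemma pick_sound: "\<forall>p\<in>set ps. sound p \<Longrightarrow> sound (pick ps k)"
proof (induction ps k rule: pick.induct)
  case (3 k)
  show ?case by (auto simp: sound_def cross_def intro!: exI[of _ "{}"])
qed auto

text \<open>Boxes are given by centre and half-widths, so a split moves the centre by the new
  half-width; a condition such as \<open>d1 \<le> 2 * h\<close> guarantees that the two halves cover
  the box. At \<open>E i\<close> direction number \<open>i\<close> belongs to both parts, hence
  \<open>take (Suc i)\<close> and \<open>drop i\<close>. A leaf sees only the first and the last
  direction, the ends of its chord.\<close>

fun check :: "polygon list \<Rightarrow> tree \<Rightarrow> int \<Rightarrow> int \<Rightarrow> int \<Rightarrow> int \<Rightarrow> int \<Rightarrow> int \<Rightarrow> int \<Rightarrow> int \<Rightarrow> (int \<times> int) list \<Rightarrow> bool" where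
  "check ps (L k) x1 x2 y1 y2 d1 d2 h1 h2 es = leaf_ok (pick ps k) x1 x2 y1 y2 d1 d2 h1 h2 (hd es) (last es)"
| "check ps (X1 h s t) x1 x2 y1 y2 d1 d2 h1 h2 es \<longleftrightarrow>
    d1 \<le> 2 * h \<and> check ps s (x1 - h) x2 y1 y2 h d2 h1 h2 es \<and> check ps t (x1 + h) x2 y1 y2 h d2 h1 h2 es"
| "check ps (X2 h s t) x1 x2 y1 y2 d1 d2 h1 h2 es \<longleftrightarrow>
    d2 \<le> 2 * h \<and> check ps s x1 (x2 - h) y1 y2 d1 h h1 h2 es \<and> check ps t x1 (x2 + h) y1 y2 d1 h h1 h2 es"
| "check ps (Y1 h s t) x1 x2 y1 y2 d1 d2 h1 h2 es \<longleftrightarrow>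
    h1 \<le> 2 * h \<and> check ps s x1 x2 (y1 - h) y2 d1 d2 h h2 es \<and> check ps t x1 x2 (y1 + h) y2 d1 d2 h h2 es"
| "check ps (Y2 h s t) x1 x2 y1 y2 d1 d2 h1 h2 es \<longleftrightarrow>
    h2 \<le> 2 * h \<and> check ps s x1 x2 y1 (y2 - h) d1 d2 h1 h es \<and> check ps t x1 x2 y1 (y2 + h) d1 d2 h1 h es"
| "check ps (E i s t) x1 x2 y1 y2 d1 d2 h1 h2 es \<longleftrightarrow>
    0 < i \<and> Suc i < length es \<and> check ps s x1 x2 y1 y2 d1 d2 h1 h2 (take (Suc i) es) \<and>
    check ps t x1 x2 y1 y2 d1 d2 h1 h2 (drop i es)"

text \<open>Positivity is demanded for all pairs, not merely for neighbours, so that the two ends of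
  every sublist of length at least 2 span a cone of less than a half turn. The norm bound is 25000
  squared: directions are rounded inwards, which keeps the chords within the disk of radius
  \<open>cmod e\<close>.\<close>

definition dirs_ok :: "(int \<times> int) list \<Rightarrow> bool" where
  "dirs_ok es \<longleftrightarrow> 2 \<le> length es \<and> sorted_wrt (\<lambda>u v. 0 < fst u * snd v - snd u * fst v) es \<and>
    list_all (\<lambda>u. fst u * fst u + snd u * snd u \<le> 625000000) es"

definition in_cone :: "int \<times> int \<Rightarrow> int \<times> int \<Rightarrow> complex \<Rightarrow> bool" where
  "in_cone u v e \<longleftrightarrow> 0 \<le> cross (ivec u) e \<and> 0 \<le> cross e (ivec v)"

text \<open>The chord between two vectors of the disk of radius \<open>cmod e\<close> meets the segment from 0 to \<open>e\<close>.\<close>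

lemma in_cone_shrink:
  assumes c: "in_cone u v e" and uv: "0 < fst u * snd v - snd u * fst v"
    and le: "cmod (ivec u) \<le> cmod e" "cmod (ivec v) \<le> cmod e" and e0: "e \<noteq> 0"
  obtains t k where "0 \<le> t" "t \<le> 1" "0 \<le> k" "k \<le> 1" "t *\<^sub>R e = (1 - k) *\<^sub>R ivec u + k *\<^sub>R ivec v"
proof -
  define D where "D = cross (ivec u) (ivec v)"
  have "D = real_of_int (fst u * snd v - snd u * fst v)" by (simp add: D_def cross_def ivec_def)
  then have D: "0 < D" using uv by linarith
  define \<alpha> \<beta> where "\<alpha> = cross e (ivec v) / D" and "\<beta> = cross (ivec u) e / D"
  have ab: "0 \<le> \<alpha>" "0 \<le> \<beta>" using c D by (auto simp: \<alpha>_def \<beta>_def in_cone_def)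
  have De: "D *\<^sub>R e = cross e (ivec v) *\<^sub>R ivec u + cross (ivec u) e *\<^sub>R ivec v"
    by (simp add: complex_eq_iff D_def cross_def algebra_simps)
  have "e = (1 / D) *\<^sub>R (D *\<^sub>R e)" using D by simp
  also have "\<dots> = \<alpha> *\<^sub>R ivec u + \<beta> *\<^sub>R ivec v"
    unfolding De by (simp add: \<alpha>_def \<beta>_def scaleR_add_right)
  finally have e: "e = \<alpha> *\<^sub>R ivec u + \<beta> *\<^sub>R ivec v" .
  \<comment> \<open>Triangle inequality: as neither chord end is longer than \<open>e\<close>, the
    coefficients add up to at least 1, and dividing by their sum shortens \<open>e\<close> onto the
    chord.\<close>
  have "cmod e \<le> \<alpha> * cmod (ivec u) + \<beta> * cmod (ivec v)"
    using norm_triangle_ineq[of "\<alpha> *\<^sub>R ivec u" "\<beta> *\<^sub>R ivec v"] e ab by simp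
  also have "\<dots> \<le> \<alpha> * cmod e + \<beta> * cmod e"
    using ab le by (intro add_mono mult_left_mono) auto
  finally have "cmod e * 1 \<le> cmod e * (\<alpha> + \<beta>)" by (simp add: algebra_simps)
  then have s: "1 \<le> \<alpha> + \<beta>" using e0 by simp
  show thesis
  proof (rule that[of "1 / (\<alpha> + \<beta>)" "\<beta> / (\<alpha> + \<beta>)"])
    have "1 - \<beta> / (\<alpha> + \<beta>) = \<alpha> / (\<alpha> + \<beta>)" using s by (simp add: field_simps)
    moreover have "(1 / (\<alpha> + \<beta>)) *\<^sub>R e = (\<alpha> / (\<alpha> + \<beta>)) *\<^sub>R ivec u + (\<beta> / (\<alpha> + \<beta>)) *\<^sub>R ivec v"
      unfolding e by (simp add: scaleR_add_right)
    ultimately show "(1 / (\<alpha> + \<beta>)) *\<^sub>R e = (1 - \<beta> / (\<alpha> + \<beta>)) *\<^sub>R ivec u + (\<beta> / (\<alpha> + \<beta>)) *\<^sub>R ivec v"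
      by simp
  qed (use s ab in auto)
qed

lemma config_shrink:
  assumes cf: "config S x y e" and t: "0 \<le> t" "t \<le> 1"
  shows "config S x y (t *\<^sub>R e)"
proof -
  have "convex S" "x + e \<in> S" "x - e \<in> S" using cf by (auto simp: config_def)
  then have "((1 + t) / 2) *\<^sub>R (x + e) + ((1 - t) / 2) *\<^sub>R (x - e) \<in> S"
    "((1 - t) / 2) *\<^sub>R (x + e) + ((1 + t) / 2) *\<^sub>R (x - e) \<in> S"
    by (rule convexD; use t in \<open>simp add: field_simps\<close>)+
  moreover have "((1 + t) / 2) *\<^sub>R (x + e) + ((1 - t) / 2) *\<^sub>R (x - e) = x + t *\<^sub>R e"
    "((1 - t) / 2) *\<^sub>R (x + e) + ((1 + t) / 2) *\<^sub>R (x - e) = x - t *\<^sub>R e"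
    by (auto simp: complex_eq_iff field_simps)
  ultimately show ?thesis using cf by (simp add: config_def)
qed

lemma abs_diff_split:
  fixes z :: real and c d h :: int
  assumes "\<bar>z - c\<bar> \<le> d" "d \<le> 2 * h"
  shows "\<bar>z - real_of_int (c - h)\<bar> \<le> h \<or> \<bar>z - real_of_int (c + h)\<bar> \<le> h"
proof -
  have "real_of_int d \<le> 2 * h" using assms(2) by linarith
  then show ?thesis using assms(1) by (auto simp: abs_le_iff)
qed

lemma check_sound:
  assumes cf: "config S x y e" and e: "cmod e = 25000"
  shows "\<forall>p\<in>set ps. sound p \<Longrightarrow> check ps t x1 x2 y1 y2 d1 d2 h1 h2 es \<Longrightarrow> in_box x x1 x2 d1 d2 \<Longrightarrow> in_box y y1 y2 h1 h2 \<Longrightarrow>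
    dirs_ok es \<Longrightarrow> in_cone (hd es) (last es) e \<Longrightarrow> big S"
proof (induction ps t x1 x2 y1 y2 d1 d2 h1 h2 es rule: check.induct)
  case (1 ps k x1 x2 y1 y2 d1 d2 h1 h2 es)
  obtain u us where es: "es = u # us" "us \<noteq> []"
    using 1(5) by (cases es; cases "tl es"; auto simp: dirs_ok_def)
  have pos: "0 < fst (hd es) * snd (last es) - snd (hd es) * fst (last es)"
    using 1(5) last_in_set[OF es(2)] by (auto simp: dirs_ok_def es)
  have norm: "cmod (ivec u) \<le> cmod e" if "u \<in> set es" for u
  proof -
    have "fst u * fst u + snd u * snd u \<le> 625000000"
      using that 1(5) by (auto simp: dirs_ok_def list_all_iff)
    then have "real_of_int (fst u * fst u + snd u * snd u) \<le> 625000000" by linarith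
    then have "(cmod (ivec u))\<^sup>2 \<le> (cmod e)\<^sup>2"
      unfolding e cmod_power2 ivec_def by (simp add: power2_eq_square)
    then show ?thesis by (rule power2_le_imp_le) simp
  qed
  have "hd es \<in> set es" "last es \<in> set es" using es by auto
  moreover have "e \<noteq> 0" using e by auto
  ultimately obtain t k' where tk: "0 \<le> t" "t \<le> 1" "0 \<le> k'" "k' \<le> 1"
      "t *\<^sub>R e = (1 - k') *\<^sub>R ivec (hd es) + k' *\<^sub>R ivec (last es)"
    using in_cone_shrink[OF 1(6) pos norm norm] by metis
  show ?case
    using leaf_ok_big[OF pick_sound[OF 1(1)] _ config_shrink[OF cf tk(1,2)] 1(3,4) tk(3,4,5)] 1(2) by simp
next
  case (2 ps h s t x1 x2 y1 y2 d1 d2 h1 h2 es)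
  then show ?case using abs_diff_split[of "Re x" x1 d1 h] by (auto simp: in_box_def)
next
  case (3 ps h s t x1 x2 y1 y2 d1 d2 h1 h2 es)
  then show ?case using abs_diff_split[of "Im x" x2 d2 h] by (auto simp: in_box_def)
next
  case (4 ps h s t x1 x2 y1 y2 d1 d2 h1 h2 es)
  then show ?case using abs_diff_split[of "Re y" y1 h1 h] by (auto simp: in_box_def)
next
  case (5 ps h s t x1 x2 y1 y2 d1 d2 h1 h2 es)
  then show ?case using abs_diff_split[of "Im y" y2 h2 h] by (auto simp: in_box_def)
next
  case (6 ps i s t x1 x2 y1 y2 d1 d2 h1 h2 es)
  have i: "0 < i" "Suc i < length es" using 6 by auto
  have "hd (take (Suc i) es) = hd es" using i by (cases es) auto
  moreover have "last (take (Suc i) es) = es ! i"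
      "hd (drop i es) = es ! i" "last (drop i es) = last es"
    using i by (auto simp: hd_drop_conv_nth take_Suc_conv_app_nth)
  ultimately have l: "hd (take (Suc i) es) = hd es" "last (take (Suc i) es) = es ! i"
      "hd (drop i es) = es ! i" "last (drop i es) = last es" by auto
  have d: "dirs_ok (take (Suc i) es)" "dirs_ok (drop i es)"
    using i 6(7) by (auto simp: dirs_ok_def sorted_wrt_take sorted_wrt_drop list_all_iff dest: in_set_takeD in_set_dropD)
  \<comment> \<open>The sign of the cross product of \<open>es ! i\<close> with \<open>e\<close>
    tells on which side of the dividing direction \<open>e\<close> lies.\<close>
  have "in_cone (hd es) (es ! i) e \<or> in_cone (es ! i) (last es) e"
    using 6(8) by (auto simp: in_cone_def cross_def mult.commute)
  then show ?case using 6 l d by auto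
qed

section \<open>Reduction to a bounded set of configurations\<close>

text \<open>Only the absolute determinant enters, so the lemma covers reflections as well as
  rotations.\<close>

lemma big_vimage:
  assumes f: "linear f" "\<bar>Re (f 1) * Im (f \<i>) - Im (f 1) * Re (f \<i>)\<bar> = 1" and b: "big (f -` S)"
  shows "big S"
proof -
  obtain T where T: "T \<subseteq> f -` S" "compact T" "10 ^ 9 \<le> measure lebesgue T"
    using b by (auto simp: big_def)
  then show ?thesis
    unfolding big_def
    using measure_linear_image_complex[OF f(1) T(2)] compact_linear_image_complex[OF f(1) T(2)] f(2)
    by (intro exI[of _ "f ` T"]) auto
qed

text \<open>A rotation puts \<open>w\<close> on the positive real axis, and convexity with the
  centre pulls it in to 34500. The polygon consists of this point and the vertices \<open>i\<close>
  to \<open>j\<close> on the far side of the disk. It is applied with 21 and 99: the tangent points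
  seen from 34500 have polar angle about 62.5 degrees, and vertices are 3 degrees apart. The
  shoelace sum is then 2012471919, barely above the threshold.\<close>

lemma far_point_big:
  assumes ct: "ctab_ok" and ij: "i \<le> 60" "60 \<le> j" "j \<le> 120"
    and tab: "2 * 10 ^ 9 \<le> 34500 * (circle_y i - circle_y j) + circle_sum j - circle_sum i" "circle_x i \<le> 34500"
    and S: "convex S" "cball 0 (10 ^ 5 / (2 * pi)) \<subseteq> S" and w: "w \<in> S" "34500 \<le> cmod w"
  shows "big S"
proof -
  define u where "u = w / of_real (cmod w)"
  have w0: "cmod w \<noteq> 0" using w by auto
  have u: "cmod u = 1" using w0 by (simp add: u_def norm_divide)
  define f where "f = (\<lambda>z. u * z)"
  have f: "linear f" by (auto simp: f_def intro!: linearI simp: algebra_simps)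
  let ?S = "f -` S"
  have cS: "convex ?S" using f S(1) by (rule convex_linear_vimage)
  have disc: "cball 0 (10 ^ 5 / (2 * pi)) \<subseteq> ?S"
  proof
    fix z :: complex assume "z \<in> cball 0 (10 ^ 5 / (2 * pi))"
    then have "f z \<in> cball 0 (10 ^ 5 / (2 * pi))" using u by (simp add: f_def norm_mult)
    then show "z \<in> ?S" using S(2) by blast
  qed
  have w': "34500 \<in> ?S"
  proof -
    have "0 \<in> S" using S(2) by auto
    then have "(1 - 34500 / cmod w) *\<^sub>R 0 + (34500 / cmod w) *\<^sub>R w \<in> S"
      using S(1) w by (intro convexD_alt) (auto simp: divide_le_eq_1 intro: less_le_trans[of 0 34500])
    moreover have "(34500 / cmod w) *\<^sub>R w = f 34500"
      using w0 by (simp add: f_def u_def scaleR_conv_of_real)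
    ultimately show ?thesis by simp
  qed
  \<comment> \<open>Vertex 60, the leftmost one, ends one chain and begins the other; the repeated
    vertex contributes \<open>cross z z = 0\<close>.\<close>
  define as bs where "as = 34500 # map circle_pt [i..<Suc 60]" and "bs = map circle_pt [60..<Suc j]"
  define T where "T = convex hull (set (as @ bs))"
  have sub: "set (as @ bs) \<subseteq> ?S"
  proof -
    have "circle_pt k \<in> ?S" if "k \<le> 150" for k
      using circle_pt_in_cball[OF ct that] disc by blast
    then show ?thesis using w' ij by (auto simp: as_def bs_def simp del: vimage_eq upt_Suc)
  qed
  have T: "T \<subseteq> ?S" "compact T" "convex T" "set as \<subseteq> T" "set bs \<subseteq> T"
    using sub cS hull_subset[of "set (as @ bs)" convex]
    by (auto simp: T_def hull_minimal finite_imp_compact_convex_hull)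
  have "cross_sum (as @ bs @ [hd as]) \<le> 2 * measure lebesgue T"
  proof (rule shoelace_le_measure_coord[where ax = False, OF T(2-5)])
    have "sorted (rev (map (coord False) (points 0 0 0 (Arc i 60))))"
      by (rule sorted_rev_points[OF ct]) (use ij in simp)
    then have s: "sorted (rev (map (coord False) (map circle_pt [i..<Suc 60])))" by (simp del: upt_Suc)
    have "coord False z \<le> coord False (circle_pt i)" if "z \<in> set (map circle_pt [i..<Suc 60])" for z
    proof -
      have "hd [i..<Suc 60] = i" by (rule hd_upt) (use ij in simp)
      then have "last (rev (map circle_pt [i..<Suc 60])) = circle_pt i"
        using ij by (simp add: last_rev hd_map del: upt_Suc)
      then show ?thesis
        using sorted_map_hd_last(2)[of "coord False" "rev (map circle_pt [i..<Suc 60])" z] s that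
        by (simp add: rev_map del: upt_Suc)
    qed
    moreover have "coord False (circle_pt i) \<le> 34500" using tab(2) by (simp add: coord_def circle_pt_def)
    ultimately have "coord False z \<le> coord False 34500" if "z \<in> set (map circle_pt [i..<Suc 60])" for z
      using that by (force simp: coord_def)
    then show "sorted (rev (map (coord False) as))"
      using s by (simp add: as_def sorted_append del: upt_Suc)
    have "sorted (map (coord False) (points 0 0 0 (Arc 60 j)))"
      by (rule sorted_points[OF ct]) (use ij in simp)
    then show "sorted (map (coord False) bs)" by (simp add: bs_def del: upt_Suc)
  qed (use ij in \<open>auto simp: as_def bs_def\<close>)
  moreover have "cross_sum (as @ bs @ [hd as]) = 34500 * (circle_y i - circle_y j) + circle_sum j - circle_sum i"
  proof -
    have hl: "hd [i..<Suc 60] = i" "last [i..<Suc 60] = 60" "hd [60..<Suc j] = 60" "last [60..<Suc j] = j"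
      using ij by (simp_all add: hd_upt last_upt del: upt_Suc)
    have "cross_sum as = cross 34500 (circle_pt i) + (circle_sum 60 - circle_sum i)"
      using cross_sum_append[of "[34500]" "map circle_pt [i..<Suc 60]"] cross_sum_map_circle_pt[OF ct, of i 60] ij
      by (simp add: as_def hd_map hl del: upt_Suc)
    moreover have "cross_sum (bs @ [hd as]) = (circle_sum j - circle_sum 60) + cross (circle_pt j) 34500"
      using cross_sum_append[of bs "[34500]"] cross_sum_map_circle_pt[OF ct, of 60 j] ij
      by (simp add: bs_def as_def last_map hl del: upt_Suc)
    moreover have "cross_sum (as @ bs @ [hd as]) = cross_sum as + cross (circle_pt 60) (circle_pt 60) + cross_sum (bs @ [hd as])"
      using cross_sum_append[of as "bs @ [hd as]"] ij
      by (simp add: as_def bs_def last_map hd_map hl del: upt_Suc)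
    ultimately show ?thesis by (simp add: cross_def circle_pt_def algebra_simps)
  qed
  moreover have "real_of_int (2 * 10 ^ 9) \<le> real_of_int (34500 * (circle_y i - circle_y j) + circle_sum j - circle_sum i)"
    using tab(1) by (simp only: of_int_le_iff)
  ultimately have "10 ^ 9 \<le> measure lebesgue T" by simp
  then have "big ?S" using T by (auto simp: big_def)
  moreover have "\<bar>Re (f 1) * Im (f \<i>) - Im (f 1) * Re (f \<i>)\<bar> = 1"
    using u by (simp add: f_def cmod_def power2_eq_square)
  ultimately show ?thesis using big_vimage[OF f] by blast
qed

text \<open>The boxes contain every configuration with all points closer than 34500 to the centre,
  up to the symmetry that makes \<open>Im y\<close> nonnegative. The half-widths are 3 * 2^13 and
  powers of 2, so that repeated halving stays integral.\<close>

definition cone_big :: "int \<times> int \<Rightarrow> int \<times> int \<Rightarrow> bool" where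
  "cone_big u v \<longleftrightarrow> (\<forall>S x y e. config S x y e \<longrightarrow> cmod e = 25000 \<longrightarrow> in_box x 0 0 24576 24576 \<longrightarrow>
     in_box y 0 16384 32768 16384 \<longrightarrow> in_cone u v e \<longrightarrow> big S)"

text \<open>Every direction lies on one side of \<open>v\<close>; this lets the quarter turn be
  treated in independent pieces.\<close>

lemma cone_big_trans: "cone_big u v \<Longrightarrow> cone_big v w \<Longrightarrow> cone_big u w"
proof -
  assume uv: "cone_big u v" and vw: "cone_big v w"
  have "in_cone u v e \<or> in_cone v w e" if "in_cone u w e" for e
    using that by (auto simp: in_cone_def cross_def mult.commute)
  then show ?thesis using uv vw unfolding cone_big_def by blast
qed

lemma check_cone_big:
  assumes "\<forall>p\<in>set ps. sound p" "dirs_ok es" "check ps t 0 0 0 16384 24576 24576 32768 16384 es"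
  shows "cone_big (hd es) (last es)"
  unfolding cone_big_def using check_sound[OF _ _ assms(1,3) _ _ assms(2)] by blast

definition far_ok :: bool where
  "far_ok \<longleftrightarrow> 2 * 10 ^ 9 \<le> 34500 * (circle_y 21 - circle_y 99) + circle_sum 99 - circle_sum 21 \<and> circle_x 21 \<le> 34500"

text \<open>The parallelogram law, applied to the two segment ends and to two opposite corners,
  bounds the squares of the norms by 34500^2 - 25000^2 and 34500^2 - 16365^2 - 8635^2. The stated
  radii are rounded up to numbers that can be halved many times.\<close>

lemma config_cmod_bounds:
  assumes cf: "config S x y e" and e: "cmod e = 25000"
    and small: "\<And>w. w \<in> S \<Longrightarrow> cmod w < 34500"
  shows "cmod x \<le> 24576" "cmod y \<le> 32768"
proof -
  have sq: "(cmod w)\<^sup>2 \<le> 34500\<^sup>2" if "w \<in> S" for w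
    using small[OF that] by (intro power_mono) auto
  have "(cmod (x + e))\<^sup>2 + (cmod (x - e))\<^sup>2 \<le> 34500\<^sup>2 + 34500\<^sup>2"
    using cf by (intro add_mono sq) (auto simp: config_def)
  moreover have "(cmod (x + e))\<^sup>2 + (cmod (x - e))\<^sup>2 = 2 * (cmod x)\<^sup>2 + 2 * (cmod e)\<^sup>2"
    unfolding cmod_power2 by (simp add: power2_eq_square algebra_simps)
  ultimately have "(cmod x)\<^sup>2 \<le> 24576\<^sup>2" by (simp add: e)
  then show "cmod x \<le> 24576" by (rule power2_le_imp_le) simp
  have "(cmod (y + Complex 16365 8635))\<^sup>2 + (cmod (y + Complex (- 16365) (- 8635)))\<^sup>2 \<le> 34500\<^sup>2 + 34500\<^sup>2"
    using cf by (intro add_mono sq) (auto simp: config_def)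
  moreover have "(cmod (y + Complex 16365 8635))\<^sup>2 + (cmod (y + Complex (- 16365) (- 8635)))\<^sup>2 =
      2 * (cmod y)\<^sup>2 + 2 * (16365\<^sup>2 + 8635\<^sup>2)"
    unfolding cmod_power2 by (simp add: power2_eq_square algebra_simps)
  ultimately have "(cmod y)\<^sup>2 \<le> 32768\<^sup>2" by simp
  then show "cmod y \<le> 32768" by (rule power2_le_imp_le) simp
qed

section \<open>Symmetries of the disk, the rectangle and the segment\<close>

context
  assumes ct: ctab_ok and far: far_ok and quad: "cone_big (25000, 0) (0, 25000)"
begin

lemma config_big_quadrant:
  assumes cf: "config S x y e" and e: "cmod e = 25000" "0 \<le> Re e" "0 \<le> Im e" and y: "0 \<le> Im y"
  shows "big S"
proof (rule ccontr)
  assume nb: "\<not> big S"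
  have "cmod w < 34500" if "w \<in> S" for w
    using far_point_big[OF ct, of 21 99 S w] far nb that cf unfolding far_ok_def config_def by force
  then have bd: "cmod x \<le> 24576" "cmod y \<le> 32768"
    using config_cmod_bounds[OF cf e(1)] by auto
  have "in_box x 0 0 24576 24576"
    using bd(1) abs_Re_le_cmod[of x] abs_Im_le_cmod[of x] by (auto simp: in_box_def)
  moreover have "in_box y 0 16384 32768 16384"
    using bd(2) abs_Re_le_cmod[of y] abs_Im_le_cmod[of y] y by (auto simp: in_box_def abs_le_iff)
  moreover have "in_cone (25000, 0) (0, 25000) e"
    using e by (auto simp: in_cone_def cross_def ivec_def)
  ultimately show False using quad cf e(1) nb unfolding cone_big_def by blast
qed

text \<open>The half turn permutes the corners of the rectangle and can keep \<open>e\<close>,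
  because the two segment ends may be exchanged. Thus the sign of \<open>Im y\<close> can be
  arranged after the direction has been normalized.\<close>

lemma config_uminus: "config S x y e \<Longrightarrow> config (uminus -` S) (- x) (- y) e"
proof -
  have *: "y - Complex a b = y + Complex (- a) (- b)" "e + x = x + e" for a b by (simp_all add: complex_eq_iff)
  have lin: "linear (uminus :: complex \<Rightarrow> complex)" by (auto intro!: linearI)
  assume "config S x y e"
  then show ?thesis
    using convex_linear_vimage[OF lin, of S]
    by (auto simp: config_def * subset_eq)
qed

text \<open>Conjugation followed by the exchange of the segment ends maps \<open>e\<close> to
  \<open>- cnj e\<close>, which takes the second quadrant of directions to the first.\<close>

lemma config_cnj: "config S x y e \<Longrightarrow> config (cnj -` S) (cnj x) (cnj y) (cnj e)"
proof -
  have lin: "linear cnj" by (auto intro!: linearI)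
  assume "config S x y e"
  then show ?thesis
    using convex_linear_vimage[OF lin, of S]
    by (auto simp: config_def subset_eq complex_cnj)
qed

lemma config_neg_dir: "config S x y e \<Longrightarrow> config S x y (- e)"
  by (auto simp: config_def)

lemma config_big_quadrant':
  assumes cf: "config S x y e" and e: "cmod e = 25000" "0 \<le> Re e" "0 \<le> Im e"
  shows "big S"
proof (cases "0 \<le> Im y")
  case True
  then show ?thesis using config_big_quadrant cf e by blast
next
  case False
  then have "big (uminus -` S)"
    using config_big_quadrant[OF config_uminus[OF cf] e] by simp
  then show ?thesis
    by (rule big_vimage[rotated 2]) (auto intro!: linearI)
qed

lemma config_big:
  assumes cf: "config S x y e" and e: "cmod e = 25000"
  shows "big S"
proof -
  have upper: "big S'" if cf': "config S' x' y' e'" and e': "cmod e' = 25000" "0 \<le> Im e'" for S' x' y' e'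
  proof (cases "0 \<le> Re e'")
    case True
    then show ?thesis using config_big_quadrant' cf' e' by blast
  next
    case False
    then have "big (cnj -` S')"
      using config_big_quadrant'[OF config_neg_dir[OF config_cnj[OF cf']]] e' by simp
    then show ?thesis
      by (rule big_vimage[rotated 2]) (auto intro!: linearI)
  qed
  show ?thesis
  proof (cases "0 \<le> Im e")
    case True
    then show ?thesis using upper cf e by blast
  next
    case False
    then show ?thesis using upper[OF config_neg_dir[OF cf]] e by simp
  qed
qed

end


fun polygons_ok :: "(vertex list \<times> vertex list \<times> polygon) list \<Rightarrow> bool" where
  "polygons_ok [] \<longleftrightarrow> True"
| "polygons_ok ((as, bs, p) # ps) \<longleftrightarrow> polygon_ok as bs p \<and> polygons_ok ps"

lemma polygons_ok_sound: "ctab_ok \<Longrightarrow> polygons_ok ps \<Longrightarrow> \<forall>p\<in>set (map (snd \<circ> snd) ps). sound p"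
  by (induction ps rule: polygons_ok.induct) (auto intro: polygon_ok_sound)

end

section \<open>From the given copies to a configuration\<close>

lemma convex_lebesgue_sets:
  fixes S :: "'a::euclidean_space set"
  assumes "convex S"
  shows "S \<in> sets lebesgue"
proof -
  have eq: "(\<Union>n. S \<inter> cball 0 (real n)) = S"
    using real_arch_simple by auto
  have "S \<inter> cball 0 (real n) \<in> sets lebesgue" for n
    using assms by (intro fmeasurableD measurable_convex convex_Int bounded_Int) auto
  then have "(\<Union>n. S \<inter> cball 0 (real n)) \<in> sets lebesgue"
    by (intro sets.countable_UN) auto
  then show ?thesis unfolding eq .
qed

text \<open>Every point of the ball lies on a diameter of the sphere. The centre is treated apart,
  as it determines no direction.\<close>

lemma cball_subset_convex:
  fixes S :: "complex set"
  assumes "convex S" "sphere c r \<subseteq> S" "0 \<le> r"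
  shows "cball c r \<subseteq> S"
proof
  fix z assume z: "z \<in> cball c r"
  show "z \<in> S"
  proof (cases "z = c")
    case True
    have "c + of_real r \<in> S" "c - of_real r \<in> S"
      using assms by (auto simp: dist_norm subset_eq)
    then have "(1 / 2) *\<^sub>R (c + of_real r) + (1 / 2) *\<^sub>R (c - of_real r) \<in> S"
      using assms(1) by (auto intro!: convexD)
    moreover have "(1 / 2) *\<^sub>R (c + of_real r) + (1 / 2) *\<^sub>R (c - of_real r) = c"
      by (simp add: complex_eq_iff field_simps)
    ultimately show ?thesis using True by simp
  next
    case False
    define d where "d = cmod (z - c)"
    have d: "0 < d" "d \<le> r" using z False by (auto simp: d_def dist_norm norm_minus_commute)
    define v where "v = (r / d) *\<^sub>R (z - c)"
    have "cmod v = r" using d assms(3) by (simp add: v_def d_def)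
    then have "c + v \<in> S" "c - v \<in> S"
      using assms by (auto simp: dist_norm subset_eq)
    then have "((1 + d / r) / 2) *\<^sub>R (c + v) + ((1 - d / r) / 2) *\<^sub>R (c - v) \<in> S"
      using d by (intro convexD[OF assms(1)]) (auto simp: field_simps)
    moreover have "((1 + d / r) / 2) *\<^sub>R (c + v) + ((1 - d / r) / 2) *\<^sub>R (c - v) = c + (d / r) *\<^sub>R v"
      by (simp add: complex_eq_iff field_simps)
    moreover have "(d / r) *\<^sub>R v = z - c" using d by (simp add: v_def)
    ultimately show ?thesis by simp
  qed
qed

text \<open>The similarity from \<open>z\<close> to \<open>t1 + a * z\<close> translates
  configuration coordinates into the plane of \<open>S\<close>. The circle is invariant under its
  rotation \<open>u1\<close>, so the rotation \<open>u3\<close> of the rectangle can fix the axes. A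
  witness of area 10^9 shrinks by the factor \<open>(cmod a)\<^sup>2\<close>, which is
  10^-10.\<close>

lemma contains_copies_measure:
  fixes S :: "complex set"
  assumes S: "convex S" "contains_copy S circ1" "contains_copy S seg_half" "contains_copy S rect"
    and main: "\<And>S x y e. config S x y e \<Longrightarrow> cmod e = 25000 \<Longrightarrow> big S"
  shows "emeasure lebesgue S \<ge> ennreal 0.1"
proof -
  obtain u1 t1 where 1: "norm u1 = 1" "(\<lambda>z. u1 * z + t1) ` circ1 \<subseteq> S"
    using S(2) by (auto simp: contains_copy_def rot_trans_copy_def)
  obtain u2 t2 where 2: "norm u2 = 1" "(\<lambda>z. u2 * z + t2) ` seg_half \<subseteq> S"
    using S(3) by (auto simp: contains_copy_def rot_trans_copy_def)
  obtain u3 t3 where 3: "norm u3 = 1" "(\<lambda>z. u3 * z + t3) ` rect \<subseteq> S"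
    using S(4) by (auto simp: contains_copy_def rot_trans_copy_def)
  \<comment> \<open>The factor \<open>\<i>\<close> lays the upright rectangle \<open>rect\<close> on
    its long side; the division by 10^5 changes the unit.\<close>
  define a where "a = u3 * \<i> / 10 ^ 5"
  have a0: "a \<noteq> 0" and na: "cmod a = 1 / 10 ^ 5" using 3 by (auto simp: a_def norm_mult norm_divide norm_power)
  define f where "f = (\<lambda>z. a * z)"
  define S' where "S' = (\<lambda>z. t1 + f z) -` S"
  have lf: "linear f" by (auto simp: f_def intro!: linearI simp: algebra_simps)
  have "convex S'"
  proof -
    have "S' = f -` ((+) (- t1) ` S)" by (force simp: S'_def image_iff)
    then show ?thesis using S(1) lf by (simp add: convex_linear_vimage convex_translation)
  qed
  moreover have "cball 0 (10 ^ 5 / (2 * pi)) \<subseteq> S'"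
  proof -
    have "sphere t1 (1 / (2 * pi)) \<subseteq> S"
    proof
      fix z assume "z \<in> sphere t1 (1 / (2 * pi))"
      then have "(z - t1) / u1 \<in> circ1" using 1(1) by (auto simp: circ1_def dist_norm norm_divide norm_minus_commute)
      then have "u1 * ((z - t1) / u1) + t1 \<in> S" using 1(2) by blast
      moreover have "u1 \<noteq> 0" using 1(1) by auto
      ultimately show "z \<in> S" by simp
    qed
    then have "cball t1 (1 / (2 * pi)) \<subseteq> S" using S(1) by (intro cball_subset_convex) auto
    moreover have "t1 + f z \<in> cball t1 (1 / (2 * pi))" if "z \<in> cball 0 (10 ^ 5 / (2 * pi))" for z
      using that by (simp add: f_def dist_norm norm_mult na field_simps)
    ultimately show ?thesis unfolding S'_def by blast
  qed
  \<comment> \<open>\<open>t2 + u2 / 4\<close> is the midpoint of the copy of the segment, and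
    \<open>u2 / 4\<close> is half of the segment as a vector.\<close>
  moreover define x where "x = (t2 + u2 / 4 - t1) / a"
  moreover define e where "e = (u2 / 4) / a"
  moreover have "x + e \<in> S'" "x - e \<in> S'"
  proof -
    have "1/2 \<in> seg_half" "0 \<in> seg_half" by (auto simp: seg_half_def)
    then have "u2 * (1/2) + t2 \<in> S" "u2 * 0 + t2 \<in> S" using 2(2) by blast+
    moreover have "t1 + f (x + e) = u2 * (1/2) + t2" "t1 + f (x - e) = u2 * 0 + t2"
      using a0 by (simp_all add: f_def x_def e_def field_simps)
    ultimately show "x + e \<in> S'" "x - e \<in> S'" by (simp_all add: S'_def)
  qed
  \<comment> \<open>\<open>Complex 0.08635 0.16365\<close> is the centre of
    \<open>rect\<close>.\<close>
  moreover define y where "y = (t3 + u3 * Complex 0.08635 0.16365 - t1) / a"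
  moreover have "y + Complex p q \<in> S'" if "\<bar>p\<bar> = 16365" "\<bar>q\<bar> = 8635" for p q
  proof -
    \<comment> \<open>The quarter turn in \<open>a\<close> sends the offset
      \<open>Complex p q\<close> to a multiple of \<open>Complex (- q) p\<close>.\<close>
    have "Complex (0.08635 - q / 10 ^ 5) (0.16365 + p / 10 ^ 5) \<in> rect"
      using that by (auto simp: rect_def abs_if split: if_splits)
    then have "u3 * Complex (0.08635 - q / 10 ^ 5) (0.16365 + p / 10 ^ 5) + t3 \<in> S" using 3(2) by blast
    moreover have "t1 + f (y + Complex p q) = u3 * Complex (0.08635 - q / 10 ^ 5) (0.16365 + p / 10 ^ 5) + t3"
    proof -
      have "t1 + f (y + Complex p q) = t3 + u3 * Complex 0.08635 0.16365 + a * Complex p q"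
        using a0 by (simp add: f_def y_def distrib_left)
      also have "a * Complex p q = u3 * Complex (- q / 10 ^ 5) (p / 10 ^ 5)"
        by (simp add: a_def complex_eq_iff field_simps)
      also have "t3 + u3 * Complex 0.08635 0.16365 + u3 * Complex (- q / 10 ^ 5) (p / 10 ^ 5) =
          u3 * (Complex 0.08635 0.16365 + Complex (- q / 10 ^ 5) (p / 10 ^ 5)) + t3"
        by (simp add: algebra_simps)
      also have "Complex 0.08635 0.16365 + Complex (- q / 10 ^ 5) (p / 10 ^ 5) =
          Complex (0.08635 - q / 10 ^ 5) (0.16365 + p / 10 ^ 5)"
        by (simp add: complex_eq_iff)
      finally show ?thesis .
    qed
    ultimately show ?thesis by (simp add: S'_def)
  qed
  ultimately have "config S' x y e" by (simp add: config_def)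
  moreover have "cmod e = 25000" using 2(1) by (simp add: e_def norm_divide na)
  ultimately have "big S'" by (rule main)
  then obtain T where T: "T \<subseteq> S'" "compact T" "10 ^ 9 \<le> measure lebesgue T" by (auto simp: big_def)
  define T' where "T' = (+) t1 ` f ` T"
  have T': "T' \<subseteq> S" "compact T'" using T lf
    by (auto simp: T'_def S'_def intro!: compact_translation compact_linear_image_complex)
  have "measure lebesgue T' = measure lebesgue (f ` T)" by (simp add: T'_def measure_translation)
  also have "\<dots> = (cmod a)\<^sup>2 * measure lebesgue T"
    unfolding measure_linear_image_complex[OF lf T(2)] cmod_power2 by (simp add: f_def power2_eq_square)
  finally have "0.1 \<le> measure lebesgue T'" using T(3) by (simp add: na power2_eq_square)
  then have "ennreal 0.1 \<le> emeasure lebesgue T'"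
    using T'(2) by (simp add: emeasure_eq_measure2 lmeasurable_compact ennreal_leI)
  \<comment> \<open>Monotonicity of \<open>emeasure\<close> requires the larger set to be
    measurable, which convexity provides.\<close>
  also have "\<dots> \<le> emeasure lebesgue S"
    using T'(1) convex_lebesgue_sets[OF S(1)] by (rule emeasure_mono)
  finally show ?thesis .
qed

section \<open>The certificates\<close>

text \<open>Integer points near the multiples of 3 degrees, rounded so as to stay in the disk. The
  sum at entry 120 is twice the area of the polygon. Compared with the disk about 0.00004 is lost in
  the original scale, little against the slack of about 0.00044.\<close>

definition circle_table :: "(int \<times> int \<times> int) list" where
  "circle_table = [
    (15915, 0, 0), (15893, 833, 13257195), (15828, 1664, 26518423), (15719, 2490, 39773727), (15568, 3307,
    52992140), (15373, 4119, 66278221), (15136, 4919, 79552824), (14858, 5704, 92802066), (14539, 6474,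
    106062302), (14181, 7225, 119298783), (13783, 7958, 132569006), (13347, 8669, 145838407), (12875, 9356,
    159099564), (12369, 10015, 172318325), (11828, 10649, 185578386), (11254, 11253, 198835024), (10649,
    11828, 212114139), (10015, 12369, 225374200), (9356, 12875, 238592961), (8669, 13347, 251854118),
    (7958, 13783, 265123519), (7225, 14181, 278393742), (6474, 14539, 291630223), (5704, 14858, 304890459),
    (4919, 15136, 318139701), (4119, 15373, 331414304), (3307, 15568, 344700385), (2490, 15719, 357918798),
    (1664, 15828, 371174102), (833, 15893, 384435330), (0, 15915, 397692525), (-833, 15893, 410949720),
    (-1664, 15828, 424210948), (-2490, 15719, 437466252), (-3312, 15567, 450765750), (-4119, 15373,
    463970847), (-4919, 15136, 477245450), (-5704, 14858, 490494692), (-6474, 14539, 503754928), (-7225,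
    14181, 516991409), (-7958, 13783, 530261632), (-8669, 13347, 543531033), (-9356, 12875, 556792190),
    (-10015, 12369, 570010951), (-10649, 11828, 583271012), (-11253, 11254, 596527650), (-11828, 10649,
    609806765), (-12369, 10015, 623066826), (-12875, 9356, 636285587), (-13347, 8669, 649546744), (-13783,
    7958, 662816145), (-14181, 7225, 676086368), (-14539, 6474, 689322849), (-14858, 5704, 702583085),
    (-15136, 4919, 715832327), (-15373, 4119, 729106930), (-15568, 3307, 742393011), (-15719, 2490,
    755611424), (-15828, 1664, 768866728), (-15893, 833, 782127956), (-15915, 0, 795385151), (-15893, -833,
    808642346), (-15828, -1664, 821903574), (-15719, -2490, 835158878), (-15567, -3312, 848458376),
    (-15373, -4119, 861663473), (-15136, -4919, 874938076), (-14858, -5704, 888187318), (-14539, -6474,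
    901447554), (-14181, -7225, 914684035), (-13783, -7958, 927954258), (-13347, -8669, 941223659),
    (-12875, -9356, 954484816), (-12369, -10015, 967703577), (-11828, -10649, 980963638), (-11254, -11253,
    994220276), (-10649, -11828, 1007499391), (-10015, -12369, 1020759452), (-9356, -12875, 1033978213),
    (-8669, -13347, 1047239370), (-7958, -13783, 1060508771), (-7225, -14181, 1073778994), (-6474, -14539,
    1087015475), (-5704, -14858, 1100275711), (-4919, -15136, 1113524953), (-4119, -15373, 1126799556),
    (-3312, -15567, 1140004653), (-2490, -15719, 1153304151), (-1664, -15828, 1166559455), (-833, -15893,
    1179820683), (0, -15915, 1193077878), (833, -15893, 1206335073), (1664, -15828, 1219596301), (2490,
    -15719, 1232851605), (3307, -15568, 1246070018), (4119, -15373, 1259356099), (4919, -15136,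
    1272630702), (5704, -14858, 1285879944), (6474, -14539, 1299140180), (7225, -14181, 1312376661), (7958,
    -13783, 1325646884), (8669, -13347, 1338916285), (9356, -12875, 1352177442), (10015, -12369,
    1365396203), (10649, -11828, 1378656264), (11253, -11254, 1391912902), (11828, -10649, 1405192017),
    (12369, -10015, 1418452078), (12875, -9356, 1431670839), (13347, -8669, 1444931996), (13783, -7958,
    1458201397), (14181, -7225, 1471471620), (14539, -6474, 1484708101), (14858, -5704, 1497968337),
    (15136, -4919, 1511217579), (15373, -4119, 1524492182), (15567, -3312, 1537697279), (15719, -2490,
    1550996777), (15828, -1664, 1564252081), (15893, -833, 1577513309), (15915, 0, 1590770504), (15893,
    833, 1604027699), (15828, 1664, 1617288927), (15719, 2490, 1630544231), (15568, 3307, 1643762644),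
    (15373, 4119, 1657048725), (15136, 4919, 1670323328), (14858, 5704, 1683572570), (14539, 6474,
    1696832806), (14181, 7225, 1710069287), (13783, 7958, 1723339510), (13347, 8669, 1736608911), (12875,
    9356, 1749870068), (12369, 10015, 1763088829), (11828, 10649, 1776348890), (11254, 11253, 1789605528),
    (10649, 11828, 1802884643), (10015, 12369, 1816144704), (9356, 12875, 1829363465), (8669, 13347,
    1842624622), (7958, 13783, 1855894023), (7225, 14181, 1869164246), (6474, 14539, 1882400727), (5704,
    14858, 1895660963), (4919, 15136, 1908910205), (4119, 15373, 1922184808), (3307, 15568, 1935470889),
    (2490, 15719, 1948689302), (1664, 15828, 1961944606), (833, 15893, 1975205834), (0, 15915, 1988463029)]"

text \<open>The form with \<open>list_all\<close> and \<open>successively\<close> lets each property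
  be evaluated in one pass over the list, without access by index. A half turn of 60 steps has 61
  vertices.\<close>

lemma circle_table_lists:
  "length circle_table = 151"
  "list_all (\<lambda>(x, y, s). x * x + y * y \<le> 253302959) circle_table"
  "successively (\<lambda>(x, y, s) (x', y', s'). s' = s + (x * y' - y * x')) circle_table"
  "successively (\<lambda>(x, y, s) (x', y', s'). x' \<le> x) (take 61 circle_table)"
  "successively (\<lambda>(x, y, s) (x', y', s'). x \<le> x') (take 61 (drop 60 circle_table))"
  "successively (\<lambda>(x, y, s) (x', y', s'). y' \<le> y) (take 61 (drop 30 circle_table))"
  "successively (\<lambda>(x, y, s) (x', y', s'). y \<le> y') (drop 90 circle_table)"
  by code_simp+

lemma successively_nth: "successively R xs \<Longrightarrow> Suc i < length xs \<Longrightarrow> R (xs ! i) (xs ! Suc i)"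
  by (induction xs arbitrary: i rule: induct_list012) (auto simp: nth_Cons split: nat.splits)

lemma ctab_ok_circle_table: "ctab_ok circle_table"
proof -
  note [simp] = circle_table_lists(1)
  show ?thesis
    unfolding ctab_ok_def
  proof (intro conjI allI impI)
    fix i :: nat
    show "circle_x circle_table i * circle_x circle_table i + circle_y circle_table i * circle_y circle_table i \<le> 253302959" if "i \<le> 150"
      using circle_table_lists(2) that by (simp add: list_all_length split_beta circle_x_def circle_y_def)
    show "circle_sum circle_table (Suc i) = circle_sum circle_table i +
        (circle_x circle_table i * circle_y circle_table (Suc i) - circle_y circle_table i * circle_x circle_table (Suc i))" if "i < 150"
      using successively_nth[OF circle_table_lists(3), of i] that
      by (auto simp: circle_x_def circle_y_def circle_sum_def split: prod.splits)
    show "circle_x circle_table (Suc i) \<le> circle_x circle_table i" if "i < 60"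
      using successively_nth[OF circle_table_lists(4), of i] that
      by (auto simp: circle_x_def split: prod.splits)
    show "circle_x circle_table i \<le> circle_x circle_table (Suc i)" if "i < 120" "60 \<le> i"
      using successively_nth[OF circle_table_lists(5), of "i - 60"] that
      by (auto simp: circle_x_def less_diff_conv2 split: prod.splits)
    show "circle_y circle_table (Suc i) \<le> circle_y circle_table i" if "i < 90" "30 \<le> i"
      using successively_nth[OF circle_table_lists(6), of "i - 30"] that
      by (auto simp: circle_y_def less_diff_conv2 split: prod.splits)
    show "circle_y circle_table i \<le> circle_y circle_table (Suc i)" if "i < 150" "90 \<le> i"
      using successively_nth[OF circle_table_lists(7), of "i - 90"] that
      by (auto simp: circle_y_def less_diff_conv2 split: prod.splits)
  qed
qed

lemma far_ok_circle_table: "far_ok circle_table"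
  by code_simp

text \<open>The polygons and the trees below were found by a numerical search.\<close>

definition polygons :: "(vertex list \<times> vertex list \<times> polygon) list" where
  "polygons = [
    ([Arc 0 33, K2, K3], [Arc 86 119], Polygon False (Form 1632750773 0 0 (-822) (-48556) 0 0 0 0 0) [(0, -1, 0,
    -13875)]),
    ([K4, K1, Arc 27 60], [Arc 61 95], Polygon False (Form 1635812716 0 0 (-1629) 48362 0 0 0 0 0) [(0, 1, 0,
    -13875)]),
    ([LP, Arc 31 40, K2], [LQ, Arc 94 101, K4, K1], Polygon False (Form 795190034 2474 (-16945) (-711) 16834
    (-36870) 31461 (-2) 0 0) [(1, 0, 1, -833), (0, -1, 0, -8407), (-1, 0, 1, -3307), (0, 1, 0, -7696)]),
    ([K4, K1, Arc 21 39, K2], [LQ, Arc 99 102], Polygon False (Form 1030300693 23590 (-22816) 5094 30145 (-23590)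
    22816 (-1) 1 0) [(0, 1, 0, -9140), (0, -1, 0, -9140), (-1, 0, 1, -7225)]),
    ([LP, Arc 21 39, K2, LQ], [Arc 79 102, K4], Polygon False (Form 843130244 (-1444) 834 (-2131) (-1306) (-16836)
    44798 (-2) 0 0) [(1, 0, 1, 7225), (0, -1, 0, -9140), (-1, 1, 1, 16365), (0, 1, 0, -7009)]),
    ([LP, Arc 32 36, K2, K3], [LQ, Arc 93 118], Polygon False (Form 872283603 1363 10408 4919 (-32406) (-36347)
    24576 (-1) 1 0) [(1, 0, 1, -1664), (0, -1, 0, -11446), (-1, 0, 1, -2490)]),
    ([LP, K1, Arc 19 39, K2, LQ], [K3, Arc 80 103, K4], Polygon False (Form 1156056378 0 0 (-2079) (-2248) 0 34540
    0 0 0) [(1, -1, 1, 16365), (0, 1, 0, -6350), (0, -1, 0, -8407), (-1, 1, 1, 16365)]),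
    ([K1, Arc 21 39, K2], [LQ, Arc 90 95, LP], Polygon False (Form 644244268 28611 (-542) 14450 0 (-4119) 48558 0
    2 0) [(0, 1, 0, -9140), (0, -1, 0, -9140), (-1, 0, 1, 0), (1, 0, 1, 4119)]),
    ([LP, Arc 24 36, K2], [LQ, Arc 78 108], Polygon False (Form 762023450 (-947) 2982 4919 (-15136) (-14965) 46002
    (-1) 1 0) [(1, 0, 1, 4919), (0, -1, 0, -11446), (-1, 0, 1, 9356)]),
    ([LP, K1, Arc 23 60], [Arc 61 97, K4], Polygon False (Form 1368783745 0 17270 0 29716 0 17270 0 0 0) [(1, -1,
    1, 16365), (0, 1, 0, -10661)]),
    ([LP, Arc 22 40, K2, LQ], [Arc 85 101, K4], Polygon False (Form 751156443 2355 (-834) (-711) (-436) (-22137)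
    47182 (-2) 0 0) [(1, 0, 1, 6474), (0, -1, 0, -8407), (-1, 1, 1, 16365), (0, 1, 0, -7696)]),
    ([LP, K2, Arc 60 60, K3, Arc 71 89], [Arc 90 106, K4], Polygon True (Form 837573353 (-32730) 17270 (-25175)
    1980 (-32730) 17270 0 0 0) [(1, -1, 1, 8635), (0, 1, 0, -34), (0, -1, 0, -8635)]),
    ([LP, Arc 23 38, K2], [LQ, Arc 79 105, K4], Polygon False (Form 812567801 (-2965) 1511 (-4779) (-3285)
    (-18357) 45475 (-2) 0 0) [(1, 0, 1, 5704), (0, -1, 0, -9891), (-1, 0, 1, 8669), (0, 1, 0, -5112)]),
    ([K4, K1, Arc 23 38, LQ], [Arc 82 99], Polygon False (Form 1070430525 0 (-29078) (-1521) 46309 0 29078 0 0 0)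
    [(0, 1, 0, -10661), (-1, 0, 1, 6474)]),
    ([Arc 30 40, K2, LQ, Arc 80 89], [Arc 90 102, K4, LP, K1, Arc 140 149], Polygon True (Form 1000400029 8407
    (-5148) 6560 12875 (-8407) 39688 (-1) 1 0) [(0, -1, 0, -5148), (-1, 1, 1, -8635), (1, 0, -1, -13783),
    (0, 1, 0, -4240), (1, -1, 1, -8635), (-1, 1, -1, -8635)]),
    ([K1, K2, Arc 57 89], [Arc 90 115, K4], Polygon True (Form 1363774153 0 0 (-63822) 23879 0 0 0 0 0) [(0, 1, 0,
    4516)]),
    ([LP, Arc 27 36, K2, Arc 56 58], [LQ, Arc 91 103, K4], Polygon False (Form 706336359 2786 6797 (-20664) 540
    (-30536) 41911 (-1) (-1) 0) [(1, 0, 1, 2490), (0, -1, 0, -11446), (0, 1, 0, 797), (-1, 0, 1, -833)]),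
    ([K2, Arc 59 59, LQ], [Arc 90 110, K4, LP], Polygon True (Form 399943994 (-16837) 522 (-29676) 8791 (-48623)
    34018 0 0 0) [(0, 1, 0, 677), (-1, 0, 1, -833), (1, -1, 1, -8635)]),
    ([LP, Arc 18 36, K2, K3], [Arc 82 102], Polygon False (Form 1173690826 0 25750 (-1555) (-46945) 0 25750 0 0 0)
    [(1, 0, 1, 9356), (0, -1, 0, -11446)]),
    ([LP, Arc 30 40, K2], [LQ, Arc 93 101, K4], Polygon False (Form 539042092 2490 196 (-711) (-436) (-35220)
    48904 (-2) 0 0) [(1, 0, 1, 0), (0, -1, 0, -8407), (-1, 0, 1, -2490), (0, 1, 0, -7696)]),
    ([LP, K1, Arc 24 39, K2, Arc 56 60], [LQ, Arc 82 102, K4], Polygon False (Form 1102136020 9441 2731 (-12780)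
    17137 (-9441) 31809 0 0 0) [(1, -1, 1, 16365), (0, 1, 0, 797), (0, -1, 0, -9140), (-1, 0, 1, 6474)]),
    ([Arc 30 41, K2, LQ, K3, Arc 78 89], [Arc 90 100, K4, LP, K1, Arc 141 149], Polygon True (Form 1156808772 0 0
    (-1420) 1742 0 34540 0 0 0) [(0, -1, 0, -4712), (-1, 1, 1, -8635), (1, -1, -1, -8635), (0, 1, 0,
    -4240), (1, -1, 1, -8635), (-1, 1, -1, -8635)]),
    ([Arc 0 36, K2, LQ], [K3, Arc 83 119], Polygon False (Form 1366862448 0 (-17270) (-785) (-29994) 0 17270 0 0
    0) [(0, -1, 0, -10661), (-1, 1, 1, 16365)]),
    ([LP, K1, Arc 21 39, K2, LQ], [K3, Arc 77 103, K4], Polygon False (Form 1154481118 0 0 (-5580) 0 0 34540 0 0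
    0) [(1, -1, 1, 16365), (0, 1, 0, -6350), (0, -1, 0, -6350), (-1, 1, 1, 16365)]),
    ([LP, Arc 31 39, K2], [LQ, Arc 88 102, K4], Polygon False (Form 591254181 (-2497) 65 (-2131) (-1306) (-31899)
    48991 (-2) 0 0) [(1, 0, 1, -833), (0, -1, 0, -9140), (-1, 0, 1, 1664), (0, 1, 0, -7009)]),
    ([LP, K2, K3], [LQ, K4, K1], Polygon False (Form 565247100 0 0 0 0 (-65460) 0 0 0 0) [(1, -1, 1, -16365),
    (-1, 1, 1, -16365)]),
    ([LP, Arc 27 35, K2], [LQ, Arc 73 106, K4], Polygon False (Form 831688174 (-9879) 5704 (-7709) (-4724)
    (-17871) 43004 (-2) 0 0) [(1, 0, 1, 2490), (0, -1, 0, -12246), (-1, 0, 1, 12369), (0, 1, 0, -4537)]),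
    ([LP, K2], [LQ, Arc 73 118], Polygon False (Form 596548504 (-28197) (-8351) 0 0 (-36189) 28949 0 2 0) [(1,
    -1, 1, -16365), (-1, 0, 1, 12369)]),
    ([LP, Arc 23 38, K2], [LQ, Arc 75 103], Polygon False (Form 752068141 800 7339 6474 (-14539) (-9422) 47115
    (-1) 1 0) [(1, 0, 1, 5704), (0, -1, 0, -9891), (-1, 0, 1, 11254)]),
    ([LP, Arc 25 36, K2], [LQ, Arc 81 104, K4], Polygon False (Form 757544596 (-3106) 1192 (-5730) (-3308)
    (-21386) 46824 (-2) 0 0) [(1, 0, 1, 4119), (0, -1, 0, -11446), (-1, 0, 1, 7225), (0, 1, 0, -5716)]),
    ([LP, Arc 26 34, K2, Arc 59 59], [LQ, Arc 87 106, K4], Polygon False (Form 779848181 345 7651 (-24409) (-4085)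
    (-26461) 40755 (-1) (-1) 0) [(1, 0, 1, 3307), (0, -1, 0, -13053), (0, 1, 0, 472), (-1, 0, 1, 2490)]),
    ([Arc 30 37, K2, Arc 59 59, LQ], [Arc 90 103, K4, LP, K1, Arc 144 149], Polygon True (Form 983338691 15893 522
    (-15285) 13480 (-15893) 34018 0 0 0) [(0, -1, 0, -6223), (0, 1, 0, -3734), (-1, 0, 1, -833), (1, -1, 1,
    -8635), (-1, 1, -1, -8635)]),
    ([LP, Arc 33 40, K2, K3], [LQ, Arc 93 101, K4, K1], Polygon False (Form 1064515465 0 0 (-711) (-436) (-37710)
    14168 (-2) 0 0) [(1, 0, 1, -2490), (0, -1, 0, -8407), (-1, 0, 1, -2490), (0, 1, 0, -7696)]),
    ([LP, Arc 28 34, K2], [LQ, Arc 80 115], Polygon False (Form 769729894 (-5302) (-2471) 3312 (-15567) (-22116)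
    42365 (-1) 1 0) [(1, 0, 1, 1664), (0, -1, 0, -13053), (-1, 0, 1, 7958)]),
    ([LP, Arc 30 31, K2], [Arc 60 61, LQ, Arc 97 110, K4], Polygon False (Form 600374323 5232 10525 (-28865)
    (-7935) (-37962) 38575 (-1) (-1) 0) [(1, 0, 1, 0), (0, -1, 0, -15532), (1, 0, -1, -15893), (-1, 0, 1,
    -5704), (0, 1, 0, -2582)]),
    ([LP, K2, LQ], [Arc 92 102, K4, Arc 120 120, K1], Polygon True (Form 537343506 (-14701) (-24463) (-9356) 12875
    (-50759) 24463 (-1) 1 0) [(1, -1, 1, 8635), (-1, 1, 1, -8635), (0, 1, 0, -4240), (0, -1, 0, -8635)]),
    ([LP, Arc 30 32, K2], [Arc 60 108], Polygon False (Form 1044886716 (-12875) 25271 (-14251) (-15828) (-12875)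
    25271 0 0 0) [(1, 0, 1, 0), (0, -1, 0, -14701)]),
    ([Arc 33 39, K2, LQ], [Arc 93 102, K4, Arc 118 121, LP], Polygon True (Form 647664537 472 (-9468) 13697 (-2970)
    (-37238) 39240 (-1) 1 0) [(0, -1, 0, -5546), (-1, 1, 1, -8635), (0, 1, 0, -4240), (1, 0, 1, 833)]),
    ([LP, Arc 28 35, K2, K3], [LQ, Arc 88 107, K4], Polygon False (Form 900413658 0 17270 (-8250) (-22628)
    (-29402) 31656 (-2) 0 0) [(1, 0, 1, 1664), (0, -1, 0, -12246), (-1, 0, 1, 1664), (0, 1, 0, -3996)]),
    ([LP, Arc 31 37, K2], [LQ, Arc 86 117], Polygon False (Form 684434226 (-3499) (-5819) 5704 (-14858) (-29605)
    42585 (-1) 1 0) [(1, 0, 1, -833), (0, -1, 0, -10661), (-1, 0, 1, 3312)]),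
    ([Arc 30 39, K2, Arc 58 61, LQ], [Arc 92 102, K4, LP], Polygon True (Form 700693568 1192 9555 (-17959) 358
    (-33922) 39545 (-1) (-1) 0) [(0, -1, 0, -5546), (0, 1, 0, -4240), (-1, 0, 1, 833), (1, -1, 1, -8635)]),
    ([LP, Arc 31 35, K2, K3], [LQ, Arc 83 115], Polygon False (Form 975872728 (-5545) 13789 4119 (-32643) (-26867)
    26235 (-1) 1 0) [(1, 0, 1, -833), (0, -1, 0, -12246), (-1, 0, 1, 5704)]),
    ([K4, K1, Arc 23 37, K2, K3], [LQ], Polygon False (Form 1138645593 32730 0 11408 0 (-32730) 0 0 0 0) [(0, 1,
    0, -10661), (0, -1, 0, -10661)]),
    ([Arc 34 82], [LQ, Arc 113 113, LP], Polygon True (Form 636249725 3162 30106 0 0 (-39502) 12436 0 0 0) [(-1,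
    0, 1, 5704), (1, 0, 1, -5704)]),
    ([Arc 33 38, K2, Arc 60 60, K3, LQ], [Arc 94 103, K4, LP], Polygon True (Form 758433816 817 17421 (-3541)
    (-2170) (-38527) 31287 (-2) 0 0) [(0, -1, 0, -5904), (0, 1, 0, -3734), (-1, 1, 1, 8635), (1, -1, 1,
    -8635)]),
    ([K2, Arc 57 89], [Arc 90 111, K4, LP], Polygon True (Form 806629101 (-32730) 17270 (-29900) 9715 (-32730)
    17270 0 0 0) [(0, 1, 0, 1410), (1, -1, 1, -8635)]),
    ([LP, K1, Arc 20 40, K2], [LQ, Arc 90 101, K4], Polygon False (Form 868226290 16365 (-7280) 7247 13347
    (-16365) 41820 (-1) 1 0) [(1, -1, 1, 16365), (0, 1, 0, -7696), (0, -1, 0, -8407), (-1, 0, 1, 0)]),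
    ([Arc 30 34, K2, LQ, K3, Arc 73 89], [Arc 90 108, K4, LP], Polygon True (Form 842219797 (-16365) 7280 (-21932)
    (-16226) (-16365) 41820 (-1) (-1) 0) [(0, -1, 0, -6932), (-1, 1, 1, -8635), (1, -1, -1, -8635), (0, 1,
    0, -721), (1, -1, 1, -8635)]),
    ([LP, Arc 28 33, K2, K3], [LQ, Arc 85 108], Polygon False (Form 889527268 1035 18446 2490 (-32989) (-23457)
    31922 (-1) 1 0) [(1, 0, 1, 1664), (0, -1, 0, -13875), (-1, 0, 1, 4119)]),
    ([LP, Arc 55 55, LQ], [Arc 95 144], Polygon True (Form 649554106 (-800) (-30509) 0 0 (-39784) 8475 0 0 0) [(1,
    0, 1, 4119), (-1, 0, 1, -4119)]),
    ([LP, Arc 26 36, K2], [LQ, Arc 89 104, K4], Polygon False (Form 638216826 2474 (-325) (-5730) (-3308) (-28590)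
    48731 (-2) 0 0) [(1, 0, 1, 3307), (0, -1, 0, -11446), (-1, 0, 1, 833), (0, 1, 0, -5716)]),
    ([LP, Arc 20 40, K2], [LQ, Arc 81 101, K4], Polygon False (Form 830683709 733 (-398) (-711) (-436) (-17547)
    45234 (-2) 0 0) [(1, 0, 1, 7958), (0, -1, 0, -8407), (-1, 0, 1, 7225), (0, 1, 0, -7696)]),
    ([K1, K2, Arc 53 56, LQ], [Arc 90 107, LP], Polygon True (Form 582760546 19564 (-572) (-47588) 5704 (-11572)
    37872 1 1 0) [(0, 1, 0, -2931), (-1, 0, 1, -3307), (1, 0, 1, -10015)]),
    ([K4, K1, Arc 21 41, K2, LQ], [Arc 84 100], Polygon False (Form 1229975267 11446 (-23771) 7936 31887 (-11446)
    23771 (-1) 1 0) [(0, 1, 0, -9140), (0, -1, 0, -7696), (-1, 1, 1, 16365)]),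
    ([LP, Arc 23 38, K2], [LQ, Arc 76 103, K4], Polygon False (Form 854728186 (-4945) 3030 (-3541) (-2170)
    (-16377) 43956 (-2) 0 0) [(1, 0, 1, 5704), (0, -1, 0, -9891), (-1, 0, 1, 10649), (0, 1, 0, -6350)]),
    ([K1, Arc 23 39, K2], [LQ, Arc 97 97, LP], Polygon False (Form 575682270 32730 0 12929 677 (-11408) 46986 0 2
    0) [(0, 1, 0, -10661), (0, -1, 0, -9140), (-1, 0, 1, -5704), (1, 0, 1, 5704)]),
    ([Arc 30 36, K2, Arc 59 60, LQ], [Arc 92 104, K4, LP], Polygon True (Form 682310273 1214 8722 (-21623) (-2475)
    (-33944) 40378 (-1) (-1) 0) [(0, -1, 0, -6501), (0, 1, 0, -3193), (-1, 0, 1, 0), (1, -1, 1, -8635)]),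
    ([LP, Arc 31 31, LQ], [Arc 66 113], Polygon False (Form 623030261 (-29994) 785 0 0 (-1388) 42409 0 0 0) [(1,
    0, 1, -833), (-1, 0, 1, 833)]),
    ([LP, Arc 34 38, K2], [LQ, Arc 93 103, K4], Polygon False (Form 483500681 (-822) (-152) (-3541) (-2170)
    (-38532) 48556 (-2) 0 0) [(1, 0, 1, -3312), (0, -1, 0, -9891), (-1, 0, 1, -2490), (0, 1, 0, -6350)]),
    ([LP, K1, Arc 25 36, K2], [LQ, Arc 76 104, K4], Polygon False (Form 1039835779 5716 (-3193) (-1611) 12065
    (-5716) 37733 (-1) 1 0) [(1, -1, 1, 16365), (0, 1, 0, -5716), (0, -1, 0, -11446), (-1, 0, 1, 10649)]),
    ([LP, K1, Arc 29 31, K2], [LQ, Arc 76 106], Polygon False (Form 929998996 10253 (-1179) 1666 0 (-1179) 39747 0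
    2 0) [(1, -1, 1, 16365), (0, 1, 0, -15532), (0, -1, 0, -15532), (-1, 0, 1, 10649)]),
    ([Arc 30 35, K2, Arc 60 60, K3, Arc 72 89], [Arc 90 105, K4, LP], Polygon True (Form 1123507408 (-16365) 24550
    (-20009) (-13475) (-16365) 24550 (-1) (-1) 0) [(0, -1, 0, -6738), (0, 1, 0, -721), (1, -1, 1, -8635)]),
    ([K1, Arc 27 33, K2], [LQ, Arc 85 109, LP], Polygon False (Form 869160464 15264 (-6704) 4980 0 (-9228) 41312 0
    2 0) [(0, 1, 0, -13875), (0, -1, 0, -13875), (-1, 0, 1, 4119), (1, 0, 1, 13347)]),
    ([K4, K1, K2], [LQ, Arc 80 109], Polygon False (Form 976287165 8407 (-22418) (-46077) 25939 (-8407) 22418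
    (-1) 1 0) [(-1, 0, 1, 7958)]),
    ([LP, Arc 36 39, K2, K3], [LQ, Arc 93 103, K4], Polygon False (Form 740537457 (-2429) 16687 (-2790) (-19082)
    (-40139) 30855 (-2) 0 0) [(1, 0, 1, -4919), (0, -1, 0, -9140), (-1, 0, 1, -2490), (0, 1, 0, -6350)]),
    ([K1, Arc 26 56], [LQ, Arc 98 100, LP], Polygon False (Form 650413705 30449 4572 3307 15568 (-13635) 40264 1 1
    0) [(0, 1, 0, -13058), (-1, 0, 1, -6474), (1, 0, 1, 7958)]),
    ([Arc 30 42, K2, Arc 57 57, LQ, Arc 81 89], [Arc 90 100, K4, LP, K1, Arc 142 149], Polygon True (Form 1080794097
    8494 599 (-7847) 17937 (-8494) 33941 0 0 0) [(0, -1, 0, -4240), (0, 1, 0, -5148), (-1, 0, 1, -2490),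
    (1, 0, -1, -14181), (1, -1, 1, -8635), (-1, 1, -1, -8635)]),
    ([Arc 30 37, K2, Arc 59 60, LQ, Arc 82 89], [Arc 90 104, K4, LP, Arc 144 149], Polygon True (Form 896365220
    (-2005) 9232 (-20838) (-2197) (-20887) 38310 (-1) (-1) 0) [(0, -1, 0, -6223), (0, 1, 0, -3193), (-1, 0,
    1, 0), (1, 0, -1, -14539), (1, -1, 1, -8635), (-1, 0, -1, -15136)]),
    ([Arc 30 37, K2, Arc 60 60], [LQ, Arc 98 103, K4, LP, Arc 144 149], Polygon True (Form 685873329 10943 9232
    (-20226) (-2489) (-33835) 38310 (-1) (-1) 0) [(0, -1, 0, -6223), (0, 1, 0, -3734), (-1, 0, 1, 14539),
    (1, -1, 1, -8635), (-1, 0, -1, -15136)]),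
    ([LP, K1, Arc 23 50, LQ], [Arc 73 98, K4], Polygon False (Form 1065287164 1414 (-703) (-770) 29397 (-1414)
    35243 0 0 0) [(1, -1, 1, 16365), (0, 1, 0, -9891), (-1, 0, 1, 13783)]),
    ([K1, Arc 27 33, K2, LQ], [Arc 75 106, LP], Polygon False (Form 961999765 9648 (-604) 4980 0 (-574) 39172 0 2
    0) [(0, 1, 0, -13875), (0, -1, 0, -13875), (-1, 1, 1, 16365), (1, 0, 1, 11828)]),
    ([Arc 30 35, K2, Arc 58 59, LQ, Arc 82 89], [Arc 90 105, K4, LP, K1, Arc 146 149], Polygon True (Form 1076100547
    9419 1898 (-19655) 13113 (-9419) 32642 0 0 0) [(0, -1, 0, -6738), (0, 1, 0, -2619), (-1, 0, 1, -833),
    (1, 0, -1, -14539), (1, -1, 1, -8635), (-1, 1, -1, -8635)]),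
    ([LP, K1, Arc 20 36, K2], [LQ, Arc 79 99], Polygon False (Form 839325762 16836 834 12877 (-1353) 1444 44798 0
    2 0) [(1, -1, 1, 16365), (0, 1, 0, -8407), (0, -1, 0, -11446), (-1, 0, 1, 8669)]),
    ([LP, K2, K3], [Arc 64 115, K4, K1], Polygon False (Form 1095722321 (-32730) 0 (-30940) 807 (-32730) 0 0 0 0)
    [(1, -1, 1, -16365), (0, 1, 0, -992)]),
    ([LP, Arc 31 38, K2, K3], [LQ, Arc 95 103, K4, K1], Polygon False (Form 1062059317 3286 520 (-3541) (-2170)
    (-37682) 13996 (-2) 0 0) [(1, 0, 1, -833), (0, -1, 0, -9891), (-1, 0, 1, -4119), (0, 1, 0, -6350)]),
    ([K1, K2, Arc 53 58, LQ], [Arc 90 105, K4, LP], Polygon True (Form 669697142 15828 (-309) (-58841) 16958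
    (-15828) 34849 0 0 0) [(0, 1, 0, -2619), (-1, 0, 1, -1664), (1, -1, 1, -8635)]),
    ([LP, K1, Arc 27 34, K2, Arc 56 60], [Arc 61 104, K4], Polygon False (Form 1372927055 0 17270 (-20415) 15287 0
    17270 0 0 0) [(1, -1, 1, 16365), (0, 1, 0, 797), (0, -1, 0, -13053)]),
    ([Arc 30 39, K2, Arc 59 59, LQ, Arc 75 89], [Arc 90 102, K4, LP, K1, Arc 143 149], Polygon True (Form 1187153761
    4639 5184 (-12320) 14385 (-4639) 29356 0 0 0) [(0, -1, 0, -5546), (0, 1, 0, -4240), (-1, 0, 1, -833),
    (1, 0, -1, -11253), (1, -1, 1, -8635), (-1, 1, -1, -8635)]),
    ([LP, K2, Arc 57 66, LQ], [Arc 98 106, K4, K1], Polygon True (Form 675122859 (-11120) (-9620) (-27547) 30409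
    (-54340) 9620 0 0 0) [(1, -1, 1, 8635), (0, 1, 0, -2014), (-1, 0, 1, 4919)]),
    ([LP, Arc 26 34, K2], [LQ, Arc 85 107, K4], Polygon False (Form 680961882 (-812) 195 (-9057) (-5552) (-25304)
    48211 (-2) 0 0) [(1, 0, 1, 3307), (0, -1, 0, -13053), (-1, 0, 1, 4119), (0, 1, 0, -3996)]),
    ([Arc 30 37, K2, LQ, K3, Arc 78 89], [Arc 90 105, K4, LP, Arc 143 149], Polygon True (Form 954348422 (-10661)
    6223 (-14905) (-16479) (-10661) 40763 (-1) (-1) 0) [(0, -1, 0, -6223), (-1, 1, 1, -8635), (1, -1, -1,
    -8635), (0, 1, 0, -2619), (1, -1, 1, -8635), (-1, 0, -1, -14858)]),
    ([LP, Arc 28 37, K2, Arc 52 53], [LQ, Arc 84 102, K4], Polygon False (Form 714638015 (-4762) 3623 (-18191) 4491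
    (-24640) 45303 (-1) (-1) 0) [(1, 0, 1, 1664), (0, -1, 0, -10661), (0, 1, 0, 1826), (-1, 0, 1, 4919)]),
    ([K2, K3, LQ], [Arc 102 125, LP], Polygon True (Form 587494833 (-6017) 276 0 (-17270) (-57459) 8756 0 2 0)
    [(-1, 1, 1, 8635), (1, 0, 1, 4119)]),
    ([LP, K2, K3], [LQ, Arc 89 118], Polygon False (Form 667054948 (-16661) 3041 0 (-17270) (-47725) 17557 0 2 0)
    [(1, -1, 1, -16365), (-1, 0, 1, 833)]),
    ([LP, Arc 31 39, K2, K3], [LQ, Arc 92 102, K4], Polygon False (Form 820840885 831 17335 (-2131) (-18576)
    (-35227) 31721 (-2) 0 0) [(1, 0, 1, -833), (0, -1, 0, -9140), (-1, 0, 1, -1664), (0, 1, 0, -7009)]),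
    ([LP, Arc 28 40, K2, Arc 55 56, LQ], [Arc 93 101, K4, K1], Polygon False (Form 926808566 3357 (-11833) (-16084)
    20953 (-32759) 26219 (-1) (-1) 0) [(1, 0, 1, 1664), (0, -1, 0, -8407), (0, 1, 0, 992), (-1, 0, 1,
    15568)]),
    ([Arc 30 38, K2, Arc 55 56, LQ], [Arc 90 102, K4, LP, Arc 145 149], Polygon True (Form 722002749 3322 4786
    (-18255) 2455 (-27814) 43230 (-1) (-1) 0) [(0, -1, 0, -5904), (0, 1, 0, -4240), (-1, 0, 1, -3307), (1,
    -1, 1, -8635), (-1, 0, -1, -15373)]),
    ([LP, Arc 22 36, LQ], [Arc 77 104, K4], Polygon False (Form 645123144 (-14987) (-4331) (-10649) 11828 (-4795)
    50679 (-1) (-1) 0) [(1, 0, 1, 6474), (-1, 0, 1, 4919), (0, 1, 0, -5716)]),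
    ([LP, Arc 24 38, K2, K3], [Arc 82 105], Polygon False (Form 1137191694 (-6334) 26390 0 (-46348) (-6334) 26390
    0 0 0) [(1, 0, 1, 4919), (0, -1, 0, -9891)]),
    ([LP, K1, Arc 25 40, K2, Arc 54 57, LQ], [Arc 83 101, K4], Polygon False (Form 1043886809 10015 (-78) (-11728)
    19856 (-10015) 34618 0 0 0) [(1, -1, 1, 16365), (0, 1, 0, 1229), (0, -1, 0, -8407), (-1, 0, 1, 15719)]),
    ([LP, Arc 35 40, K2], [LQ, Arc 89 101, K4, K1], Polygon False (Form 808418242 (-4952) (-17790) (-711) 16834
    (-36016) 31266 (-2) 0 0) [(1, 0, 1, -4119), (0, -1, 0, -8407), (-1, 0, 1, 833), (0, 1, 0, -7696)]),
    ([LP, Arc 31 33, K2, K3], [LQ, Arc 93 111, K4], Polygon False (Form 779284572 1657 17444 (-11691) (-25764)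
    (-36053) 31612 (-2) 0 0) [(1, 0, 1, -833), (0, -1, 0, -13875), (-1, 0, 1, -2490), (0, 1, 0, -2184)]),
    ([LP, Arc 22 39, K2], [LQ, Arc 77 101], Polygon False (Form 713202209 4155 6882 7225 (-14181) (-8545) 48890
    (-1) 1 0) [(1, 0, 1, 6474), (0, -1, 0, -9140), (-1, 0, 1, 10015)]),
    ([Arc 32 39, K2, LQ, Arc 81 89], [Arc 90 102, K4, Arc 119 120, LP], Polygon True (Form 807634619 (-8439) (-6988)
    13762 (-2139) (-26719) 38644 (-1) 1 0) [(0, -1, 0, -5546), (-1, 1, 1, -8635), (1, 0, -1, -14181), (0,
    1, 0, -4240), (1, 0, 1, 0)]),
    ([K1, K2, LQ, Arc 76 89], [Arc 90 111, LP], Polygon True (Form 746595779 7900 (-4603) (-32730) 0 (-3532) 36323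
    0 2 0) [(-1, 1, 1, -8635), (1, 0, -1, -11828), (1, 0, 1, -7225)]),
    ([LP, Arc 29 32, K2, Arc 53 54], [LQ, Arc 81 104, K4], Polygon False (Form 739122685 (-7621) 5428 (-23843) 1704
    (-23443) 43628 (-1) (-1) 0) [(1, 0, 1, 833), (0, -1, 0, -14701), (0, 1, 0, 1507), (-1, 0, 1, 7225)]),
    ([LP, Arc 36 39, K2, K3, LQ], [Arc 92 102, K4, Arc 120 120, K1], Polygon True (Form 1029397205 (-3255) (-692)
    (-2131) (-18576) (-39313) 13694 (-2) 0 0) [(1, 0, 1, 15136), (0, -1, 0, -5546), (-1, 1, 1, 8635), (0,
    1, 0, -4240)]),
    ([LP, Arc 32 36, K2, Arc 53 60], [Arc 61 68, LQ, Arc 101 102, K4, K1], Polygon False (Form 917871938 5179 320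
    (-19295) 20713 (-41237) 14066 (-1) (-1) 0) [(1, 0, 1, -1664), (0, -1, 0, -11446), (0, 1, 0, 1507), (1,
    0, -1, -14539), (-1, 0, 1, -8669)]),
    ([LP, Arc 14 37, K2, LQ], [K3, Arc 82 111], Polygon False (Form 1065297326 (-2353) 604 (-770) (-29397) (-2353)
    35144 0 0 0) [(1, 0, 1, 11828), (0, -1, 0, -9891), (-1, 1, 1, 16365)]),
    ([LP, Arc 32 36, K2, K3], [Arc 79 80, LQ, Arc 107 109], Polygon False (Form 724199286 5316 28265 (-3750)
    (-45753) (-35338) 20729 0 0 0) [(1, 0, 1, -1664), (0, -1, 0, -11446), (1, 0, -1, -7958), (-1, 0, 1,
    -12369)]),
    ([LP, Arc 34 39, K2, K3], [LQ, Arc 91 103, K4], Polygon False (Form 793533689 (-2479) 16944 (-2790) (-19082)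
    (-36875) 31460 (-2) 0 0) [(1, 0, 1, -3312), (0, -1, 0, -9140), (-1, 0, 1, -833), (0, 1, 0, -6350)]),
    ([LP, Arc 27 40, K2, K3], [LQ, Arc 99 101, K4, K1], Polygon False (Form 1064537863 9715 1538 (-711) (-436)
    (-37465) 12630 (-2) 0 0) [(1, 0, 1, 2490), (0, -1, 0, -8407), (-1, 0, 1, -7225), (0, 1, 0, -7696)]),
    ([Arc 34 34, K2, Arc 59 62, K3], [LQ, Arc 96 106, K4, LP], Polygon True (Form 703675303 1607 17701 (-8581)
    (-2421) (-40961) 30703 (-2) 0 0) [(0, -1, 0, -6932), (0, 1, 0, -2014), (-1, 0, 1, 15136), (1, -1, 1,
    -8635)]),
    ([Arc 30 38, K2, Arc 59 60, LQ, Arc 79 89], [Arc 90 103, LP, Arc 143 149], Polygon True (Form 835910252 2935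
    13880 (-9419) (-13706) (-11557) 40574 0 0 0) [(0, -1, 0, -5904), (0, 1, 0, -7802), (-1, 0, 1, 0), (1,
    0, -1, -13347), (1, 0, 1, -12369), (-1, 0, -1, -14858)]),
    ([LP, Arc 21 40, K2], [LQ, Arc 79 101, K4], Polygon False (Form 843953110 (-1444) 834 (-711) (-436) (-16836)
    44798 (-2) 0 0) [(1, 0, 1, 7225), (0, -1, 0, -8407), (-1, 0, 1, 8669), (0, 1, 0, -7696)]),
    ([Arc 30 37, K2, Arc 59 59, LQ, Arc 76 89], [Arc 90 103, K4, LP, Arc 144 149], Polygon True (Form 963692103
    (-6202) 11110 (-20204) (-1656) (-16690) 36432 (-1) (-1) 0) [(0, -1, 0, -6223), (0, 1, 0, -3734), (-1,
    0, 1, -833), (1, 0, -1, -11828), (1, -1, 1, -8635), (-1, 0, -1, -15136)]),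
    ([K4, K1, Arc 23 51], [LQ, Arc 87 97], Polygon False (Form 1174189512 11691 (-22944) 0 46986 (-11691) 22944 0
    0 0) [(0, 1, 0, -10661), (-1, 0, 1, 2490)]),
    ([LP, Arc 35 36, K2, K3], [LQ, Arc 82 105, K4], Polygon False (Form 893022710 (-10593) 18104 (-6334) (-21152)
    (-30375) 29912 (-2) 0 0) [(1, 0, 1, -4119), (0, -1, 0, -11446), (-1, 0, 1, 6474), (0, 1, 0, -5112)]),
    ([Arc 33 39, K2, Arc 60 60, K3], [LQ, Arc 96 102, K4, K1, LP], Polygon True (Form 1016142002 2429 583 (-2131)
    15964 (-40139) 13585 (-2) 0 0) [(0, -1, 0, -5546), (0, 1, 0, -4240), (-1, 0, 1, 15136), (1, -1, 1,
    8635)]),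
    ([Arc 32 40, K2, Arc 60 61], [LQ, Arc 95 101, K4, LP], Polygon True (Form 636702395 1983 9923 (-16626) (-436)
    (-38041) 39003 (-1) (-1) 0) [(0, -1, 0, -5148), (0, 1, 0, -4712), (-1, 0, 1, 15373), (1, -1, 1,
    -8635)]),
    ([Arc 30 38, K2, Arc 60 60, LQ, Arc 87 89], [Arc 90 102, K4, LP, Arc 143 149], Polygon True (Form 847101845 2764
    7774 (-18797) (-1664) (-24086) 39212 (-1) (-1) 0) [(0, -1, 0, -5904), (0, 1, 0, -4240), (-1, 0, 1, 0),
    (1, 0, -1, -15719), (1, -1, 1, -8635), (-1, 0, -1, -14858)]),
    ([LP, K2, LQ], [K3, Arc 78 101, K4], Polygon False (Form 578415227 (-32730) 0 (-18025) 472 (-32730) 34540 0 0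
    0) [(1, -1, 1, -16365), (-1, 1, 1, 16365), (0, -1, 0, -7009), (0, 1, 0, -7696)]),
    ([K1, K2, K3, LQ], [Arc 94 119, LP], Polygon True (Form 896690391 20144 2535 (-32730) (-17270) (-19200) 16401
    0 2 0) [(-1, 1, 1, 8635), (1, 0, 1, -833)]),
    ([LP, Arc 24 37, K2], [LQ, Arc 76 104], Polygon False (Form 737408994 (-14) 6501 5704 (-14858) (-11446) 47427
    (-1) 1 0) [(1, 0, 1, 4919), (0, -1, 0, -10661), (-1, 0, 1, 10649)]),
    ([K4, K1, LP, Arc 29 60], [LQ, Arc 98 100], Polygon False (Form 876921540 6857 (-7281) (-7958) 31053 (-37921)
    21797 (-1) (-1) 0) [(-1, 1, -1, -16365), (1, 0, 1, 833), (-1, 0, 1, -6474)]),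
    ([LP, Arc 29 36, K2], [LQ, Arc 95 106, K4, K1], Polygon False (Form 798630768 4952 (-16750) (-6909) 12783
    (-36016) 31266 (-2) 0 0) [(1, 0, 1, 833), (0, -1, 0, -11446), (-1, 0, 1, -4119), (0, 1, 0, -4537)]),
    ([LP, Arc 27 40, LQ], [K3, Arc 77 101, K4], Polygon False (Form 750005667 (-22282) 1936 (-18684) 978 (-5468)
    46772 0 (-2) 0) [(1, 0, 1, 2490), (-1, 0, 1, 7958), (0, -1, 0, -6350), (0, 1, 0, -7696)]),
    ([Arc 30 38, K2, LQ, K3, Arc 80 89], [Arc 90 104, K4, Arc 118 118, LP, Arc 141 149], Polygon True (Form
    1093432414 (-8603) (-1425) 3695 (-18158) (-8603) 33115 0 0 0) [(0, -1, 0, -5904), (-1, 1, 1, -8635),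
    (1, -1, -1, -8635), (0, 1, 0, -3193), (1, 0, 1, -1664), (-1, 0, -1, -14181)]),
    ([Arc 30 35, K2, Arc 59 61, LQ], [Arc 91 106, K4, LP, Arc 149 149], Polygon True (Form 716658546 1194 9468
    (-23602) (-3891) (-32258) 39588 (-1) (-1) 0) [(0, -1, 0, -6738), (0, 1, 0, -2014), (-1, 0, 1, 833), (1,
    -1, 1, -8635), (-1, 0, -1, -15893)]),
    ([K4, K1, Arc 23 43, LQ], [Arc 80 97], Polygon False (Form 1160909475 2057 (-26152) 0 46986 (-2057) 26152 0 0
    0) [(0, 1, 0, -10661), (-1, 0, 1, 10015)]),
    ([LP, Arc 27 38, K2, LQ], [Arc 82 106, K4, Arc 113 114], Polygon False (Form 766378634 (-2755) (-2536) 9504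
    (-9594) (-22537) 43812 (-1) 1 0) [(1, 0, 1, 2490), (0, -1, 0, 1507), (-1, 1, 1, 16365), (0, 1, 0,
    -4537)]),
    ([Arc 52 61, LQ], [Arc 90 105, K4, K1, K2], Polygon True (Form 990000931 15893 (-15082) (-58522) 34998
    (-15893) 15082 0 0 0) [(-1, 0, 1, 833), (0, 1, 0, -2619)]),
    ([K1, K2, K3, Arc 61 68], [LQ, Arc 109 115, K4], Polygon True (Form 831293614 27886 (-2195) (-63996) 3286
    (-27886) 2195 0 0 0) [(0, 1, 0, 7802), (-1, 0, 1, 8669)]),
    ([Arc 30 43, K2, Arc 55 66, K3, Arc 74 89], [Arc 90 99, K4, LP, K1, Arc 142 149], Polygon True (Form 1410950442 0
    17270 (-2801) 14740 0 17270 0 0 0) [(0, -1, 0, -3716), (0, 1, 0, -2014), (1, -1, 1, -8635), (-1, 1, -1,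
    -8635)]),
    ([Arc 30 39, K2, LQ, Arc 80 89], [Arc 90 103, K4, Arc 118 118, LP, Arc 139 149], Polygon True (Form 965091493
    1248 (-7407) 13038 (-3476) (-15566) 37429 (-1) 1 0) [(0, -1, 0, -5546), (-1, 1, 1, -8635), (1, 0, -1,
    -13783), (0, 1, 0, -3734), (1, 0, 1, -1664), (-1, 0, -1, -13347)]),
    ([K1, K2, Arc 50 52, LQ, Arc 74 89], [Arc 90 103, K4, LP], Polygon True (Form 798285514 2711 147 (-56528) 20327
    (-2711) 34393 0 0 0) [(0, 1, 0, -677), (-1, 0, 1, -6474), (1, 0, -1, -10649), (1, -1, 1, -8635)]),
    ([LP, K2, Arc 59 59, LQ, Arc 86 89], [Arc 90 102, K4, K1], Polygon True (Form 748310664 (-20149) (-16400)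
    (-25249) 30978 (-45311) 16400 0 0 0) [(1, -1, 1, 8635), (0, 1, 0, -4240), (-1, 0, 1, -833), (1, 0, -1,
    -15567)]),
    ([Arc 30 36, LQ, Arc 79 89], [Arc 90 107, K4, Arc 117 122, K1, Arc 141 149], Polygon True (Form 1067558051
    (-3750) (-28483) (-5253) 20042 3750 28483 0 0 0) [(-1, 0, 1, -15136), (1, 0, -1, -13347), (0, 1, 0,
    -1380), (0, -1, 0, -5546)]),
    ([K2, K3], [LQ, Arc 109 131, LP], Polygon True (Form 574300465 0 (-68) 0 (-17270) (-59424) 0 0 2 0) [(-1, 0,
    1, 8669), (1, 0, 1, 8669)])]"

section \<open>Evaluation of the certificates over sixteen cones of directions\<close>

definition library :: "polygon list" where
  "library = map (snd \<circ> snd) polygons"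

lemma polygons_ok_polygons: "polygons_ok circle_table polygons"
  by code_simp

lemma library_sound: "\<forall>p\<in>set library. sound p"
  unfolding library_def by (rule polygons_ok_sound[OF ctab_ok_circle_table polygons_ok_polygons])

text \<open>A cone is a sixteenth of the quarter turn, with five directions about 1.4 degrees apart;
  \<open>E\<close> nodes bring in the inner ones where the chord of the whole cone is too coarse.
  All sixteen trees open alike: polygons 0, 1 and 15 contain no segment end and dispose of rectangle
  centres in the left quarter, in the right quarter and, between these, in the upper half of the
  box.\<close>

lemma cone_big_0: "cone_big (25000, 0) (24879, 2451)"
proof -
  have "check library (
    Y1 16384 (Y1 8192 (L 0) (Y2 8192 (X1 12288 (X2 12288 (Y1 4096 (L 0) (Y2 4096 (X1 6144 (L 22) (X2 6144
    (L 7) (Y1 2048 (L 98) (X2 3072 (L 7) (X1 3072 (Y2 2048 (Y2 1024 (X2 1536 (L 14) (L 21)) (L 70)) (L 7))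
    (L 6)))))) (X1 6144 (L 22) (L 7)))) (Y1 4096 (L 0) (Y2 4096 (X1 6144 (L 22) (X2 6144 (Y1 2048 (L 98)
    (Y2 2048 (X1 3072 (X2 3072 (L 21) (Y1 1024 (L 98) (X1 1536 (L 127) (X1 768 (X1 384 (Y1 512 (L 6) (L
    127)) (L 6)) (L 6))))) (L 6)) (L 70))) (L 57))) (X1 6144 (L 22) (L 70))))) (X2 12288 (Y1 4096 (L 0) (Y2
    4096 (X1 6144 (X2 6144 (L 7) (X2 3072 (L 7) (X2 1536 (L 72) (Y2 2048 (Y2 1024 (L 21) (L 72)) (L 72)))))
    (L 18)) (L 7))) (Y1 4096 (L 0) (Y2 4096 (X1 6144 (X2 6144 (Y1 2048 (L 18) (Y2 2048 (X2 3072 (L 21) (X1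
    3072 (X1 1536 (L 6) (Y1 1024 (L 88) (L 6))) (X2 1536 (X2 768 (X1 1536 (L 80) (L 18)) (L 88)) (L 88))))
    (X2 3072 (L 60) (X1 3072 (Y1 1024 (L 113) (L 6)) (L 28))))) (L 57)) (L 18)) (X1 6144 (L 60) (L 18))))))
    (L 15))) (Y1 8192 (Y2 8192 (X1 12288 (X2 12288 (Y1 4096 (Y2 4096 (X1 6144 (L 13) (X2 6144 (L 7) (Y1
    2048 (X2 3072 (L 7) (Y2 2048 (Y2 1024 (X2 1536 (L 14) (L 21)) (L 70)) (L 70))) (L 119)))) (L 63)) (L
    1)) (Y1 4096 (Y2 4096 (X1 6144 (L 13) (X2 6144 (Y1 2048 (Y2 2048 (X1 3072 (X2 3072 (L 21) (X2 1536 (X2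
    768 (Y2 1024 (L 87) (L 14)) (L 87)) (L 87))) (X1 1536 (X2 3072 (L 21) (Y1 1024 (L 6) (L 87))) (L 6)))
    (X2 3072 (L 70) (X2 1536 (L 70) (X1 3072 (L 26) (X1 1536 (L 26) (L 6)))))) (X1 3072 (L 13) (X1 1536 (L
    13) (X1 768 (L 13) (Y1 1024 (L 6) (L 13)))))) (L 57))) (X1 6144 (L 13) (L 70))) (L 1))) (X2 12288 (Y1
    4096 (Y2 4096 (X1 6144 (X2 6144 (L 7) (Y1 2048 (Y2 2048 (X2 3072 (L 7) (Y2 1024 (X2 1536 (X2 768 (L 72)
    (Y2 512 (L 21) (L 72))) (L 21)) (L 72))) (L 72)) (X1 3072 (L 69) (L 9)))) (L 9)) (L 7)) (L 1)) (Y1 4096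
    (Y2 4096 (X1 6144 (X2 6144 (Y1 2048 (Y2 2048 (X1 3072 (L 6) (X2 3072 (L 21) (X2 1536 (Y2 1024 (L 116)
    (X2 768 (L 21) (Y1 1024 (L 80) (L 26)))) (L 116)))) (X1 3072 (L 6) (X2 3072 (L 60) (Y1 1024 (L 28) (L
    76))))) (X1 3072 (L 69) (L 9))) (L 57)) (L 9)) (X1 6144 (L 60) (L 9))) (L 1)))) (L 15)) (L 1)))
      0 0 0 16384 24576 24576 32768 16384
      [(25000, 0), (24992, 614), (24970, 1224), (24932, 1839), (24879, 2451)]"
    by code_simp
  from check_cone_big[OF library_sound _ this] show ?thesis by (simp add: dirs_ok_def)
qed

lemma cone_big_1: "cone_big (24879, 2451) (24520, 4875)"
proof -
  have "check library (
    Y1 16384 (Y1 8192 (L 0) (Y2 8192 (X1 12288 (X2 12288 (Y1 4096 (L 0) (Y2 4096 (X1 6144 (L 22) (X2 6144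
    (L 7) (Y1 2048 (X1 3072 (L 22) (Y1 1024 (L 8) (L 6))) (Y2 2048 (X1 3072 (X2 3072 (L 7) (Y1 1024 (X1
    1536 (L 14) (L 6)) (L 14))) (L 6)) (L 70))))) (X1 6144 (L 22) (L 7)))) (Y1 4096 (L 0) (Y2 4096 (X1 6144
    (L 22) (X2 6144 (Y1 2048 (X1 3072 (L 22) (X1 1536 (L 98) (Y1 1024 (L 18) (L 6)))) (Y2 2048 (X1 3072 (X2
    3072 (Y1 1024 (X1 1536 (L 22) (L 6)) (Y2 1024 (X1 1536 (X2 1536 (L 21) (Y1 512 (X2 768 (E 2 (L 21) (L
    124)) (L 117)) (L 13))) (X2 1536 (L 21) (Y1 512 (X1 768 (X1 384 (E 2 (L 6) (L 124)) (L 6)) (L 6)) (Y2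
    512 (E 2 (X1 768 (X2 768 (L 21) (Y1 256 (X1 384 (X1 192 (L 127) (L 6)) (L 6)) (L 87))) (L 6)) (L 4)) (L
    4))))) (X1 1536 (L 4) (L 4)))) (Y1 1024 (L 98) (X2 1536 (Y1 512 (L 117) (Y2 1024 (Y1 256 (L 117) (L
    87)) (L 4))) (Y2 1024 (L 87) (L 47))))) (L 6)) (X1 3072 (L 8) (L 6)))) (L 57))) (X1 6144 (L 22) (L
    33))))) (X2 12288 (Y1 4096 (L 0) (Y2 4096 (X1 6144 (X2 6144 (L 7) (Y1 2048 (X2 3072 (L 7) (L 28)) (Y2
    2048 (X1 3072 (X2 3072 (L 7) (Y1 1024 (X1 1536 (L 6) (X2 1536 (L 28) (L 28))) (X1 1536 (L 6) (X1 768 (L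
    6) (X1 384 (L 6) (Y1 512 (L 28) (L 6))))))) (X2 3072 (L 7) (Y1 1024 (L 18) (Y2 1024 (X2 1536 (L 92) (X2
    768 (X2 384 (L 92) (Y2 512 (L 21) (L 28))) (L 21))) (L 28))))) (L 72)))) (L 18)) (L 55))) (Y1 4096 (L
    0) (Y2 4096 (X1 6144 (X2 6144 (Y1 2048 (E 2 (L 18) (L 88)) (Y2 2048 (X1 3072 (X2 3072 (Y1 1024 (Y2 1024
    (X1 1536 (L 6) (L 80)) (L 8)) (X1 1536 (L 6) (Y1 512 (Y2 1024 (X1 768 (L 6) (L 80)) (L 8)) (L 6)))) (X2
    1536 (L 80) (Y2 1024 (L 116) (L 47)))) (X2 3072 (Y2 1024 (X2 1536 (Y1 1024 (L 18) (L 21)) (L 80)) (L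
    28)) (L 88))) (X2 3072 (L 28) (L 28)))) (L 57)) (L 18)) (X1 6144 (L 60) (L 18)))))) (L 15))) (Y1 8192
    (Y2 8192 (X1 12288 (X2 12288 (Y1 4096 (Y2 4096 (X1 6144 (L 13) (X2 6144 (L 7) (Y1 2048 (X2 3072 (X1
    3072 (L 53) (X1 1536 (L 62) (L 23))) (Y2 2048 (X1 3072 (L 14) (X1 1536 (L 14) (L 14))) (L 70))) (L
    119)))) (L 63)) (L 1)) (Y1 4096 (Y2 4096 (X1 6144 (L 13) (X2 6144 (Y1 2048 (Y2 2048 (X1 3072 (X2 3072
    (Y1 1024 (Y2 1024 (X2 1536 (L 14) (Y2 512 (E 2 (X2 768 (L 21) (L 87)) (L 51)) (L 4))) (L 51)) (L 13))
    (Y1 1024 (Y2 1024 (L 87) (L 4)) (L 13))) (X2 3072 (Y1 1024 (X1 1536 (X1 768 (X1 384 (E 2 (L 6) (L 51))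
    (L 23)) (L 23)) (L 23)) (X1 1536 (X1 768 (L 13) (X2 1536 (L 14) (L 104))) (L 23))) (Y1 1024 (Y1 512 (L
    6) (X1 1536 (L 54) (L 4))) (L 54)))) (X2 3072 (L 70) (X1 3072 (L 4) (X1 1536 (L 4) (L 6))))) (X1 3072
    (L 13) (X1 1536 (L 13) (X1 768 (L 13) (Y1 1024 (L 23) (L 13)))))) (L 57))) (X2 6144 (L 94) (L 27))) (L
    1))) (X2 12288 (Y1 4096 (Y2 4096 (X1 6144 (X2 6144 (L 7) (Y1 2048 (Y2 2048 (X1 3072 (L 23) (X2 3072 (Y1
    1024 (L 7) (L 20)) (Y1 1024 (Y2 1024 (X1 1536 (X2 1536 (Y1 512 (X1 768 (L 6) (Y1 256 (L 92) (X1 384 (L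
    6) (L 92)))) (X1 768 (L 14) (X1 384 (L 23) (L 77)))) (Y1 512 (Y2 512 (E 2 (L 21) (X1 768 (L 6) (X2 768
    (X2 384 (X2 192 (Y2 256 (L 21) (L 92)) (L 21)) (L 21)) (L 21)))) (X1 768 (L 6) (X2 768 (L 92) (L 21))))
    (X1 768 (L 23) (X1 384 (L 23) (X1 192 (L 23) (L 123)))))) (Y1 512 (Y1 256 (L 18) (L 123)) (L 123))) (X1
    1536 (Y1 512 (X1 768 (L 6) (L 28)) (L 77)) (L 77))) (X1 1536 (L 23) (L 9))))) (L 72)) (X1 3072 (X1 1536
    (Y1 1024 (L 23) (L 119)) (L 69)) (L 9)))) (L 9)) (L 55)) (L 1)) (Y1 4096 (Y2 4096 (X1 6144 (X2 6144 (Y1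
    2048 (Y2 2048 (X1 3072 (L 23) (X2 3072 (Y1 1024 (Y2 1024 (X2 1536 (L 21) (L 80)) (E 2 (L 21) (Y2 512
    (X2 1536 (L 21) (L 80)) (Y2 256 (L 21) (L 28))))) (X1 1536 (L 23) (L 9))) (X2 1536 (Y1 1024 (L 47) (X1
    1536 (L 23) (L 9))) (L 61)))) (X1 3072 (L 6) (Y1 1024 (L 28) (L 76)))) (X1 3072 (X1 1536 (Y1 1024 (L
    23) (X1 768 (L 13) (L 9))) (L 69)) (L 9))) (L 57)) (L 9)) (X1 6144 (X2 6144 (L 94) (L 57)) (L 9))) (L
    1)))) (L 15)) (L 1)))
      0 0 0 16384 24576 24576 32768 16384
      [(24879, 2451), (24812, 3060), (24729, 3669), (24632, 4273), (24520, 4875)]"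
    by code_simp
  from check_cone_big[OF library_sound _ this] show ?thesis by (simp add: dirs_ok_def)
qed

text \<open>One of the deepest trees. Half-widths go down to 128, and \<open>E 2\<close> followed by
  \<open>E 1\<close> isolates single steps of the direction list: for small slack both the
  second-order error on the box and the loss from the chord have to be small.\<close>

lemma cone_big_2: "cone_big (24520, 4875) (23923, 7258)"
proof -
  have "check library (
    Y1 16384 (Y1 8192 (L 0) (Y2 8192 (X1 12288 (X2 12288 (Y1 4096 (L 0) (Y2 4096 (X1 6144 (X1 3072 (L 22)
    (Y1 2048 (L 22) (L 53))) (X2 6144 (L 7) (Y1 2048 (Y2 2048 (X1 3072 (L 22) (L 8)) (L 7)) (Y2 2048 (X2
    3072 (L 7) (X1 3072 (L 14) (X2 1536 (L 14) (X1 1536 (L 51) (L 51))))) (X1 3072 (L 4) (L 8)))))) (X1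
    6144 (L 39) (L 7)))) (Y1 4096 (L 0) (Y2 4096 (X1 6144 (Y1 2048 (L 22) (Y1 1024 (L 22) (L 13))) (X2 6144
    (Y1 2048 (X1 3072 (L 22) (X1 1536 (L 98) (Y1 1024 (L 33) (L 98)))) (Y2 2048 (X1 3072 (X2 3072 (X1 1536
    (Y1 1024 (L 22) (E 2 (L 124) (X1 768 (L 4) (L 4)))) (Y2 1024 (Y1 1024 (X2 1536 (L 124) (L 117)) (X1 768
    (L 4) (L 4))) (L 4))) (Y1 1024 (X1 1536 (L 22) (E 2 (L 98) (L 33))) (X1 1536 (X1 768 (L 93) (X1 384 (L
    93) (X2 1536 (X2 768 (L 93) (L 47)) (L 47)))) (X2 1536 (X2 768 (E 2 (L 80) (L 12)) (L 47)) (L 47)))))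
    (X2 3072 (Y1 1024 (Y2 1024 (X2 1536 (L 12) (L 117)) (L 8)) (Y2 1024 (X1 1536 (L 4) (L 4)) (L 4))) (L
    47))) (L 8))) (L 57))) (X1 6144 (L 39) (L 33))))) (X2 12288 (Y1 4096 (L 0) (Y2 4096 (X1 6144 (X2 6144
    (L 7) (Y1 2048 (L 8) (Y2 2048 (X1 3072 (X2 3072 (L 7) (Y1 1024 (X1 1536 (L 12) (L 8)) (Y2 1024 (X2 1536
    (Y2 512 (L 51) (L 14)) (L 12)) (X1 1536 (L 14) (X1 768 (L 14) (L 8)))))) (X2 3072 (L 7) (Y1 1024 (L 8)
    (Y2 1024 (Y2 512 (X1 1536 (L 104) (L 18)) (L 113)) (L 8))))) (L 72)))) (L 18)) (L 55))) (Y1 4096 (L 0)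
    (Y2 4096 (X1 6144 (X2 6144 (Y1 2048 (L 88) (Y2 2048 (X1 3072 (X2 3072 (Y2 1024 (X2 1536 (L 12) (L 80))
    (Y1 1024 (L 8) (L 8))) (L 47)) (X1 1536 (X2 3072 (X2 1536 (Y2 1024 (L 54) (L 8)) (L 47)) (L 47)) (L
    18))) (L 113))) (L 57)) (L 18)) (X1 6144 (L 60) (L 18)))))) (L 15))) (Y1 8192 (Y2 8192 (X1 12288 (X2
    12288 (Y1 4096 (Y2 4096 (X1 6144 (L 13) (X2 6144 (L 7) (Y1 2048 (Y2 2048 (X1 3072 (L 53) (X2 3072 (X1
    1536 (L 53) (L 46)) (X1 1536 (L 14) (L 14)))) (X1 3072 (L 63) (L 62))) (X2 3072 (L 119) (Y1 1024 (Y2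
    2048 (L 14) (L 53)) (L 13)))))) (L 63)) (L 1)) (Y1 4096 (Y2 4096 (X1 6144 (L 13) (X2 6144 (Y1 2048 (Y2
    2048 (X1 3072 (X1 1536 (L 13) (Y1 1024 (X2 3072 (L 51) (L 4)) (L 13))) (X2 3072 (X1 1536 (X2 1536 (L
    51) (L 4)) (X2 1536 (L 51) (L 4))) (Y1 1024 (L 54) (L 4)))) (X1 3072 (L 4) (X1 1536 (X1 768 (L 4) (L
    12)) (L 23)))) (Y2 2048 (X2 3072 (X1 3072 (L 13) (X1 1536 (L 13) (X1 768 (L 13) (X2 1536 (L 51) (L
    4))))) (L 4)) (X2 3072 (Y2 1024 (X2 1536 (L 71) (L 4)) (L 63)) (L 4)))) (L 57))) (X2 6144 (L 94) (L
    27))) (L 1))) (X2 12288 (Y1 4096 (Y2 4096 (X1 6144 (X2 6144 (L 7) (Y1 2048 (Y2 2048 (X1 3072 (X2 3072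
    (L 46) (Y1 1024 (Y2 1024 (X1 1536 (X2 1536 (L 14) (L 51)) (X2 1536 (L 14) (Y2 512 (X2 768 (X2 384 (X2
    192 (L 14) (L 4)) (L 4)) (L 4)) (X2 768 (L 14) (X2 384 (Y1 512 (L 4) (L 14)) (L 4)))))) (X1 1536 (L 14)
    (L 59))) (X2 1536 (L 89) (X2 768 (L 66) (Y2 1024 (Y2 512 (L 104) (X1 1536 (L 14) (L 14))) (L 14))))))
    (X2 3072 (X2 1536 (L 7) (X2 768 (L 31) (X2 384 (L 31) (L 66)))) (Y1 1024 (Y2 1024 (X1 1536 (X2 1536 (Y1
    512 (Y2 512 (X2 768 (L 14) (X1 768 (L 51) (X2 384 (Y1 256 (L 51) (L 66)) (L 104)))) (X1 768 (L 14) (Y1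
    256 (L 28) (L 66)))) (L 66)) (Y1 512 (Y2 512 (L 104) (E 2 (X1 768 (Y2 256 (E 1 (L 23) (L 4)) (L 23))
    (X1 384 (Y1 256 (L 28) (Y2 256 (E 1 (L 23) (Y1 128 (L 12) (L 4))) (L 28))) (L 28))) (X2 768 (Y2 256 (L
    12) (X1 768 (X2 384 (L 14) (L 12)) (L 103))) (L 12)))) (Y2 512 (X2 768 (X2 384 (Y2 256 (L 51) (L 66))
    (L 104)) (L 54)) (E 2 (X1 768 (X2 768 (L 14) (Y2 256 (E 1 (L 21) (L 4)) (L 23))) (X2 768 (L 77) (Y1 256
    (Y2 256 (L 54) (L 77)) (L 77)))) (X1 768 (X2 768 (Y1 256 (Y2 256 (L 4) (L 14)) (L 20)) (L 54)) (X2 768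
    (Y2 256 (X2 384 (L 20) (L 67)) (L 20)) (L 105))))))) (X2 1536 (Y1 512 (X2 768 (X2 384 (L 92) (L 92)) (L
    103)) (L 66)) (Y1 512 (L 103) (Y2 512 (L 105) (L 123))))) (X1 1536 (X2 1536 (L 14) (Y1 512 (X1 768 (X2
    768 (L 14) (Y1 256 (L 28) (X1 384 (L 59) (X1 192 (L 59) (L 113))))) (L 28)) (X1 768 (X1 384 (L 14) (L
    59)) (L 77)))) (X2 1536 (L 66) (L 103)))) (Y2 1024 (X2 1536 (L 20) (X2 768 (L 66) (X2 384 (L 66) (Y2
    512 (L 104) (L 66))))) (L 20))))) (L 60)) (X1 3072 (X1 1536 (Y1 1024 (L 69) (L 119)) (L 20)) (L 9))))
    (Y1 2048 (Y1 1024 (L 18) (L 9)) (L 9))) (X2 6144 (L 55) (L 52))) (L 1)) (Y1 4096 (Y2 4096 (X1 6144 (X2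
    6144 (Y1 2048 (Y2 2048 (X1 3072 (X2 3072 (Y1 1024 (X2 1536 (Y2 1024 (L 4) (Y2 512 (E 2 (L 23) (L 12))
    (L 59))) (L 54)) (X2 1536 (X2 768 (Y2 1024 (L 4) (L 59)) (L 54)) (L 12))) (L 26)) (X2 3072 (Y1 1024 (Y2
    1024 (X2 1536 (X1 1536 (L 54) (L 105)) (L 47)) (X1 1536 (X2 1536 (Y1 512 (Y2 512 (E 2 (L 113) (X1 768
    (L 12) (L 28))) (L 8)) (Y2 512 (E 2 (X1 768 (L 23) (X1 384 (L 23) (X1 192 (L 23) (L 76)))) (X1 768 (L
    54) (L 105))) (X1 768 (L 59) (L 77)))) (L 26)) (Y1 512 (L 28) (L 76)))) (Y2 1024 (X1 1536 (X2 1536 (X1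
    768 (X2 768 (L 54) (L 4)) (L 105)) (L 4)) (L 9)) (X1 1536 (X2 1536 (X2 768 (L 77) (Y2 512 (L 54) (L
    77))) (L 26)) (L 9)))) (L 47))) (X1 3072 (L 23) (Y1 1024 (X2 3072 (X2 1536 (L 60) (L 113)) (L 28)) (L
    76)))) (X1 3072 (X1 1536 (X1 768 (Y1 1024 (L 69) (L 13)) (L 69)) (L 69)) (L 9))) (L 57)) (Y1 2048 (Y1
    1024 (L 18) (L 9)) (L 9))) (X1 6144 (X2 6144 (L 94) (L 45)) (L 36))) (L 1)))) (L 15)) (L 1)))
      0 0 0 16384 24576 24576 32768 16384
      [(24520, 4875), (24392, 5479), (24251, 6073), (24094, 6669), (23923, 7258)]"
    by code_simp
  from check_cone_big[OF library_sound _ this] show ?thesis by (simp add: dirs_ok_def)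
qed

lemma cone_big_3: "cone_big (23923, 7258) (23097, 9567)"
proof -
  have "check library (
    Y1 16384 (Y1 8192 (L 0) (Y2 8192 (X1 12288 (X2 12288 (Y1 4096 (L 0) (Y2 4096 (X1 6144 (Y1 2048 (L 22)
    (L 53)) (X2 6144 (L 7) (Y1 2048 (Y2 2048 (L 8) (L 7)) (X2 3072 (X1 3072 (X1 1536 (L 3) (L 10)) (L 46))
    (Y2 2048 (X2 1536 (X1 3072 (L 10) (L 10)) (X1 3072 (L 10) (L 10))) (L 8)))))) (X1 6144 (L 3) (L 7))))
    (Y1 4096 (L 0) (Y2 4096 (X1 6144 (Y1 2048 (L 22) (Y1 1024 (L 22) (L 13))) (X2 6144 (Y1 2048 (Y2 2048 (L
    33) (L 8)) (Y2 2048 (Y1 1024 (X1 3072 (L 120) (X1 1536 (L 120) (L 120))) (Y2 1024 (Y1 512 (L 12) (L 4))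
    (L 29))) (L 8))) (Y1 2048 (Y2 2048 (L 33) (L 8)) (L 111)))) (X1 6144 (L 27) (L 33))))) (X2 12288 (Y1
    4096 (L 0) (Y2 4096 (X1 6144 (X2 6144 (L 7) (Y1 2048 (L 8) (Y2 2048 (X1 3072 (X2 3072 (L 46) (X2 1536
    (Y2 1024 (L 12) (L 62)) (L 29))) (X1 1536 (X2 3072 (L 46) (Y1 1024 (L 8) (Y2 1024 (L 12) (L 8)))) (L
    18))) (L 60)))) (L 18)) (L 55))) (Y1 4096 (L 0) (Y2 4096 (X1 6144 (X2 6144 (Y1 2048 (X2 3072 (L 8) (L
    88)) (Y2 2048 (X2 3072 (Y1 1024 (L 8) (Y2 1024 (L 12) (L 8))) (L 47)) (X1 3072 (L 8) (L 8)))) (X2 3072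
    (X2 1536 (Y2 2048 (L 47) (L 8)) (L 57)) (L 11))) (L 18)) (X2 6144 (L 94) (L 45)))))) (L 15))) (Y1 8192
    (Y2 8192 (X1 12288 (X2 12288 (Y1 4096 (Y2 4096 (X1 6144 (L 13) (X2 6144 (L 7) (Y1 2048 (Y2 2048 (X1
    3072 (L 53) (Y2 1024 (X2 3072 (L 31) (X2 1536 (Y1 1024 (L 10) (X2 768 (L 31) (L 66))) (L 10))) (X2 3072
    (L 62) (X1 1536 (L 10) (X1 768 (L 10) (L 10)))))) (X1 3072 (L 10) (L 62))) (L 106)))) (L 63)) (L 1))
    (Y1 4096 (Y2 4096 (X1 6144 (L 13) (X2 6144 (Y1 2048 (Y2 2048 (X1 3072 (X1 1536 (L 13) (X2 3072 (L 10)
    (L 4))) (X2 3072 (Y1 1024 (L 10) (L 10)) (L 12))) (X1 3072 (L 4) (X2 3072 (L 12) (L 4)))) (X1 3072 (L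
    13) (X1 1536 (L 13) (X2 3072 (X1 768 (L 10) (L 10)) (L 4))))) (Y1 2048 (L 111) (L 12)))) (X2 6144 (L
    94) (L 27))) (L 1))) (X2 12288 (Y1 4096 (Y2 4096 (X1 6144 (X2 6144 (L 55) (Y1 2048 (Y2 2048 (X1 3072
    (X2 3072 (L 46) (Y1 1024 (Y2 1024 (Y1 512 (L 10) (L 10)) (X2 1536 (L 46) (Y2 512 (X2 768 (E 2 (L 14) (L
    10)) (L 12)) (L 59)))) (X2 1536 (L 89) (Y2 1024 (X2 768 (Y2 512 (L 10) (L 89)) (L 4)) (L 89))))) (X2
    3072 (X2 1536 (L 46) (L 31)) (Y1 1024 (Y2 1024 (X1 1536 (X2 1536 (X1 768 (Y1 512 (X2 768 (L 46) (L 51))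
    (Y2 512 (L 10) (L 20))) (L 110)) (X1 768 (Y1 512 (L 12) (X1 384 (L 10) (L 67))) (L 67))) (X2 1536 (L
    110) (L 67))) (X1 1536 (X2 1536 (X2 768 (L 31) (L 71)) (Y1 512 (Y2 512 (E 2 (X1 768 (X2 768 (X2 384 (L
    14) (Y2 256 (L 12) (L 14))) (L 12)) (L 103)) (X1 768 (L 29) (L 67))) (Y1 256 (L 8) (Y1 128 (Y1 64 (L 8)
    (L 71)) (L 71)))) (Y2 512 (X2 768 (L 20) (X1 768 (X2 384 (Y2 256 (L 12) (L 20)) (L 12)) (L 67))) (L
    20)))) (X2 1536 (X2 768 (L 31) (L 71)) (L 103)))) (X2 1536 (L 20) (Y2 1024 (Y2 512 (L 110) (X2 768 (L
    20) (L 67))) (L 20)))))) (X2 3072 (L 7) (Y2 1024 (X2 1536 (L 31) (L 71)) (L 60)))) (X1 3072 (X1 1536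
    (Y1 1024 (L 69) (L 106)) (L 20)) (L 20)))) (Y1 2048 (Y1 1024 (Y1 512 (L 18) (L 9)) (L 9)) (L 9))) (X1
    6144 (L 62) (X2 6144 (L 55) (L 52)))) (L 1)) (Y1 4096 (Y2 4096 (X1 6144 (X2 6144 (Y1 2048 (Y2 2048 (X1
    3072 (X2 3072 (X2 1536 (X2 768 (Y1 1024 (L 12) (Y1 512 (L 12) (Y2 1024 (L 4) (L 89)))) (L 12)) (L 12))
    (L 12)) (X2 3072 (Y1 1024 (Y2 1024 (L 54) (X1 1536 (X2 1536 (Y1 512 (Y2 512 (L 12) (Y2 256 (E 2 (L 8)
    (L 29)) (L 8))) (X2 768 (Y2 512 (L 54) (Y2 256 (X1 768 (L 12) (L 67)) (L 71))) (L 26))) (L 26)) (Y2 512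
    (L 61) (X2 1536 (L 103) (L 36))))) (Y2 1024 (X1 1536 (L 12) (L 61)) (X2 1536 (X2 768 (Y2 512 (L 105) (L
    20)) (L 105)) (X1 1536 (L 12) (L 61))))) (L 47))) (X1 3072 (X2 3072 (X1 1536 (L 59) (X2 1536 (X1 768 (L
    59) (L 59)) (L 26))) (L 26)) (X2 3072 (Y1 1024 (Y2 1024 (X1 1536 (X2 1536 (Y1 512 (L 8) (X1 768 (X2 768
    (L 59) (X2 384 (L 59) (L 26))) (L 76))) (L 26)) (L 36)) (L 60)) (X1 1536 (X2 1536 (L 20) (Y2 1024 (L
    26) (L 76))) (L 76))) (Y1 1024 (L 36) (X1 1536 (L 26) (L 36)))))) (Y2 2048 (X1 3072 (X2 3072 (Y1 1024
    (L 69) (L 81)) (L 4)) (X1 1536 (X2 3072 (X2 1536 (L 69) (L 29)) (L 4)) (L 9))) (X2 3072 (Y2 1024 (X2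
    1536 (L 71) (L 95)) (L 125)) (L 95)))) (Y1 2048 (Y2 2048 (L 116) (X1 3072 (L 26) (L 11))) (L 81))) (Y1
    2048 (Y1 1024 (L 36) (L 9)) (L 9))) (X2 6144 (Y2 2048 (L 125) (L 15)) (L 45))) (L 1)))) (L 15)) (L 1)))
      0 0 0 16384 24576 24576 32768 16384
      [(23923, 7258), (23738, 7842), (23539, 8421), (23324, 8999), (23097, 9567)]"
    by code_simp
  from check_cone_big[OF library_sound _ this] show ?thesis by (simp add: dirs_ok_def)
qed

lemma cone_big_4: "cone_big (23097, 9567) (22049, 11783)"
proof -
  have "check library (
    Y1 16384 (Y1 8192 (L 0) (Y2 8192 (X1 12288 (X2 12288 (Y1 4096 (L 0) (Y2 4096 (X1 6144 (Y1 2048 (L 22)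
    (L 53)) (X2 6144 (L 7) (Y1 2048 (X1 3072 (L 33) (L 8)) (Y2 2048 (X1 3072 (X2 3072 (L 10) (L 10)) (X2
    3072 (L 10) (L 10))) (X1 3072 (L 4) (L 62)))))) (X1 6144 (L 3) (L 7)))) (Y1 4096 (L 0) (Y2 4096 (X1
    6144 (X1 3072 (L 22) (X1 1536 (L 22) (X1 768 (L 39) (L 39)))) (X2 6144 (Y1 2048 (L 33) (Y2 2048 (Y1
    1024 (L 120) (Y2 1024 (X1 3072 (L 29) (L 12)) (L 29))) (L 33))) (Y1 2048 (L 27) (L 111)))) (L 94))))
    (X2 12288 (Y1 4096 (L 0) (Y2 4096 (X1 6144 (X2 6144 (L 7) (Y1 2048 (L 8) (Y2 2048 (X1 3072 (X2 3072 (L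
    46) (Y1 1024 (L 8) (L 29))) (X2 3072 (X1 1536 (X1 768 (L 46) (L 46)) (L 48)) (X1 1536 (Y1 1024 (L 8)
    (Y1 512 (L 38) (X1 768 (L 79) (L 38)))) (L 48)))) (X1 3072 (L 62) (X2 3072 (L 7) (L 48)))))) (L 18)) (L
    55))) (Y1 4096 (L 0) (Y2 4096 (X1 6144 (X2 6144 (Y1 2048 (L 41) (Y2 2048 (Y1 1024 (X1 3072 (X2 3072 (L
    29) (L 33)) (L 41)) (X1 3072 (L 29) (X1 1536 (X2 3072 (X2 1536 (L 29) (L 26)) (L 26)) (L 88)))) (X1
    3072 (Y1 1024 (L 8) (L 8)) (X2 3072 (L 48) (L 41))))) (X1 3072 (X1 1536 (L 33) (X1 768 (L 33) (L 11)))
    (L 11))) (L 18)) (X2 6144 (L 94) (L 45)))))) (L 15))) (Y1 8192 (Y2 8192 (X1 12288 (X2 12288 (Y1 4096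
    (Y2 4096 (X1 6144 (L 3) (X2 6144 (L 3) (Y1 2048 (Y2 2048 (X1 3072 (L 53) (X2 3072 (L 31) (X1 1536 (L
    10) (L 10)))) (X1 3072 (L 3) (X1 1536 (L 53) (X2 3072 (L 53) (L 10))))) (L 106)))) (L 63)) (L 1)) (Y1
    4096 (Y2 4096 (X1 6144 (L 13) (X2 6144 (Y1 2048 (Y2 2048 (X1 3072 (X2 3072 (L 10) (L 29)) (X2 3072 (L
    10) (L 29))) (X1 3072 (L 4) (X2 3072 (L 12) (L 12)))) (X1 3072 (L 13) (X2 3072 (L 81) (L 4)))) (Y1 2048
    (L 111) (L 12)))) (X2 6144 (X2 3072 (L 75) (L 27)) (L 27))) (L 1))) (X2 12288 (Y1 4096 (Y2 4096 (X1
    6144 (X2 6144 (Y1 2048 (L 7) (L 65)) (Y1 2048 (Y2 2048 (X1 3072 (X2 3072 (L 31) (Y1 1024 (X2 1536 (Y2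
    1024 (L 50) (L 31)) (X2 768 (Y1 512 (L 29) (Y2 1024 (L 10) (Y2 512 (L 10) (L 31)))) (L 29))) (X2 1536
    (Y2 1024 (X1 1536 (L 10) (L 86)) (L 20)) (X1 1536 (L 10) (Y2 1024 (L 10) (Y2 512 (L 86) (L 89)))))))
    (X2 3072 (L 31) (Y1 1024 (Y2 1024 (X1 1536 (X2 1536 (L 86) (L 110)) (L 118)) (X2 1536 (L 31) (X1 1536
    (X1 768 (Y1 512 (Y1 256 (L 79) (L 30)) (L 30)) (E 2 (L 67) (L 110))) (X2 768 (L 110) (L 67))))) (Y2
    1024 (L 16) (Y2 512 (L 86) (L 20)))))) (X1 3072 (X2 3072 (L 46) (Y1 1024 (X2 1536 (L 46) (Y2 1024 (X2
    768 (L 31) (Y1 512 (L 79) (L 71))) (L 60))) (L 20))) (X2 3072 (X1 1536 (L 46) (L 65)) (Y1 1024 (Y2 1024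
    (X2 1536 (L 31) (X2 768 (L 31) (Y1 512 (Y1 256 (L 48) (L 71)) (L 20)))) (X1 1536 (L 60) (L 52))) (L
    20))))) (Y2 2048 (X1 3072 (X1 1536 (Y1 1024 (E 2 (L 89) (L 86)) (L 106)) (L 89)) (L 20)) (X2 3072 (X2
    1536 (L 52) (L 75)) (Y2 1024 (L 31) (L 75)))))) (X1 3072 (X2 6144 (L 65) (X1 1536 (Y1 2048 (Y1 1024 (Y2
    2048 (L 118) (L 48)) (L 9)) (L 9)) (L 9))) (L 9))) (X2 6144 (L 55) (X1 6144 (L 52) (L 52)))) (L 1)) (Y1
    4096 (Y2 4096 (X1 6144 (X2 6144 (Y1 2048 (Y2 2048 (X1 3072 (X2 3072 (Y1 1024 (L 29) (L 29)) (L 12)) (X2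
    3072 (X1 1536 (X2 1536 (X1 768 (Y1 1024 (L 29) (L 30)) (L 67)) (L 26)) (L 61)) (L 61))) (X1 3072 (X2
    3072 (X1 1536 (L 29) (X2 1536 (Y2 1024 (Y1 1024 (L 29) (Y1 512 (L 79) (L 89))) (L 59)) (L 26))) (L 26))
    (X2 3072 (Y1 1024 (Y2 1024 (X1 1536 (X2 1536 (Y1 512 (X1 768 (X1 384 (L 79) (Y2 512 (L 79) (L 48))) (L
    48)) (E 2 (X2 768 (L 71) (X1 768 (L 26) (L 67))) (L 30))) (L 26)) (L 36)) (Y1 512 (L 48) (L 76))) (Y2
    1024 (X2 1536 (X2 768 (L 20) (L 95)) (L 95)) (L 76))) (Y1 1024 (L 36) (L 95))))) (X2 3072 (X2 1536 (Y2
    2048 (L 81) (X1 3072 (L 95) (L 20))) (L 95)) (L 95))) (Y1 2048 (Y2 2048 (L 116) (L 11)) (L 81))) (Y1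
    2048 (Y1 1024 (L 36) (L 9)) (L 9))) (X2 6144 (X2 3072 (L 75) (L 125)) (L 45))) (L 1)))) (L 15)) (L 1)))
      0 0 0 16384 24576 24576 32768 16384
      [(23097, 9567), (22855, 10131), (22600, 10688), (22330, 11241), (22049, 11783)]"
    by code_simp
  from check_cone_big[OF library_sound _ this] show ?thesis by (simp add: dirs_ok_def)
qed

lemma cone_big_5: "cone_big (22049, 11783) (20786, 13890)"
proof -
  have "check library (
    Y1 16384 (Y1 8192 (L 0) (Y2 8192 (X1 12288 (X2 12288 (Y1 4096 (L 0) (Y2 4096 (X1 6144 (Y1 2048 (L 22)
    (L 53)) (X2 6144 (L 3) (Y1 2048 (L 33) (Y2 2048 (Y1 1024 (L 120) (X2 3072 (L 50) (X1 3072 (L 10) (L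
    10)))) (X1 3072 (L 10) (L 62)))))) (X2 6144 (L 3) (L 112)))) (Y1 4096 (L 0) (Y2 4096 (X1 6144 (X1 3072
    (L 22) (L 39)) (X2 6144 (Y1 2048 (L 33) (Y2 2048 (X1 3072 (L 93) (X2 3072 (Y1 1024 (L 33) (L 24)) (L
    93))) (L 33))) (L 27))) (L 27)))) (X2 12288 (Y1 4096 (L 0) (Y2 4096 (X1 6144 (X2 6144 (L 7) (Y1 2048 (L
    41) (Y2 2048 (X1 3072 (X2 3072 (L 50) (Y1 1024 (L 29) (L 50))) (X1 1536 (X2 3072 (L 68) (Y1 1024 (L 41)
    (L 38))) (L 48))) (X1 3072 (Y1 1024 (L 8) (X1 1536 (L 50) (X1 768 (L 79) (L 48)))) (L 48))))) (L 18))
    (X1 6144 (L 62) (L 18)))) (Y1 4096 (L 0) (Y2 4096 (X1 6144 (X2 6144 (Y1 2048 (L 41) (Y2 2048 (X1 3072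
    (Y1 1024 (X1 1536 (L 33) (L 41)) (X2 3072 (L 29) (L 26))) (X1 1536 (Y1 1024 (L 41) (X1 768 (L 38) (L
    38))) (L 88))) (X1 3072 (X2 3072 (Y1 1024 (L 8) (X1 1536 (L 24) (L 79))) (L 33)) (L 41)))) (X1 3072 (X1
    1536 (L 33) (L 11)) (L 11))) (L 18)) (X1 6144 (L 41) (L 18)))))) (L 15))) (Y1 8192 (Y2 8192 (X1 12288
    (X2 12288 (Y1 4096 (Y2 4096 (X1 6144 (L 3) (X2 6144 (L 3) (Y1 2048 (Y2 2048 (X1 3072 (L 53) (X2 3072 (L
    31) (Y1 1024 (L 10) (Y2 1024 (L 86) (L 86))))) (X1 3072 (L 3) (X1 1536 (L 50) (X2 3072 (L 3) (L 50)))))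
    (L 106)))) (L 63)) (L 1)) (Y1 4096 (Y2 4096 (X1 6144 (L 13) (X2 6144 (Y1 2048 (Y2 2048 (Y2 1024 (X2
    3072 (X1 3072 (L 10) (L 10)) (L 24)) (X2 3072 (L 24) (L 24))) (X1 3072 (L 2) (X1 1536 (L 10) (L 50))))
    (Y2 2048 (L 81) (L 81))) (Y1 2048 (L 111) (L 24)))) (X2 6144 (X2 3072 (X1 6144 (L 3) (L 63)) (L 17)) (L
    27))) (L 1))) (X2 12288 (Y1 4096 (Y2 4096 (X1 6144 (X2 6144 (Y1 2048 (L 55) (L 65)) (Y1 2048 (Y2 2048
    (X1 3072 (X2 3072 (L 31) (Y1 1024 (L 50) (L 86))) (X1 1536 (Y1 1024 (L 118) (L 16)) (L 118))) (X1 3072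
    (X2 3072 (X1 1536 (L 46) (L 46)) (Y1 1024 (X1 1536 (L 50) (Y1 512 (Y1 256 (Y2 1024 (L 50) (L 62)) (L
    30)) (L 30))) (X2 1536 (L 20) (L 30)))) (Y1 1024 (Y2 1024 (Y1 512 (Y1 256 (L 48) (L 30)) (L 30)) (Y1
    512 (L 48) (L 20))) (Y2 1024 (L 16) (L 20))))) (Y2 2048 (X2 3072 (L 31) (L 86)) (X1 3072 (X2 3072 (X2
    1536 (L 65) (L 75)) (Y1 1024 (L 16) (L 16))) (L 20))))) (X2 6144 (L 65) (Y1 2048 (Y1 1024 (Y2 2048 (L
    56) (X2 3072 (L 65) (L 36))) (L 9)) (L 9)))) (X2 6144 (L 55) (X2 3072 (L 52) (X2 1536 (L 52) (L 75)))))
    (L 1)) (Y1 4096 (Y2 4096 (X1 6144 (X2 6144 (Y1 2048 (Y2 2048 (X1 3072 (X2 3072 (Y1 1024 (L 50) (L 81))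
    (L 29)) (X1 1536 (Y1 1024 (Y1 512 (X1 768 (L 38) (L 38)) (L 30)) (L 16)) (L 61))) (X1 3072 (X2 3072 (X1
    1536 (L 50) (Y1 1024 (Y1 512 (L 79) (L 30)) (L 30))) (L 26)) (X2 3072 (Y1 1024 (X1 1536 (Y1 512 (Y1 256
    (L 48) (L 30)) (L 30)) (L 36)) (L 30)) (L 11)))) (Y2 2048 (L 81) (X1 3072 (L 30) (L 30)))) (L 11)) (Y1
    2048 (Y1 1024 (L 36) (L 9)) (L 9))) (X2 6144 (X2 3072 (X2 1536 (L 75) (L 17)) (L 17)) (L 45))) (L 1))))
    (L 15)) (L 1)))
      0 0 0 16384 24576 24576 32768 16384
      [(22049, 11783), (21752, 12322), (21444, 12851), (21121, 13375), (20786, 13890)]"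
    by code_simp
  from check_cone_big[OF library_sound _ this] show ?thesis by (simp add: dirs_ok_def)
qed

lemma cone_big_6: "cone_big (20786, 13890) (19325, 15860)"
proof -
  have "check library (
    Y1 16384 (Y1 8192 (L 0) (Y2 8192 (X1 12288 (X2 12288 (Y1 4096 (L 0) (Y2 4096 (X1 6144 (X1 3072 (L 3) (L
    53)) (X2 6144 (L 3) (Y1 2048 (L 39) (Y2 2048 (X1 3072 (L 37) (X2 3072 (L 19) (Y1 1024 (L 19) (L 19))))
    (X1 3072 (L 2) (X2 3072 (L 19) (L 24))))))) (X2 6144 (L 3) (L 112)))) (Y1 4096 (L 0) (Y2 4096 (X1 6144
    (X1 3072 (L 22) (L 39)) (X2 6144 (Y1 2048 (L 33) (Y2 2048 (X1 3072 (L 39) (X2 3072 (Y1 1024 (L 39) (L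
    24)) (L 93))) (L 39))) (L 27))) (L 27)))) (X2 12288 (Y1 4096 (L 0) (Y2 4096 (X1 6144 (X2 6144 (L 55)
    (Y1 2048 (L 5) (Y2 2048 (X1 3072 (X2 3072 (X1 1536 (L 19) (L 68)) (X1 1536 (L 24) (Y1 1024 (L 5) (L
    38)))) (Y1 1024 (L 5) (L 38))) (X1 3072 (X2 3072 (L 62) (Y1 1024 (L 5) (X1 1536 (L 50) (L 38)))) (L
    48))))) (E 2 (L 18) (L 99))) (X1 6144 (L 62) (L 18)))) (Y1 4096 (L 0) (Y2 4096 (X1 6144 (X2 6144 (Y1
    2048 (L 41) (Y2 2048 (X1 3072 (X2 3072 (Y1 1024 (X1 1536 (L 39) (L 41)) (X1 1536 (L 24) (L 38))) (L
    107)) (X1 1536 (L 107) (L 41))) (X1 3072 (X2 3072 (Y1 1024 (L 5) (X1 1536 (L 24) (L 38))) (L 107)) (L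
    41)))) (L 11)) (L 36)) (X1 6144 (L 41) (L 18)))))) (L 15))) (Y1 8192 (Y2 8192 (X1 12288 (X2 12288 (Y1
    4096 (Y2 4096 (X1 6144 (L 3) (X2 6144 (L 3) (Y1 2048 (Y2 2048 (X1 3072 (L 2) (Y1 1024 (X1 1536 (L 2) (L
    19)) (X1 1536 (L 85) (L 16)))) (X1 3072 (L 3) (X2 3072 (L 3) (Y1 1024 (L 19) (L 16))))) (X2 3072 (L
    106) (L 85))))) (L 121)) (L 1)) (Y1 4096 (Y2 4096 (X1 6144 (X1 3072 (L 13) (X2 6144 (L 2) (L 90))) (X2
    6144 (Y1 2048 (Y2 2048 (X1 3072 (X1 1536 (L 2) (L 2)) (X2 3072 (Y1 1024 (L 19) (L 19)) (L 24))) (X1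
    3072 (L 2) (X2 3072 (L 24) (L 17)))) (Y2 2048 (L 85) (L 16))) (Y1 2048 (L 111) (L 24)))) (X2 6144 (L
    17) (L 27))) (L 1))) (X2 12288 (Y1 4096 (Y2 4096 (X1 6144 (X2 6144 (X2 3072 (L 42) (X2 1536 (L 42) (Y2
    2048 (L 31) (L 65)))) (Y1 2048 (Y2 2048 (X1 3072 (X2 3072 (L 68) (X1 1536 (Y1 1024 (L 19) (L 16)) (L
    118))) (L 56)) (X1 3072 (Y1 1024 (Y1 512 (X1 1536 (L 50) (Y1 256 (L 38) (L 30))) (L 16)) (L 16)) (X1
    1536 (L 34) (L 34)))) (Y2 2048 (X1 3072 (L 16) (L 16)) (X1 3072 (L 16) (L 20))))) (X1 3072 (X2 6144 (X1
    1536 (L 65) (L 65)) (X1 1536 (L 34) (L 34))) (L 9))) (X2 6144 (L 55) (X2 3072 (L 52) (Y2 2048 (L 75) (L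
    15))))) (L 1)) (Y1 4096 (Y2 4096 (X1 6144 (X2 6144 (Y1 2048 (Y2 2048 (X2 3072 (X1 3072 (Y1 1024 (X2
    1536 (X1 1536 (L 19) (L 56)) (L 24)) (L 16)) (X1 1536 (L 56) (L 40))) (X1 3072 (X1 1536 (L 24) (L 61))
    (L 61))) (X1 3072 (Y1 1024 (Y1 512 (X1 1536 (L 79) (L 38)) (L 30)) (L 16)) (Y1 1024 (Y1 512 (X1 1536 (L
    38) (L 41)) (L 30)) (L 30)))) (Y2 2048 (L 16) (L 16))) (L 11)) (Y1 2048 (Y2 2048 (L 61) (L 36)) (L 9)))
    (X2 6144 (L 17) (L 45))) (L 1)))) (L 15)) (L 1)))
      0 0 0 16384 24576 24576 32768 16384
      [(20786, 13890), (20439, 14396), (20079, 14894), (19709, 15380), (19325, 15860)]"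
    by code_simp
  from check_cone_big[OF library_sound _ this] show ?thesis by (simp add: dirs_ok_def)
qed

lemma cone_big_7: "cone_big (19325, 15860) (17678, 17677)"
proof -
  have "check library (
    Y1 16384 (Y1 8192 (L 0) (Y2 8192 (X1 12288 (X2 12288 (Y1 4096 (L 0) (Y2 4096 (X1 6144 (X1 3072 (L 3) (L
    53)) (X2 6144 (L 3) (Y1 2048 (L 39) (Y2 2048 (X1 3072 (L 37) (Y1 1024 (L 37) (X1 1536 (L 37) (X2 3072
    (L 19) (L 19))))) (X1 3072 (L 2) (X2 3072 (L 3) (Y1 1024 (L 5) (X1 1536 (L 2) (L 19))))))))) (X2 6144
    (L 3) (L 112)))) (Y1 4096 (L 0) (Y2 4096 (X1 6144 (X2 6144 (X1 3072 (L 49) (X1 1536 (L 39) (L 39))) (L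
    27)) (X2 6144 (Y1 2048 (L 39) (Y2 2048 (X1 3072 (L 37) (X2 3072 (Y1 1024 (L 37) (Y2 1024 (X1 1536 (L
    24) (L 24)) (L 24))) (L 93))) (X1 3072 (L 39) (X1 1536 (L 39) (L 39))))) (L 27))) (L 27)))) (X2 12288
    (Y1 4096 (L 0) (Y2 4096 (X1 6144 (X2 6144 (L 55) (Y1 2048 (L 5) (Y2 2048 (Y1 1024 (L 5) (X1 3072 (X1
    1536 (X2 3072 (L 19) (X2 1536 (L 19) (L 58))) (L 38)) (L 38))) (Y1 1024 (L 5) (X2 3072 (L 91) (X2 1536
    (L 91) (L 91))))))) (L 99)) (X2 6144 (L 52) (L 112)))) (Y1 4096 (L 0) (Y2 4096 (X1 6144 (X2 6144 (Y1
    2048 (L 5) (Y2 2048 (X1 3072 (X2 3072 (X1 1536 (Y1 1024 (L 41) (X1 768 (L 24) (L 100))) (L 100)) (L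
    107)) (L 100)) (X2 3072 (X1 3072 (X2 1536 (Y1 1024 (L 5) (L 38)) (L 107)) (L 5)) (L 17)))) (L 11)) (L
    36)) (X1 6144 (L 83) (L 45)))))) (L 15))) (Y1 8192 (Y2 8192 (X1 12288 (X2 12288 (Y1 4096 (Y2 4096 (X1
    6144 (L 3) (X2 6144 (L 3) (Y1 2048 (Y2 2048 (X1 3072 (L 2) (X1 1536 (L 2) (X2 3072 (L 68) (Y1 1024 (L
    19) (L 16))))) (X1 3072 (L 3) (X2 3072 (L 3) (Y1 1024 (Y2 1024 (L 19) (L 19)) (L 16))))) (L 85)))) (L
    121)) (L 1)) (Y1 4096 (Y2 4096 (X1 6144 (X2 6144 (X1 3072 (L 13) (L 2)) (L 73)) (X2 6144 (Y1 2048 (Y2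
    2048 (X1 3072 (L 2) (X2 3072 (X1 1536 (L 2) (X2 1536 (L 19) (L 24))) (Y1 1024 (X1 1536 (L 24) (L 24))
    (L 24)))) (X1 3072 (L 2) (X2 3072 (Y1 1024 (X1 1536 (L 2) (L 19)) (L 16)) (L 17)))) (L 85)) (L 73)))
    (X2 6144 (L 17) (L 27))) (L 1))) (X2 12288 (Y1 4096 (Y2 4096 (X1 6144 (X2 6144 (Y2 2048 (L 42) (X1 3072
    (X1 1536 (L 3) (L 65)) (L 65))) (Y1 2048 (Y2 2048 (X1 3072 (X2 3072 (L 68) (Y1 1024 (Y2 1024 (X1 1536
    (L 19) (L 40)) (L 56)) (L 16))) (L 40)) (Y1 1024 (Y1 512 (Y2 1024 (L 56) (Y1 256 (L 91) (L 30))) (L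
    16)) (L 16))) (Y2 2048 (L 16) (L 16)))) (Y1 2048 (X1 3072 (L 34) (L 99)) (L 9))) (X2 6144 (L 52) (X2
    3072 (X1 6144 (L 52) (L 52)) (L 75)))) (L 1)) (Y1 4096 (Y2 4096 (X1 6144 (X2 6144 (Y1 2048 (Y2 2048 (X1
    3072 (Y1 1024 (X1 1536 (X2 3072 (X1 768 (L 19) (L 56)) (L 24)) (L 56)) (L 16)) (L 56)) (X2 3072 (X2
    1536 (X1 3072 (Y2 1024 (L 56) (L 17)) (L 34)) (L 17)) (L 17))) (L 16)) (L 11)) (Y1 2048 (Y2 2048 (L 61)
    (L 36)) (L 9))) (X2 6144 (L 17) (L 45))) (L 1)))) (L 15)) (L 1)))
      0 0 0 16384 24576 24576 32768 16384
      [(19325, 15860), (18930, 16329), (18524, 16788), (18106, 17238), (17678, 17677)]"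
    by code_simp
  from check_cone_big[OF library_sound _ this] show ?thesis by (simp add: dirs_ok_def)
qed

lemma cone_big_8: "cone_big (17678, 17677) (15860, 19325)"
proof -
  have "check library (
    Y1 16384 (Y1 8192 (L 0) (Y2 8192 (X1 12288 (X2 12288 (Y1 4096 (L 0) (Y2 4096 (X1 6144 (X1 3072 (L 3) (L
    3)) (X2 6144 (L 3) (Y1 2048 (L 5) (Y2 2048 (X1 3072 (L 2) (X2 3072 (Y1 1024 (L 5) (Y2 1024 (E 2 (L 19)
    (L 101)) (L 115))) (Y1 1024 (L 37) (Y2 1024 (X1 1536 (L 2) (X2 1536 (Y1 512 (L 19) (Y2 512 (Y1 256 (L
    19) (L 2)) (L 115))) (Y1 512 (L 37) (X1 768 (L 2) (E 2 (L 19) (X1 384 (L 2) (E 1 (L 58) (L 32))))))))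
    (X1 1536 (L 2) (X1 768 (L 37) (X2 1536 (L 115) (X1 384 (L 58) (Y1 512 (L 5) (L 58)))))))))) (X1 3072 (L
    3) (X2 3072 (L 3) (X1 1536 (L 2) (Y1 1024 (L 5) (X1 768 (L 2) (X1 384 (L 58) (L 91))))))))))) (X1 6144
    (L 3) (X2 6144 (L 3) (L 112))))) (Y1 4096 (L 0) (Y2 4096 (X1 6144 (L 35) (X2 6144 (Y1 2048 (Y2 2048 (L
    39) (L 5)) (Y2 2048 (X1 3072 (L 37) (X2 3072 (Y1 1024 (L 37) (Y2 1024 (X1 1536 (L 37) (X2 1536 (Y1 512
    (L 37) (X1 768 (L 90) (E 2 (L 58) (E 1 (L 58) (L 32))))) (X1 768 (Y1 512 (L 37) (L 90)) (Y1 512 (L 37)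
    (E 2 (L 24) (X1 384 (L 90) (Y1 256 (L 64) (L 90)))))))) (X1 1536 (L 35) (X1 768 (L 37) (Y1 512 (L 37)
    (Y1 256 (X1 384 (L 37) (L 64)) (L 58))))))) (X1 1536 (L 35) (X2 1536 (Y1 1024 (L 37) (Y2 1024 (E 2 (L
    93) (L 96)) (L 17))) (L 27))))) (X1 3072 (L 35) (X2 3072 (Y1 1024 (L 5) (Y2 1024 (X1 1536 (L 2) (X2
    1536 (L 58) (L 17))) (L 17))) (L 17))))) (L 27))) (L 27)))) (X2 12288 (Y1 4096 (L 0) (Y2 4096 (X1 6144
    (X2 6144 (L 42) (Y1 2048 (L 5) (Y2 2048 (X1 3072 (X2 3072 (Y1 1024 (L 5) (Y1 512 (L 5) (L 68))) (Y1
    1024 (L 5) (X1 1536 (X1 768 (X2 1536 (L 84) (X2 768 (L 84) (L 84))) (L 84)) (L 38)))) (X1 1536 (L 84)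
    (L 5))) (Y1 1024 (L 5) (X2 3072 (L 5) (L 91)))))) (L 99)) (X2 6144 (L 52) (L 112)))) (Y1 4096 (L 0) (Y2
    4096 (X1 6144 (X2 6144 (Y1 2048 (L 5) (Y2 2048 (X1 3072 (X1 1536 (Y1 1024 (L 41) (L 100)) (L 100)) (L
    64)) (X2 3072 (X1 3072 (X1 1536 (L 100) (L 100)) (L 5)) (L 11)))) (L 11)) (L 36)) (X1 6144 (L 83) (L
    45)))))) (L 15))) (Y1 8192 (Y2 8192 (X1 12288 (X2 12288 (Y1 4096 (Y2 4096 (X1 6144 (L 3) (X2 6144 (L 3)
    (Y1 2048 (Y2 2048 (X1 3072 (L 2) (X2 3072 (X1 1536 (L 3) (X1 768 (L 3) (L 68))) (Y1 1024 (X1 1536 (L 2)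
    (X1 768 (L 2) (X1 384 (L 2) (X1 192 (L 2) (L 2))))) (L 85)))) (X1 3072 (L 3) (X1 1536 (L 2) (L 115))))
    (L 85)))) (L 121)) (L 1)) (Y1 4096 (Y2 4096 (X1 6144 (L 35) (X2 6144 (Y1 2048 (Y2 2048 (X1 3072 (L 2)
    (X2 3072 (Y1 1024 (Y2 1024 (X1 1536 (L 2) (X2 1536 (X1 768 (L 2) (X1 384 (L 2) (X2 768 (E 2 (L 19) (L
    2)) (L 90)))) (L 90))) (X1 1536 (L 2) (X2 1536 (Y1 512 (X1 768 (L 2) (X1 384 (L 2) (L 58))) (L 2)) (L
    90)))) (L 85)) (Y1 1024 (Y2 1024 (L 90) (L 17)) (L 2)))) (X1 3072 (L 2) (X2 3072 (Y1 1024 (Y2 1024 (X1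
    1536 (L 2) (X2 1536 (L 58) (L 17))) (L 17)) (L 2)) (L 17)))) (L 85)) (L 73))) (X1 6144 (L 63) (X2 6144
    (L 17) (L 27)))) (L 1))) (X2 12288 (Y1 4096 (Y2 4096 (X1 6144 (X2 6144 (L 42) (Y1 2048 (Y2 2048 (X1
    3072 (X2 3072 (L 68) (Y1 1024 (Y2 1024 (X1 1536 (X2 1536 (X1 768 (X1 384 (X1 192 (L 2) (L 109)) (L
    109)) (L 40)) (Y1 512 (Y2 512 (X1 768 (Y1 256 (E 2 (L 19) (E 1 (L 19) (L 32))) (L 109)) (L 84)) (X1 768
    (X1 384 (E 2 (L 19) (E 1 (X1 192 (L 19) (L 44)) (L 32))) (L 44)) (L 84))) (L 40))) (L 40)) (X1 1536 (Y1
    512 (Y1 256 (Y1 128 (L 84) (E 2 (L 56) (L 44))) (L 109)) (L 40)) (L 40))) (L 16))) (L 40)) (Y1 1024 (Y2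
    1024 (L 56) (Y1 512 (L 91) (L 16))) (L 16))) (X1 3072 (L 16) (L 16)))) (X1 3072 (L 34) (X1 1536 (L 34)
    (L 9)))) (X2 6144 (L 52) (X2 3072 (L 122) (L 17)))) (L 1)) (Y1 4096 (Y2 4096 (X1 6144 (X2 6144 (Y1 2048
    (Y2 2048 (X1 3072 (X2 3072 (Y1 1024 (Y2 1024 (X1 1536 (X2 1536 (Y1 512 (X1 768 (E 2 (L 19) (E 1 (X1 384
    (L 58) (L 44)) (L 32))) (L 84)) (L 40)) (X1 768 (E 2 (L 24) (Y1 512 (E 1 (L 58) (L 32)) (L 40))) (L
    44))) (L 40)) (X1 1536 (X1 768 (Y1 512 (X2 1536 (E 2 (L 58) (L 44)) (L 100)) (L 40)) (L 44)) (L 56)))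
    (L 40)) (Y1 1024 (L 107) (L 40))) (X2 3072 (L 40) (L 11))) (X2 3072 (X1 3072 (X2 1536 (Y2 1024 (E 2 (L
    56) (L 102)) (L 17)) (L 17)) (L 34)) (L 11))) (L 16)) (L 11)) (X2 6144 (Y2 2048 (L 61) (L 11)) (L 11)))
    (X2 6144 (L 17) (L 45))) (L 1)))) (L 15)) (L 1)))
      0 0 0 16384 24576 24576 32768 16384
      [(17678, 17677), (17238, 18106), (16788, 18524), (16329, 18930), (15860, 19325)]"
    by code_simp
  from check_cone_big[OF library_sound _ this] show ?thesis by (simp add: dirs_ok_def)
qed

lemma cone_big_9: "cone_big (15860, 19325) (13890, 20786)"
proof -
  have "check library (
    Y1 16384 (Y1 8192 (L 0) (Y2 8192 (X1 12288 (X2 12288 (Y1 4096 (L 0) (Y2 4096 (X1 6144 (Y1 2048 (X1 3072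
    (L 3) (L 3)) (L 3)) (X2 6144 (L 3) (Y1 2048 (L 5) (Y2 2048 (X1 3072 (L 2) (X2 3072 (Y1 1024 (L 5) (L
    101)) (Y1 1024 (L 5) (X1 1536 (L 2) (X2 1536 (L 74) (X1 768 (L 32) (L 32))))))) (X1 3072 (L 2) (X2 3072
    (L 101) (Y1 1024 (L 5) (Y2 1024 (L 74) (L 74))))))))) (X2 6144 (L 3) (L 82)))) (Y1 4096 (L 0) (Y2 4096
    (X1 6144 (L 35) (X2 6144 (Y1 2048 (L 83) (Y2 2048 (X1 3072 (L 35) (X2 3072 (Y1 1024 (L 96) (Y2 1024 (X1
    1536 (L 96) (L 96)) (X1 1536 (L 32) (L 96)))) (X1 1536 (L 35) (X2 1536 (L 96) (L 27))))) (X1 3072 (L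
    35) (X1 1536 (L 35) (L 35))))) (L 27))) (L 83)))) (X2 12288 (Y1 4096 (L 0) (Y2 4096 (X1 6144 (X2 6144
    (L 42) (Y1 2048 (L 5) (Y2 2048 (X1 3072 (X2 3072 (X1 1536 (L 101) (L 44)) (X1 1536 (Y1 1024 (L 5) (X1
    768 (X1 384 (L 32) (L 64)) (L 44))) (L 64))) (L 5)) (X2 3072 (L 5) (Y1 1024 (L 5) (L 91)))))) (L 99))
    (X2 6144 (L 122) (L 82)))) (Y1 4096 (L 0) (Y2 4096 (X1 6144 (X2 6144 (Y1 2048 (L 5) (Y1 1024 (L 5) (X1
    3072 (X1 1536 (L 64) (L 64)) (X1 1536 (L 64) (L 5))))) (L 11)) (X2 6144 (L 99) (L 11))) (X1 6144 (L 83)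
    (L 45)))))) (L 15))) (Y1 8192 (Y2 8192 (X1 12288 (X2 12288 (Y1 4096 (Y2 4096 (X1 6144 (L 3) (X2 6144 (L
    3) (Y1 2048 (Y2 2048 (X1 3072 (L 2) (X1 1536 (L 2) (X1 768 (L 115) (Y1 1024 (X2 3072 (L 2) (L 108)) (L
    114))))) (X1 3072 (L 3) (X1 1536 (L 2) (X1 768 (L 2) (L 115))))) (L 114)))) (L 121)) (L 1)) (Y1 4096
    (Y2 4096 (X1 6144 (L 35) (X2 6144 (Y1 2048 (Y2 2048 (X1 3072 (L 2) (X2 3072 (X1 1536 (L 2) (Y1 1024 (X1
    768 (L 2) (X1 384 (L 32) (L 32))) (L 2))) (L 126))) (X1 3072 (L 2) (X1 1536 (L 2) (X1 768 (L 35) (X1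
    384 (L 35) (L 17)))))) (L 114)) (L 73))) (X1 6144 (L 63) (X2 6144 (L 17) (L 45)))) (L 1))) (X2 12288
    (Y1 4096 (Y2 4096 (X1 6144 (X2 6144 (L 42) (Y1 2048 (Y2 2048 (X1 3072 (X2 3072 (Y1 1024 (Y2 1024 (X1
    1536 (L 101) (L 68)) (L 68)) (L 68)) (Y1 1024 (X1 1536 (X1 768 (L 108) (X2 1536 (L 108) (L 44))) (L
    102)) (L 109))) (L 109)) (X1 3072 (X2 3072 (L 34) (X2 1536 (L 34) (Y1 1024 (Y2 1024 (L 102) (L 17)) (L
    34)))) (L 34))) (X1 3072 (X1 1536 (L 114) (L 97)) (L 97)))) (X1 3072 (L 34) (L 43))) (X1 6144 (L 34)
    (X1 3072 (L 34) (L 43)))) (L 1)) (Y1 4096 (Y2 4096 (X1 6144 (X2 6144 (Y1 2048 (Y2 2048 (X1 3072 (X2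
    3072 (Y1 1024 (X1 1536 (X1 768 (X2 1536 (L 32) (L 32)) (L 44)) (L 44)) (X1 1536 (X2 1536 (L 108) (L
    32)) (L 40))) (X1 1536 (Y1 1024 (L 64) (L 32)) (L 64))) (X2 3072 (L 44) (L 11))) (L 17)) (Y2 2048 (L
    40) (L 16))) (L 11)) (X2 6144 (Y2 2048 (L 61) (L 11)) (L 11))) (X2 6144 (L 17) (L 45))) (L 1)))) (L
    15)) (L 1)))
      0 0 0 16384 24576 24576 32768 16384
      [(15860, 19325), (15380, 19709), (14894, 20079), (14396, 20439), (13890, 20786)]"
    by code_simp
  from check_cone_big[OF library_sound _ this] show ?thesis by (simp add: dirs_ok_def)
qed

lemma cone_big_10: "cone_big (13890, 20786) (11783, 22049)"
proof -
  have "check library (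
    Y1 16384 (Y1 8192 (L 0) (Y2 8192 (X1 12288 (X2 12288 (Y1 4096 (L 0) (Y2 4096 (X1 6144 (X1 3072 (L 3)
    (X2 6144 (L 3) (L 3))) (X2 6144 (L 3) (Y1 2048 (L 5) (Y2 2048 (X1 3072 (X1 1536 (L 2) (L 2)) (X2 3072
    (L 74) (Y1 1024 (L 5) (L 32)))) (X1 3072 (L 2) (X2 3072 (L 74) (L 74))))))) (X2 6144 (L 3) (L 82))))
    (Y1 4096 (L 0) (Y2 4096 (X1 6144 (L 35) (X2 6144 (Y1 2048 (L 83) (Y2 2048 (X1 3072 (L 35) (X2 3072 (L
    96) (L 35))) (L 35))) (L 83))) (L 83)))) (X2 12288 (Y1 4096 (L 0) (Y2 4096 (X1 6144 (X2 6144 (L 42) (Y1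
    2048 (L 5) (Y1 1024 (L 5) (Y1 512 (L 5) (X1 3072 (X1 1536 (L 74) (Y2 2048 (L 102) (L 5))) (L 5)))))) (L
    43)) (X2 6144 (L 42) (L 82)))) (Y1 4096 (L 0) (Y2 4096 (X1 6144 (X2 6144 (Y1 2048 (L 5) (Y2 2048 (X1
    3072 (X2 3072 (X1 1536 (L 96) (L 64)) (L 83)) (L 64)) (L 82))) (L 11)) (X1 3072 (X2 6144 (L 99) (L 11))
    (L 11))) (X2 6144 (L 17) (L 45)))))) (L 15))) (Y1 8192 (Y2 8192 (X1 12288 (X2 12288 (Y1 4096 (Y2 4096
    (X1 6144 (L 3) (X2 6144 (L 42) (Y1 2048 (X1 3072 (L 2) (Y1 1024 (Y2 2048 (X2 3072 (L 101) (L 108)) (X1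
    1536 (L 2) (L 74))) (L 114))) (X1 3072 (L 106) (L 114))))) (X2 6144 (L 42) (X2 3072 (L 75) (X1 6144 (L
    3) (L 17))))) (L 1)) (Y1 4096 (Y2 4096 (X1 6144 (L 35) (X2 6144 (Y1 2048 (Y2 2048 (X1 3072 (L 2) (X2
    3072 (Y1 1024 (L 32) (L 32)) (L 78))) (L 78)) (L 78)) (L 35))) (X1 6144 (L 63) (L 73))) (L 1))) (X2
    12288 (Y1 4096 (Y2 4096 (X1 6144 (X2 6144 (L 42) (Y1 2048 (Y2 2048 (Y1 1024 (X1 3072 (X2 3072 (L 101)
    (L 108)) (L 102)) (L 97)) (X1 3072 (X2 3072 (X1 1536 (X1 768 (Y1 1024 (L 74) (L 97)) (L 34)) (L 34))
    (Y1 1024 (X1 1536 (L 74) (Y2 1024 (L 102) (L 34))) (L 97))) (L 34))) (L 97))) (L 43)) (X1 6144 (L 34)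
    (L 43))) (L 1)) (Y1 4096 (Y2 4096 (X1 6144 (X2 6144 (Y1 2048 (Y2 2048 (X1 3072 (X2 3072 (Y1 1024 (X1
    1536 (L 32) (X1 768 (L 44) (L 44))) (L 97)) (X1 1536 (X2 1536 (L 32) (L 11)) (L 11))) (X2 3072 (X1 1536
    (L 44) (L 44)) (L 11))) (X2 3072 (Y2 1024 (E 2 (L 17) (X1 3072 (L 78) (L 102))) (L 17)) (L 11))) (L
    97)) (L 11)) (X2 6144 (X2 3072 (Y2 2048 (L 44) (L 11)) (L 11)) (L 11))) (L 73)) (L 1)))) (L 15)) (L 1)))
      0 0 0 16384 24576 24576 32768 16384
      [(13890, 20786), (13375, 21121), (12851, 21444), (12322, 21752), (11783, 22049)]"
    by code_simp
  from check_cone_big[OF library_sound _ this] show ?thesis by (simp add: dirs_ok_def)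
qed

text \<open>From this cone on the second coordinates of the directions are at least 22049. The
  hexagon of polygon 25, made of the rectangle corners and the segment ends, has the sum 565247100 +
  65460 \<open>Im e\<close>, independent of \<open>x\<close> and \<open>y\<close> and above 2 * 10^9
  from \<open>Im e\<close> = 21919 on. It applies whenever \<open>x\<close> and \<open>y\<close>
  differ horizontally by at most 16365 + \<open>Re e\<close>, so \<open>L 25\<close> closes large
  boxes and the trees are small.\<close>

lemma cone_big_11: "cone_big (11783, 22049) (9567, 23097)"
proof -
  have "check library (
    Y1 16384 (Y1 8192 (L 0) (Y2 8192 (X1 12288 (L 25) (Y1 4096 (L 0) (X1 6144 (L 25) (X2 12288 (L 43) (X2
    6144 (X1 3072 (L 99) (L 36)) (L 36)))))) (L 15))) (Y1 8192 (Y2 8192 (X1 12288 (X2 12288 (Y1 4096 (X1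
    6144 (X1 3072 (L 3) (X1 1536 (L 3) (L 3))) (L 25)) (L 1)) (X1 6144 (L 49) (Y1 4096 (L 25) (L 1)))) (L
    25)) (L 15)) (L 1)))
      0 0 0 16384 24576 24576 32768 16384
      [(11783, 22049), (11241, 22330), (10688, 22600), (10131, 22855), (9567, 23097)]"
    by code_simp
  from check_cone_big[OF library_sound _ this] show ?thesis by (simp add: dirs_ok_def)
qed

lemma cone_big_12: "cone_big (9567, 23097) (7258, 23923)"
proof -
  have "check library (
    Y1 16384 (Y1 8192 (L 0) (Y2 8192 (X1 12288 (X1 6144 (X1 3072 (X2 12288 (Y1 4096 (L 0) (L 3)) (L 49)) (L
    25)) (L 25)) (Y1 4096 (L 0) (X1 6144 (L 25) (X2 12288 (L 43) (X2 6144 (L 82) (L 36)))))) (L 15))) (Y1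
    8192 (Y2 8192 (X1 12288 (Y1 4096 (X1 6144 (X2 12288 (X2 6144 (L 3) (L 49)) (L 49)) (L 25)) (L 1)) (X1
    6144 (L 25) (X2 12288 (L 43) (X2 6144 (X1 3072 (L 25) (L 43)) (L 73))))) (L 15)) (L 1)))
      0 0 0 16384 24576 24576 32768 16384
      [(9567, 23097), (8999, 23324), (8421, 23539), (7842, 23738), (7258, 23923)]"
    by code_simp
  from check_cone_big[OF library_sound _ this] show ?thesis by (simp add: dirs_ok_def)
qed

lemma cone_big_13: "cone_big (7258, 23923) (4875, 24520)"
proof -
  have "check library (
    Y1 16384 (Y1 8192 (L 0) (Y2 8192 (X1 12288 (X1 6144 (X2 12288 (X2 6144 (Y1 4096 (L 0) (L 3)) (L 49)) (L
    49)) (L 25)) (X2 12288 (X1 6144 (Y1 4096 (L 0) (L 25)) (L 43)) (X2 6144 (L 82) (Y2 4096 (L 11) (L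
    17))))) (L 15))) (Y1 8192 (Y2 8192 (X1 12288 (Y1 4096 (X1 6144 (X2 12288 (X2 6144 (L 3) (L 49)) (L 49))
    (L 25)) (L 1)) (X1 6144 (L 25) (X2 12288 (L 43) (X2 6144 (X1 3072 (L 25) (L 43)) (L 73))))) (L 15)) (L
    1)))
      0 0 0 16384 24576 24576 32768 16384
      [(7258, 23923), (6669, 24094), (6073, 24251), (5479, 24392), (4875, 24520)]"
    by code_simp
  from check_cone_big[OF library_sound _ this] show ?thesis by (simp add: dirs_ok_def)
qed

lemma cone_big_14: "cone_big (4875, 24520) (2451, 24879)"
proof -
  have "check library (
    Y1 16384 (Y1 8192 (L 0) (Y2 8192 (X1 12288 (X1 6144 (X2 12288 (X2 6144 (Y1 4096 (L 0) (L 3)) (L 49)) (L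
    49)) (L 25)) (X2 12288 (X2 6144 (Y1 4096 (L 0) (L 42)) (L 128)) (X2 6144 (L 82) (Y2 4096 (L 11) (L
    45))))) (L 15))) (Y1 8192 (Y2 8192 (X1 12288 (X2 12288 (Y1 4096 (X2 6144 (L 42) (X1 6144 (L 49) (X1
    3072 (Y2 4096 (X2 3072 (L 42) (L 78)) (L 122)) (L 25)))) (L 1)) (X2 6144 (Y2 4096 (L 78) (Y2 2048 (L
    78) (L 15))) (L 126))) (X1 6144 (L 25) (X2 12288 (L 43) (X2 6144 (X1 3072 (L 25) (L 43)) (L 73))))) (L
    15)) (L 1)))
      0 0 0 16384 24576 24576 32768 16384
      [(4875, 24520), (4273, 24632), (3669, 24729), (3060, 24812), (2451, 24879)]"
    by code_simp
  from check_cone_big[OF library_sound _ this] show ?thesis by (simp add: dirs_ok_def)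
qed

lemma cone_big_15: "cone_big (2451, 24879) (0, 25000)"
proof -
  have "check library (
    Y1 16384 (Y1 8192 (L 0) (Y2 8192 (X1 12288 (Y1 4096 (L 0) (X1 6144 (X2 12288 (X2 6144 (L 3) (L 49)) (L
    49)) (L 25))) (X2 12288 (X2 6144 (Y1 4096 (L 0) (L 42)) (L 128)) (X2 6144 (L 82) (Y2 4096 (L 11) (L
    45))))) (L 15))) (Y1 8192 (Y2 8192 (X1 12288 (X2 12288 (X2 6144 (Y1 4096 (L 42) (L 1)) (Y2 4096 (X1
    6144 (L 49) (Y1 4096 (X1 3072 (X2 3072 (L 42) (L 78)) (L 25)) (L 1))) (L 122))) (X2 6144 (Y2 4096 (L
    78) (Y2 2048 (L 78) (L 15))) (L 126))) (X2 12288 (Y1 4096 (X1 6144 (L 25) (X1 3072 (X1 1536 (L 25) (L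
    43)) (L 43))) (L 1)) (Y1 4096 (X1 6144 (L 25) (X2 6144 (X1 3072 (X1 1536 (L 25) (L 43)) (L 43)) (L
    73))) (L 1)))) (L 15)) (L 1)))
      0 0 0 16384 24576 24576 32768 16384
      [(2451, 24879), (1839, 24932), (1224, 24970), (614, 24992), (0, 25000)]"
    by code_simp
  from check_cone_big[OF library_sound _ this] show ?thesis by (simp add: dirs_ok_def)
qed

lemma cone_big_quadrant: "cone_big (25000, 0) (0, 25000)"
  by (intro cone_big_trans[OF cone_big_0] cone_big_trans[OF cone_big_1] cone_big_trans[OF cone_big_2] cone_big_trans[OF cone_big_3] cone_big_trans[OF cone_big_4] cone_big_trans[OF cone_big_5] cone_big_trans[OF cone_big_6] cone_big_trans[OF cone_big_7] cone_big_trans[OF cone_big_8] cone_big_trans[OF cone_big_9] cone_big_trans[OF cone_big_10] cone_big_trans[OF cone_big_11] cone_big_trans[OF cone_big_12] cone_big_trans[OF cone_big_13] cone_big_trans[OF cone_big_14] cone_big_15)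

theorem theorem1:
  fixes S :: "complex set"
  assumes "convex S"
    and "contains_copy S circ1"
    and "contains_copy S seg_half"
    and "contains_copy S rect"
  shows "emeasure lebesgue S \<ge> ennreal 0.1"
  using assms
  by (rule contains_copies_measure)
    (rule config_big[OF ctab_ok_circle_table far_ok_circle_table cone_big_quadrant])

end
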